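(* Let $\Theta=z\frac{\partial}{\partial z}$. The differential operator $$\begin{aligned} D_Y ={}& 7^{2}\Theta^4-7z\left(1135\Theta^4+2204\Theta^3+1683\Theta^2+581\Theta+77\right)\\ &+z^{2}\left(28723\Theta^4+40708\Theta^3+13260\Theta^2-1337\Theta-896\right)\\ &-z^{3}\left(32126\Theta^4+38514\Theta^3+26511\Theta^2+10731\Theta+1806\right)\\ &+77z^{4}\left(130\Theta^4+254\Theta^3+192\Theta^2+65\Theta+8\right)+11^{2}z^{5}(\Theta+1)^4 \end{aligned}$$ annihilates the power series $$\Phi_0(z)=\sum_{n=0}^\infty\ \sum_{\substack{\underline m\in\mathbb Z_{\ge0}^{12}\\ f_i(\underline m)\ge0\ \forall i\\ m_4+\dots+m_{11}=n}}\frac{(n!)^3}{m_0!\cdots m_{11}!\,f_1(\underline m)!\cdots f_6(\underline m)!}\,z^n ,$$ that is, $D_Y\Phi_0(z)=0$, and hence $D_Y$ is the mirror Picard--Fuchs operator for the family $\mathcal Y$.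
   Context: Here $\underline m=(m_0,\dots,m_{11})$ and $f_1,\dots,f_6$ are the integral linear forms $$\begin{aligned} f_1&=-m_1-m_2+m_4+m_5+m_6,\\ f_2&=m_0-m_1-m_2-m_3+m_4+m_5+2m_6+m_8+m_9+m_{10}+2m_{11},\\ f_3&=-m_1-m_3+m_5+m_6+m_7+m_8+m_{10}+m_{11},\\ f_4&=-m_3+m_7+m_8+m_9+m_{10}+m_{11},\\ f_5&=-m_0+m_1+m_3-m_6-m_8-m_{11},\\ f_6&=-m_0+m_1+m_2+m_3-m_5-m_6-m_{10}-m_{11}. \end{aligned}$$ $\mathbb C[z,\Theta]$ is the (non-commutative) ring of operators on $\mathbb C[[z]]$ generated by multiplication by $z$ and $\Theta$, with $[\Theta,z]=z$; every operator can be written as $z^mP_0(\Theta)+z^{m-1}P_1(\Theta)+\dots+P_m(\Theta)$ with polynomials $P_k$. $\mathcal Y$ is the family of Calabi--Yau threefolds $V(M\cdot v,\operatorname{Pf}(M))\subset\mathbb P^8$, with $M$ a general $6\times6$ skew-symmetric matrix and $v$ a general $6\times1$ column of linear forms. $\Phi_0(z)$ is the power series ("mirror principal period") attached to $\mathcal Y$ by Batyrev's construction from a small toric degeneration. The mirror Picard--Fuchs operator for $\mathcal Y$ is, by definition, the operator $D\in\mathbb C[z,\Theta]$ (considered up to a polynomial factor in $\mathbb C[z]$) that (i) has $\Theta$-degree $4$; (ii) has $0$ as its unique indicial root, i.e. $P_m(\Theta)$ is proportional to $\Theta^4$; (iii) satisfies $D\Phi_0(z)=0$. *)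

theory Defs
  imports "HOL-Computational_Algebra.Computational_Algebra" "HOL-Library.FuncSet"
begin

section \<open>The ring of operators generated by multiplication by z and Theta\<close>

type_synonym operator = "complex fps \<Rightarrow> complex fps"

definition theta :: operator where
  "theta f = fps_X * fps_deriv f"

text \<open>The product of the ring is composition of operators.\<close>

inductive_set diff_ops :: "operator set" where
  const: "(\<lambda>f. fps_const c * f) \<in> diff_ops"
| z: "(\<lambda>f. fps_X * f) \<in> diff_ops"
| theta: "theta \<in> diff_ops"
| add: "A \<in> diff_ops \<Longrightarrow> B \<in> diff_ops \<Longrightarrow> (\<lambda>f. A f + B f) \<in> diff_ops"
| mult: "A \<in> diff_ops \<Longrightarrow> B \<in> diff_ops \<Longrightarrow> A \<circ> B \<in> diff_ops"

definition theta_poly :: "complex poly \<Rightarrow> operator" where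
  "theta_poly p f = (\<Sum>j\<le>degree p. fps_const (coeff p j) * (theta ^^ j) f)"

text \<open>
  The bivariate polynomial \<open>P\<close> encodes the operator with powers of \<open>z\<close> on the left: the
  coefficient of \<open>z^k\<close> is the polynomial \<open>coeff P k\<close> in Theta. In the notation
  \<open>z^m P_0(\<Theta>) + z^(m-1) P_1(\<Theta>) + \<dots> + P_m(\<Theta>)\<close>, the polynomial \<open>coeff P k\<close> is \<open>P_(m-k)\<close>;
  in particular \<open>coeff P 0\<close> is \<open>P_m\<close>, whose roots are the indicial roots.
\<close>

definition normal_op :: "complex poly poly \<Rightarrow> operator" where
  "normal_op P f = (\<Sum>k\<le>degree P. fps_X ^ k * theta_poly (coeff P k) f)"

definition theta_degree :: "complex poly poly \<Rightarrow> nat" where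
  "theta_degree P = Max ((\<lambda>k. degree (coeff P k)) ` {..degree P})"

lemma theta_nth: "fps_nth (theta f) n = of_nat n * fps_nth f n"
  by (cases n) (simp_all add: theta_def)

lemma theta_funpow_nth: "fps_nth ((theta ^^ j) f) n = of_nat n ^ j * fps_nth f n"
  by (induction j) (simp_all add: theta_nth)

lemma theta_poly_nth: "fps_nth (theta_poly p f) n = poly p (of_nat n) * fps_nth f n"
  by (simp add: theta_poly_def theta_funpow_nth fps_sum_nth poly_altdef sum_distrib_right mult.assoc)

lemma normal_op_nth:
  "fps_nth (normal_op P f) n =
     (\<Sum>k\<le>n. poly (coeff P k) (of_nat (n - k)) * fps_nth f (n - k))"
proof -
  have "fps_nth (normal_op P f) n =
      (\<Sum>k\<le>degree P. if k \<le> n then poly (coeff P k) (of_nat (n - k)) * fps_nth f (n - k) else 0)"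
    by (auto simp: normal_op_def fps_sum_nth fps_X_power_mult_nth theta_poly_nth intro!: sum.cong)
  also have "\<dots> = (\<Sum>k\<in>{..degree P} \<inter> {..n}. poly (coeff P k) (of_nat (n - k)) * fps_nth f (n - k))"
    by (subst sum.inter_restrict) (simp_all cong: if_cong)
  also have "\<dots> = (\<Sum>k\<le>n. poly (coeff P k) (of_nat (n - k)) * fps_nth f (n - k))"
    by (rule sum.mono_neutral_left) (auto simp: coeff_eq_0)
  finally show ?thesis .
qed

lemma normal_op_unique:
  assumes "normal_op P = normal_op Q"
  shows "P = Q"
proof (rule poly_eqI)
  fix k
  have "poly (coeff R k) (of_nat n) = fps_nth (normal_op R (fps_X ^ n)) (n + k)" for R n
  proof -
    have "fps_nth (normal_op R (fps_X ^ n)) (n + k) =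
        (\<Sum>i\<le>n+k. if i = k then poly (coeff R k) (of_nat n) else 0)"
      unfolding normal_op_nth by (intro sum.cong) (auto simp: fps_X_power_nth)
    then show ?thesis by simp
  qed
  then have "poly (coeff P k - coeff Q k) (of_nat n) = 0" for n
    using assms by simp
  then have "range of_nat \<subseteq> {x. poly (coeff P k - coeff Q k) x = 0}"
    by auto
  moreover have "infinite (range (of_nat :: nat \<Rightarrow> complex))"
    using inj_of_nat by (rule range_inj_infinite)
  ultimately show "coeff P k = coeff Q k"
    using poly_roots_finite finite_subset by (metis right_minus_eq)
qed

lemma normal_op_add: "(\<lambda>f. normal_op P f + normal_op Q f) = normal_op (P + Q)"
  by (rule ext, rule fps_ext) (simp add: normal_op_nth sum.distrib algebra_simps)

lemma normal_op_pCons: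
  "normal_op (pCons p P) f = theta_poly p f + fps_X * normal_op P f"
proof (rule fps_ext)
  fix n
  show "fps_nth (normal_op (pCons p P) f) n = fps_nth (theta_poly p f + fps_X * normal_op P f) n"
    by (cases n)
      (simp_all add: normal_op_nth theta_poly_nth sum.atMost_Suc_shift del: sum.atMost_Suc of_nat_diff)
qed

lemma normal_op_monom: "normal_op (monom p k) f = fps_X ^ k * theta_poly p f"
proof (induction k)
  case 0
  have "normal_op 0 f = 0" by (rule fps_ext) (simp add: normal_op_nth)
  then show ?case by (simp add: monom_0 normal_op_pCons)
next
  case (Suc k)
  have "theta_poly 0 f = 0" by (simp add: theta_poly_def)
  then show ?case by (simp add: monom_Suc normal_op_pCons Suc mult.assoc)
qed

lemma normal_op_sum:
  "finite I \<Longrightarrow> normal_op (\<Sum>i\<in>I. P i) f = (\<Sum>i\<in>I. normal_op (P i) f)"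
proof (induction I rule: finite_induct)
  case empty
  show ?case by (simp, rule fps_ext) (simp add: normal_op_nth)
next
  case (insert i I)
  then show ?case by (simp flip: normal_op_add)
qed

lemma theta_poly_comm:
  "theta_poly p (fps_X ^ k * theta_poly q f) =
     fps_X ^ k * theta_poly (pcompose p [:of_nat k, 1:] * q) f"
  by (rule fps_ext) (auto simp: theta_poly_nth fps_X_power_mult_nth poly_pcompose of_nat_diff)

lemma theta_poly_sum: "finite I \<Longrightarrow> theta_poly p (\<Sum>i\<in>I. g i) = (\<Sum>i\<in>I. theta_poly p (g i))"
  by (rule fps_ext) (simp add: theta_poly_nth fps_sum_nth sum_distrib_left)

lemma normal_op_comp: "\<exists>R. normal_op P \<circ> normal_op Q = normal_op R"
proof
  let ?R = "\<Sum>k\<le>degree P. \<Sum>l\<le>degree Q.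
              monom (pcompose (coeff P k) [:of_nat l, 1:] * coeff Q l) (k + l)"
  show "normal_op P \<circ> normal_op Q = normal_op ?R"
  proof
    fix f
    have "(normal_op P \<circ> normal_op Q) f = (\<Sum>k\<le>degree P. \<Sum>l\<le>degree Q.
        fps_X ^ k * theta_poly (coeff P k) (fps_X ^ l * theta_poly (coeff Q l) f))"
      by (simp add: normal_op_def[of P] normal_op_def[of Q] theta_poly_sum sum_distrib_left)
    also have "\<dots> = normal_op ?R f"
      by (simp add: normal_op_sum normal_op_monom theta_poly_comm power_add mult.assoc)
    finally show "(normal_op P \<circ> normal_op Q) f = normal_op ?R f" .
  qed
qed

lemma fps_sum_in_diff_ops:
  assumes "\<And>i. i \<le> n \<Longrightarrow> A i \<in> diff_ops"
  shows "(\<lambda>f. \<Sum>i\<le>(n::nat). A i f) \<in> diff_ops"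
  using assms
proof (induction n)
  case 0
  then show ?case by simp
next
  case (Suc n)
  then show ?case using diff_ops.add[of "\<lambda>f. \<Sum>i\<le>n. A i f" "A (Suc n)"] by simp
qed

theorem diff_ops_eq_range_normal_op: "diff_ops = range normal_op"
proof
  show "diff_ops \<subseteq> range normal_op"
  proof
    fix D assume "D \<in> diff_ops"
    then show "D \<in> range normal_op"
    proof induction
      case (const c)
      have "(\<lambda>f. fps_const c * f) = normal_op (monom [:c:] 0)"
        by (rule ext, subst normal_op_monom) (simp add: theta_poly_def)
      then show ?case by blast
    next
      case z
      have "(\<lambda>f. fps_X * f) = normal_op (monom [:1:] 1)"
        by (rule ext, subst normal_op_monom) (simp add: theta_poly_def)
      then show ?case by blast
    next
      case theta
      have "theta = normal_op (monom [:0, 1:] 0)"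
        by (rule ext, subst normal_op_monom) (simp add: theta_poly_def)
      then show ?case by blast
    next
      case (add A B)
      then show ?case using normal_op_add by (auto simp: image_iff)
    next
      case (mult A B)
      then obtain P Q where "A = normal_op P" "B = normal_op Q" by blast
      then show ?case using normal_op_comp[of P Q] by (metis rangeI)
    qed
  qed
  have one: "(\<lambda>f. f) \<in> diff_ops"
  proof -
    have "(\<lambda>f :: complex fps. fps_const 1 * f) = (\<lambda>f. f)" by (rule ext) simp
    then show ?thesis using diff_ops.const[of 1] by metis
  qed
  have X: "(\<lambda>f. fps_X ^ k * f) \<in> diff_ops" for k
  proof (induction k)
    case 0
    then show ?case using one by simp
  next
    case (Suc k)
    then show ?case using diff_ops.mult[OF diff_ops.z Suc] by (simp add: o_def mult.assoc)
  qed
  have T: "theta ^^ k \<in> diff_ops" for k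
  proof (induction k)
    case 0
    then show ?case using one by (simp add: id_def)
  next
    case (Suc k)
    then show ?case using diff_ops.mult[OF diff_ops.theta Suc] by (simp add: o_def)
  qed
  have "theta_poly p \<in> diff_ops" for p
  proof -
    have "(\<lambda>f. fps_const (coeff p j) * (theta ^^ j) f) \<in> diff_ops" for j
      using diff_ops.mult[OF diff_ops.const[of "coeff p j"] T[of j]] by (simp add: o_def)
    then show ?thesis
      unfolding theta_poly_def[abs_def] by (intro fps_sum_in_diff_ops)
  qed
  then have "(\<lambda>f. fps_X ^ k * theta_poly p f) \<in> diff_ops" for k p
    using diff_ops.mult[OF X[of k]] by (fastforce simp: o_def)
  then have "normal_op P \<in> diff_ops" for P
    unfolding normal_op_def[abs_def] by (intro fps_sum_in_diff_ops)
  then show "range normal_op \<subseteq> diff_ops" by blast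
qed

section \<open>Mirror Picard--Fuchs operators\<close>

text \<open>
  Because of the requirement \<open>c \<noteq> 0\<close>, the number 0 is the unique root of the indicial
  polynomial \<open>coeff P 0\<close>.
\<close>

definition mirror_PF_conditions :: "complex fps \<Rightarrow> operator \<Rightarrow> bool" where
  "mirror_PF_conditions \<Phi> D \<longleftrightarrow>
     D \<in> diff_ops \<and>
     (\<exists>P. D = normal_op P \<and> theta_degree P = 4 \<and> (\<exists>c. c \<noteq> 0 \<and> coeff P 0 = monom c 4)) \<and>
     D \<Phi> = 0"

definition eq_up_to_poly_factor :: "operator \<Rightarrow> operator \<Rightarrow> bool" where
  "eq_up_to_poly_factor D E \<longleftrightarrow>
     (\<exists>p q :: complex poly. p \<noteq> 0 \<and> q \<noteq> 0 \<and>
        (\<forall>f. fps_of_poly p * D f = fps_of_poly q * E f))"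

text \<open>
  ``The'' operator satisfying the conditions, considered up to a polynomial factor: the conditions
  hold for \<open>D\<close>, and they determine \<open>D\<close> up to factors in \<open>\<complex>[z]\<close>. The family enters only through
  its mirror principal period \<open>\<Phi>\<close>.
\<close>

definition is_mirror_Picard_Fuchs_operator :: "complex fps \<Rightarrow> operator \<Rightarrow> bool" where
  "is_mirror_Picard_Fuchs_operator \<Phi> D \<longleftrightarrow>
     mirror_PF_conditions \<Phi> D \<and>
     (\<forall>E. mirror_PF_conditions \<Phi> E \<longrightarrow> eq_up_to_poly_factor D E)"

section \<open>The power series and the operator\<close>

definition lin_forms :: "(nat \<Rightarrow> int) \<Rightarrow> int list" where
  "lin_forms m =
    [- m 1 - m 2 + m 4 + m 5 + m 6,
     m 0 - m 1 - m 2 - m 3 + m 4 + m 5 + 2 * m 6 + m 8 + m 9 + m 10 + 2 * m 11,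
     - m 1 - m 3 + m 5 + m 6 + m 7 + m 8 + m 10 + m 11,
     - m 3 + m 7 + m 8 + m 9 + m 10 + m 11,
     - m 0 + m 1 + m 3 - m 6 - m 8 - m 11,
     - m 0 + m 1 + m 2 + m 3 - m 5 - m 6 - m 10 - m 11]"

definition index_set :: "nat \<Rightarrow> (nat \<Rightarrow> nat) set" where
  "index_set n = {m \<in> {..<12} \<rightarrow>\<^sub>E UNIV.
     (\<forall>x\<in>set (lin_forms (\<lambda>i. int (m i))). x \<ge> 0) \<and> (\<Sum>i=4..11. m i) = n}"

definition Phi_0 :: "complex fps" where
  "Phi_0 = Abs_fps (\<lambda>n. \<Sum>m\<in>index_set n.
     fact n ^ 3 /
       ((\<Prod>i<12. fact (m i)) * (\<Prod>x\<leftarrow>lin_forms (\<lambda>i. int (m i)). fact (nat x))))"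

lemma finite_index_set: "finite (index_set n)"
proof (rule finite_subset)
  show "index_set n \<subseteq> {..<12} \<rightarrow>\<^sub>E {..2 * n}"
  proof
    fix m assume m: "m \<in> index_set n"
    have "(\<Sum>i=4..11. m i) = n" using m by (simp add: index_set_def)
    then have s: "m 4 + m 5 + m 6 + m 7 + m 8 + m 9 + m 10 + m 11 = n"
      by (simp add: numeral_eq_Suc)
    have f: "int (m 1) + int (m 2) \<le> int (m 4) + int (m 5) + int (m 6)"
      "int (m 3) \<le> int (m 7) + int (m 8) + int (m 9) + int (m 10) + int (m 11)"
      "int (m 0) + int (m 6) + int (m 8) + int (m 11) \<le> int (m 1) + int (m 3)"
      using m by (auto simp: index_set_def lin_forms_def)
    have "m i \<le> 2 * n" if "i < 12" for i
    proof -
      have "i \<in> {0, 1, 2, 3, 4, 5, 6, 7, 8, 9, 10, 11}" using that by (simp, presburger)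
      then show ?thesis
        by (elim insertE emptyE) (use s f in \<open>simp_all\<close>)
    qed
    then show "m \<in> {..<12} \<rightarrow>\<^sub>E {..2 * n}"
      using m by (auto simp: index_set_def PiE_def Pi_def)
  qed
  show "finite ({..<12} \<rightarrow>\<^sub>E {..2 * n} :: (nat \<Rightarrow> nat) set)"
    by (intro finite_PiE) auto
qed

definition D_Y :: operator where
  "D_Y f =
     7^2 * (theta ^^ 4) f
     - 7 * fps_X * theta_poly [:77, 581, 1683, 2204, 1135:] f
     + fps_X^2 * theta_poly [:- 896, - 1337, 13260, 40708, 28723:] f
     - fps_X^3 * theta_poly [:1806, 10731, 26511, 38514, 32126:] f
     + 77 * fps_X^4 * theta_poly [:8, 65, 192, 254, 130:] f
     + 11^2 * fps_X^5 * theta_poly ([:1, 1:] ^ 4) f"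

end

theory Submission
  imports Defs "HOL-Analysis.Binary_Product_Measure"
begin

text \<open>
  Why the coefficients \<open>A n\<close> of the period satisfy the recurrence. In the summand of \<open>Phi_0\<close> all
  eighteen factorials in the denominator are factorials of integral linear forms. In suitable
  coordinates on the lattice of exponents the eleven-fold sum (the equation
  \<open>m\<^sub>4 + \<dots> + m\<^sub>1\<^sub>1 = n\<close> removes one of the twelve variables) can be evaluated by repeated use of the
  Chu--Vandermonde identity, down to a double sum
  (lemmas \<open>Chu_Vandermonde_zsum\<close>, \<open>eleven_fold_sum_eq_double_sum\<close>, \<open>Phi_0_nth\<close>):
  \<open>A n = \<Sum>j k. (n choose k)^2 (2n-k choose n) (n choose j) (2n-j choose n) (2n-k choose j)\<close>.
  The sums of this hypergeometric term against polynomial weights in \<open>j\<close> and \<open>k\<close> contain a space of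
  rank three that is stable under \<open>n \<rightarrow> n + 1\<close>. Creative telescoping gives the first-order
  system for a basis \<open>A, J, H\<close> of it (\<open>weighted_sum_step\<close>, \<open>first_order_system\<close>). Summing the terms
  of the recurrence from the highest index downwards and rewriting each partial sum in \<open>A, J, H\<close> at the
  next lower index, one ends with 0 (\<open>carry_step\<close>, \<open>seqA_recurrence\<close>), and this is \<open>D_Y Phi_0 = 0\<close>.

  Why \<open>D_Y\<close> is the only such operator. If \<open>E\<close> is another one, a combination of \<open>D_Y\<close> and \<open>E\<close> with
  coefficients in \<open>\<complex>[z]\<close> cancels \<open>\<Theta>\<^sup>4\<close> and still annihilates \<open>Phi_0\<close>, so it is enough that no nonzero operator
  of order at most 3 does (\<open>no_lower_order_annihilator\<close>). Let \<open>L\<close> be an annihilator of least order \<open>r\<close>.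
  By division with remainder it is a right factor of \<open>D_Y\<close> (\<open>right_factor_exists\<close>). As \<open>D_Y\<close> is Fuchsian,
  the local exponents of \<open>L\<close> at every point are \<open>r\<close> of the four exponents of \<open>D_Y\<close>
  (\<open>indicial_right_factor\<close>). The latter are \<open>0, 0, 0, 0\<close> at 0; \<open>1, 1, 1, 1\<close> at infinity; \<open>0, 1, 1, 2\<close> at
  the three roots of \<open>1 - 159z + 84z\<^sup>2 + z\<^sup>3\<close>; \<open>0, 1, 3, 4\<close> at \<open>7/11\<close>; and \<open>0, 1, 2, 3\<close> elsewhere. The
  quotient \<open>b/a\<close> of the two highest coefficients of \<open>L\<close> (with respect to \<open>d/dz\<close>) has at \<open>p\<close> the residue
  \<open>(r choose 2) - S\<close>, where \<open>S\<close> is the sum of the exponents of \<open>L\<close> at \<open>p\<close> (\<open>residue_at\<close>). The residues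
  at the finite points add up to \<open>(r choose 2) + r\<close>, by the exponents at infinity (\<open>sum_of_residues\<close>).
  The point 0 contributes \<open>(r choose 2)\<close>, so the other points must contribute \<open>r\<close>. For \<open>r \<le> 2\<close> none of
  them has a positive residue; for \<open>r = 3\<close> the three roots of the cubic contribute at most 1 each, the
  point \<open>7/11\<close> at most \<open>-1\<close> and the remaining points nothing positive. Either way the total is less
  than \<open>r\<close>.
\<close>

section \<open>Reciprocal factorials and sums over the integers\<close>

text \<open>
  With the value 0 at negative integers, the conditions that linear forms be nonnegative become part
  of the summand, and the sums may range over all integers.
\<close>

definition invf :: "int \<Rightarrow> real" where
  "invf x = (if x < 0 then 0 else 1 / fact (nat x))"

definition factz :: "int \<Rightarrow> real" where
  "factz x = fact (nat x)"

lemma invf_rec: "of_int x * invf x = invf (x - 1)"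
proof (cases "x > 0")
  case True
  then have "nat x = Suc (nat (x - 1))" by simp
  then have "fact (nat x) = of_int x * (fact (nat (x - 1)) :: real)"
    using True by (simp add: fact_Suc)
  then show ?thesis using True by (simp add: invf_def)
qed (auto simp: invf_def)

lemma factz_rec: "x \<ge> 1 \<Longrightarrow> factz x = of_int x * factz (x - 1)"
proof -
  assume "x \<ge> 1"
  then have "nat x = Suc (nat (x - 1))" by simp
  then show ?thesis using \<open>x \<ge> 1\<close> by (simp add: factz_def fact_Suc)
qed

text \<open>
  For values in \<^typ>\<open>ennreal\<close> sums over the integers can be interchanged, shifted and reflected without
  any condition of summability.
\<close>

definition zsum :: "(int \<Rightarrow> ennreal) \<Rightarrow> ennreal" (binder "\<Sum>\<^sub>\<int> " 10) where
  "zsum f = (\<integral>\<^sup>+ x. f x \<partial>count_space UNIV)"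

lemma zsum_cmult: "(\<Sum>\<^sub>\<int> x. c * f x) = c * (\<Sum>\<^sub>\<int> x. f x)"
  by (simp add: zsum_def nn_integral_cmult)

lemma zsum_swap: "(\<Sum>\<^sub>\<int> x. \<Sum>\<^sub>\<int> y. f x y) = (\<Sum>\<^sub>\<int> y. \<Sum>\<^sub>\<int> x. f x y)"
  unfolding zsum_def
  using nn_integral_fst_count_space[of "\<lambda>(x, y). f x y"]
    nn_integral_snd_count_space[of "\<lambda>(x, y). f x y"] by simp

lemma zsum_reflect: "(\<Sum>\<^sub>\<int> x. f (c - x)) = (\<Sum>\<^sub>\<int> x. f x)"
  unfolding zsum_def
  by (rule nn_integral_bij_count_space) (rule bij_betwI[of _ _ _ "\<lambda>x. c - x"], auto)

lemma zsum_shift: "(\<Sum>\<^sub>\<int> x. f (x + c)) = (\<Sum>\<^sub>\<int> x. f x)"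
  unfolding zsum_def
  by (rule nn_integral_bij_count_space) (rule bij_betwI[of _ _ _ "\<lambda>x. x - c"], auto)

lemma zsum_finite:
  assumes "finite A" "\<And>x. x \<notin> A \<Longrightarrow> f x = 0"
  shows "(\<Sum>\<^sub>\<int> x. f x) = (\<Sum>x\<in>A. f x)"
  unfolding zsum_def using assms by (intro nn_integral_count_space') auto

lemma nn_integral_count_space_Pair:
  "(\<integral>\<^sup>+ z. f z \<partial>count_space UNIV) = (\<Sum>\<^sub>\<int> x. \<integral>\<^sup>+ y. f (x, y) \<partial>count_space UNIV)"
  unfolding zsum_def by (rule nn_integral_fst_count_space[symmetric])

definition I :: "int \<Rightarrow> ennreal" where "I x = ennreal (invf x)"

definition F :: "int \<Rightarrow> ennreal" where "F x = ennreal (factz x)"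

lemma invf_nonneg: "invf x \<ge> 0"
  by (simp add: invf_def)

lemma factz_pos: "factz x > 0"
  by (simp add: factz_def)

lemma I_nonzero: "I x \<noteq> 0 \<Longrightarrow> x \<ge> 0"
  by (auto simp: I_def invf_def split: if_splits)

text \<open>
  For cancelling a factorial produced by the Chu--Vandermonde identity against a reciprocal factorial:
  the other reciprocal factorials, collected in \<open>A\<close>, vanish when the argument \<open>x\<close> is negative.
\<close>

lemma cancel_fact:
  assumes "A \<noteq> 0 \<Longrightarrow> x \<ge> 0"
  shows "A * (F x * I x) = A"
proof (cases "A = 0")
  case False
  then have "factz x * invf x = 1" using assms by (simp add: invf_def factz_def)
  then have "F x * I x = 1"
    using factz_pos[of x] by (simp add: F_def I_def ennreal_mult''[symmetric] invf_nonneg)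
  then show ?thesis by simp
qed simp

lemma binomial_invf:
  "real (m choose k) = fact m * invf (int k) * invf (int m - int k)"
proof (cases "k \<le> m")
  case True
  then have "nat (int m - int k) = m - k" by simp
  then show ?thesis using True by (simp add: invf_def binomial_fact)
qed (simp add: invf_def)

text \<open>
  This is \<open>\<Sum>x. (q choose x) (p + r choose p - x) = (p + q + r choose p)\<close>, divided by \<open>q! (p + r)!\<close>. If one of
  \<open>p\<close>, \<open>q\<close>, \<open>p + r\<close>, \<open>q + r\<close> is negative, some factor on each side is a reciprocal factorial of a negative number,
  so that both sides are 0; hence the identity can be iterated without side conditions.
\<close>

lemma Chu_Vandermonde_zsum:
  "(\<Sum>\<^sub>\<int> x. C * (I x * I (p - x) * I (q - x) * I (r + x)))
    = C * (F (p + q + r) * I p * I q * I (p + r) * I (q + r))"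
proof -
  have "(\<Sum>\<^sub>\<int> x. I x * I (p - x) * I (q - x) * I (r + x))
    = F (p + q + r) * I p * I q * I (p + r) * I (q + r)"
  proof (cases "p \<ge> 0 \<and> q \<ge> 0 \<and> p + r \<ge> 0")
    case False
    have "I x * I (p - x) * I (q - x) * I (r + x) = 0" for x
      using False I_nonzero[of x] I_nonzero[of "p - x"] I_nonzero[of "q - x"] I_nonzero[of "r + x"]
      by (cases "I x = 0 \<or> I (p - x) = 0 \<or> I (q - x) = 0 \<or> I (r + x) = 0") auto
    moreover have "I p * I q * I (p + r) = 0"
      using False I_nonzero[of p] I_nonzero[of q] I_nonzero[of "p + r"] by auto
    then have "F (p + q + r) * I p * I q * I (p + r) * I (q + r) = 0"
      by (metis (no_types, opaque_lifting) mult.assoc mult_zero_left mult_zero_right)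
    ultimately show ?thesis by (simp only: zsum_def nn_integral_const mult_zero_left)
  next
    case True
    define P Q s where "P = nat p" and "Q = nat q" and "s = nat (p + r)"
    have pq: "p = int P" "q = int Q" "r = int s - int P"
      using True by (simp_all add: P_def Q_def s_def)
    have "(\<Sum>\<^sub>\<int> x. I x * I (p - x) * I (q - x) * I (r + x)) =
        (\<Sum>x\<in>int ` {..P}. I x * I (p - x) * I (q - x) * I (r + x))"
    proof (rule zsum_finite)
      fix x assume "x \<notin> int ` {..P}"
      then have "x < 0 \<or> x > p"
        unfolding pq by (metis atMost_iff image_eqI int_nat_eq linorder_not_le nat_le_iff)
      then show "I x * I (p - x) * I (q - x) * I (r + x) = 0"
        using I_nonzero[of x] I_nonzero[of "p - x"] by fastforce
    qed simp
    also have "\<dots> = (\<Sum>k\<le>P. I (int k) * I (p - int k) * I (q - int k) * I (r + int k))"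
      by (simp add: sum.reindex)
    also have "\<dots> = ennreal (\<Sum>k\<le>P. invf (int k) * invf (p - int k) * invf (q - int k) * invf (r + int k))"
      by (simp add: I_def ennreal_mult'' invf_nonneg flip: sum_ennreal)
    also have "(\<Sum>k\<le>P. invf (int k) * invf (p - int k) * invf (q - int k) * invf (r + int k)) =
        factz (p + q + r) * invf p * invf q * invf (p + r) * invf (q + r)"
    proof -
      have binomials: "real ((Q choose k) * (s choose (P - k))) =
          fact Q * fact s * (invf (int k) * invf (p - int k) * invf (q - int k) * invf (r + int k))"
        if "k \<le> P" for k
        using that by (simp add: binomial_invf pq of_nat_diff algebra_simps)
      have "fact Q * fact s * (\<Sum>k\<le>P. invf (int k) * invf (p - int k) * invf (q - int k) * invf (r + int k))
          = real (\<Sum>k\<le>P. (Q choose k) * (s choose (P - k)))"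
        unfolding sum_distrib_left of_nat_sum by (intro sum.cong refl binomials[symmetric]) simp
      also have "\<dots> = real ((Q + s) choose P)"
        by (simp only: vandermonde)
      also have "\<dots> = factz (p + q + r) * invf p * invf (q + r)"
        unfolding binomial_invf by (simp add: pq factz_def nat_add_distrib algebra_simps)
      finally show ?thesis by (simp add: pq invf_def field_simps)
    qed
    finally show ?thesis
      by (simp add: F_def I_def ennreal_mult'' invf_nonneg)
  qed
  then show ?thesis by (simp add: zsum_cmult)
qed

section \<open>The coefficients of the period as double sums\<close>

text \<open>
  For \<open>0 \<le> j, k \<le> n\<close> this is the product of binomial coefficients
  \<open>(n choose k)^2 (2n-k choose n) (n choose j) (2n-j choose n) (2n-k choose j)\<close>, written in factorials so that the
  effect of shifting \<open>n\<close>, \<open>j\<close> or \<open>k\<close> can be read off.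
\<close>

definition summand :: "nat \<Rightarrow> int \<Rightarrow> int \<Rightarrow> real" where
  "summand n j k = fact n * factz (2 * int n - k) ^ 2 * factz (2 * int n - j) *
     invf k ^ 2 * invf (int n - k) ^ 3 * invf j ^ 2 * invf (int n - j) ^ 2 * invf (2 * int n - k - j)"

definition weighted_sum :: "nat \<Rightarrow> (real \<Rightarrow> real \<Rightarrow> real) \<Rightarrow> real" where
  "weighted_sum n w = (\<Sum>k\<le>n. \<Sum>j\<le>n. w (real j) (real k) * summand n (int j) (int k))"

text \<open>
  Brings sums belonging to different \<open>n\<close> to the same range of summation.
\<close>

lemma weighted_sum_extend:
  assumes "n \<le> m"
  shows "weighted_sum n w = (\<Sum>k\<le>m. \<Sum>j\<le>m. w (real j) (real k) * summand n (int j) (int k))"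
proof -
  have z: "summand n j k = 0" if "j > int n \<or> k > int n" for j k
    using that by (auto simp: summand_def invf_def)
  have "(\<Sum>j\<le>m. w (real j) (real k) * summand n (int j) (int k)) =
      (\<Sum>j\<le>n. w (real j) (real k) * summand n (int j) (int k))" for k
    using assms by (intro sum.mono_neutral_right) (auto simp: z)
  then have "(\<Sum>k\<le>m. \<Sum>j\<le>m. w (real j) (real k) * summand n (int j) (int k)) =
      (\<Sum>k\<le>m. \<Sum>j\<le>n. w (real j) (real k) * summand n (int j) (int k))"
    by simp
  also have "\<dots> = weighted_sum n w"
    unfolding weighted_sum_def
    using assms by (intro sum.mono_neutral_right) (auto simp: z)
  finally show ?thesis ..
qed

definition seqA :: "nat \<Rightarrow> real" where
  "seqA n = weighted_sum n (\<lambda>j k. 1)"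

text \<open>
  The order of the variables is chosen such that, from the inside outwards, the factors that contain the
  innermost variable \<open>x\<close> always form a product \<open>I x * I (p - x) * I (q - x) * I (r + x)\<close>, possibly after a
  reflection or a shift of \<open>x\<close>. This works for the eight sums up to \<open>m2\<close>. Then \<open>e\<close> also occurs in the factor
  \<open>F (2 * n - i + e) * I (n - i + e) ^ 2\<close>; the Chu--Vandermonde identity read backwards replaces this factor by a sum
  over a new variable \<open>k\<close>, after which the sums over \<open>e\<close> and \<open>i\<close> are of the required form again.

  In terms of constant terms: the left-hand side is the constant term of the \<open>n\<close>-th power of a Laurent
  polynomial in four variables. Mutations turn this polynomial into
  \<open>(1 + U) (1 + T) (1 + S) (1 + x) ((1 + S) (1 + T) + x T) / (U V S x)\<close> with \<open>T = U + V\<close>, and the double sum is the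
  constant term of the \<open>n\<close>-th power of the latter.
\<close>

lemma eleven_fold_sum_eq_double_sum:
  fixes n :: int
  assumes n: "n \<ge> 0"
  shows "(\<Sum>\<^sub>\<int> j i e m2 w s3 m1 t m0 m11 m6.
     F n ^ 3 * (I m0 * I m1 * I m2 * I (j - m1) * I (w - s3) * I (s3 - m6) * I m6
       * I (i - e - m2 - t + m11 + m6) * I (t - m11 - m6) * I (n - i - w + s3)
       * I (e + m2 - s3 - m11) * I m11
       * I (w - m1 - m2) * I (m0 + n + t - i + e - j) * I (i - j) * I (n - j + m1 - w)
       * I (j - t - m0) * I (j - e - m0)))
   = (\<Sum>\<^sub>\<int> j k. F n * F (2 * n - k) ^ 2 * F (2 * n - j) * I k ^ 2 * I (n - k) ^ 3 * I j ^ 2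
        * I (n - j) ^ 2 * I (2 * n - k - j))"
    (is "(\<Sum>\<^sub>\<int> j i e m2 w s3 m1 t m0 m11 m6. ?T0 j i e m2 w s3 m1 t m0 m11 m6) = _")
proof -
  have step_m6: "(\<Sum>\<^sub>\<int> m6. ?T0 j i e m2 w s3 m1 t m0 m11 m6) =
      F n ^ 3 * (I m0 * I m1 * I m2 * I (j - m1) * I (w - s3) * I (n - i - w + s3) * I (w - m1 - m2)
       * I (m0 + n + t - i + e - j) * I (i - j) * I (n - j + m1 - w) * I (j - t - m0) * I (j - e - m0)
       * I s3 * I (i - e - m2) * F (i - e - m2 + s3))
       * (I m11 * I (e + m2 - s3 - m11) * I (t - m11) * I (i - e - m2 + s3 - t + m11))"
    (is "_ = ?T1 j i e m2 w s3 m1 t m0 m11")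
    for j i e m2 w s3 m1 t m0 m11
    using Chu_Vandermonde_zsum[of "F n ^ 3 * (I m0 * I m1 * I m2 * I (j - m1) * I (w - s3)
       * I (n - i - w + s3) * I (e + m2 - s3 - m11) * I m11
       * I (w - m1 - m2) * I (m0 + n + t - i + e - j) * I (i - j) * I (n - j + m1 - w)
       * I (j - t - m0) * I (j - e - m0))" s3 "t - m11" "i - e - m2 - t + m11"]
    by (simp add: algebra_simps)
  have step_m11: "(\<Sum>\<^sub>\<int> m11. ?T1 j i e m2 w s3 m1 t m0 m11) =
      F n ^ 3 * (I m1 * I m2 * I (j - m1) * I (w - s3) * I (n - i - w + s3) * I (w - m1 - m2) * I (i - j)
       * I (n - j + m1 - w) * I s3 * I (i - e - m2) * F i * I (e + m2 - s3) * I t * I (i - t))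
       * (I m0 * I (j - t - m0) * I (j - e - m0) * I (n + t - i + e - j + m0))"
    (is "_ = ?T2 j i e m2 w s3 m1 t m0") for j i e m2 w s3 m1 t m0
  proof -
    have "(\<Sum>\<^sub>\<int> m11. ?T1 j i e m2 w s3 m1 t m0 m11) = F n ^ 3 * (I m1 * I m2 * I (j - m1) * I (w - s3) * I (n - i - w + s3) * I (w - m1 - m2) * I (i - j) * I (n - j + m1 - w) * F i * I (e + m2 - s3) * I t * I (i - t)) * (I m0 * I (j - t - m0) * I (j - e - m0) * I (n + t - i + e - j + m0))
      * ((I (i - e - m2) * I s3 * (F (i - e - m2 + s3) * I (i - e - m2 + s3))))"
      using Chu_Vandermonde_zsum[of "F n ^ 3 * (I m0 * I m1 * I m2 * I (j - m1) * I (w - s3) * I (n - i - w + s3) * I (w - m1 - m2)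
       * I (m0 + n + t - i + e - j) * I (i - j) * I (n - j + m1 - w) * I (j - t - m0) * I (j - e - m0)
       * I s3 * I (i - e - m2) * F (i - e - m2 + s3))"
        "e + m2 - s3" "t" "i - e - m2 + s3 - t"]
      by (simp add: algebra_simps power2_eq_square power3_eq_cube)
    also have "I (i - e - m2) * I s3 * (F (i - e - m2 + s3) * I (i - e - m2 + s3)) = I (i - e - m2) * I s3"
      by (rule cancel_fact) (use n in \<open>auto dest!: I_nonzero\<close>)
    also have "F n ^ 3 * (I m1 * I m2 * I (j - m1) * I (w - s3) * I (n - i - w + s3) * I (w - m1 - m2) * I (i - j) * I (n - j + m1 - w) * F i * I (e + m2 - s3) * I t * I (i - t)) * (I m0 * I (j - t - m0) * I (j - e - m0) * I (n + t - i + e - j + m0))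
      * ((I (i - e - m2) * I s3)) = ?T2 j i e m2 w s3 m1 t m0"
      by (simp add: mult_ac power2_eq_square)
    finally show ?thesis .
  qed
  have step_m0: "(\<Sum>\<^sub>\<int> m0. ?T2 j i e m2 w s3 m1 t m0) =
      F n ^ 3 * (I m1 * I m2 * I (j - m1) * I (w - s3) * I (n - i - w + s3) * I (w - m1 - m2) * I (i - j)
       * I (n - j + m1 - w) * I s3 * I (i - e - m2) * F i * I (e + m2 - s3) * F (n - i + j) * I (j - e)
       * I (n - i + e))
       * (I t * I (i - t) * I (j - t) * I (n - i + t))"
    (is "_ = ?T3 j i e m2 w s3 m1 t") for j i e m2 w s3 m1 t
  proof -
    have "(\<Sum>\<^sub>\<int> m0. ?T2 j i e m2 w s3 m1 t m0) = ?T3 j i e m2 w s3 m1 t"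
      using Chu_Vandermonde_zsum[of "F n ^ 3 * (I m1 * I m2 * I (j - m1) * I (w - s3) * I (n - i - w + s3) * I (w - m1 - m2) * I (i - j)
       * I (n - j + m1 - w) * I s3 * I (i - e - m2) * F i * I (e + m2 - s3) * I t * I (i - t))"
        "j - t" "j - e" "n + t - i + e - j"]
      by (simp add: algebra_simps power2_eq_square power3_eq_cube)
    then show ?thesis .
  qed
  have step_t: "(\<Sum>\<^sub>\<int> t. ?T3 j i e m2 w s3 m1 t) =
      F n ^ 3 * (I m2 * I (w - s3) * I (n - i - w + s3) * I (i - j) * I s3 * I (i - e - m2)
       * I (e + m2 - s3) * I (j - e) * I (n - i + e) * F (n + j) * I j * I n)
       * (I m1 * I (j - m1) * I (w - m2 - m1) * I (n - j - w + m1))"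
    (is "_ = ?T4 j i e m2 w s3 m1") for j i e m2 w s3 m1
  proof -
    have "(\<Sum>\<^sub>\<int> t. ?T3 j i e m2 w s3 m1 t) = F n ^ 3 * (I m2 * I (i - j) * I (j - e) * I (n - i + e) * F (n + j) * I n) * (I m1 * I (j - m1) * I (w - m2 - m1) * I (n - j - w + m1))
      * ((I s3 * I (i - e - m2) * I (e + m2 - s3) * (F (i) * I (i))) * (I (w - s3) * I (n - i - w + s3) * I j * (F (n - i + j) * I (n - i + j))))"
      using Chu_Vandermonde_zsum[of "F n ^ 3 * (I m1 * I m2 * I (j - m1) * I (w - s3) * I (n - i - w + s3) * I (w - m1 - m2) * I (i - j)
       * I (n - j + m1 - w) * I s3 * I (i - e - m2) * F i * I (e + m2 - s3) * F (n - i + j) * I (j - e)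
       * I (n - i + e))"
        "i" "j" "n - i"]
      by (simp add: algebra_simps power2_eq_square power3_eq_cube)
    also have "I s3 * I (i - e - m2) * I (e + m2 - s3) * (F (i) * I (i)) = I s3 * I (i - e - m2) * I (e + m2 - s3)"
      by (rule cancel_fact) (use n in \<open>auto dest!: I_nonzero\<close>)
    also have "I (w - s3) * I (n - i - w + s3) * I j * (F (n - i + j) * I (n - i + j)) = I (w - s3) * I (n - i - w + s3) * I j"
      by (rule cancel_fact) (use n in \<open>auto dest!: I_nonzero\<close>)
    also have "F n ^ 3 * (I m2 * I (i - j) * I (j - e) * I (n - i + e) * F (n + j) * I n) * (I m1 * I (j - m1) * I (w - m2 - m1) * I (n - j - w + m1))
      * ((I s3 * I (i - e - m2) * I (e + m2 - s3)) * (I (w - s3) * I (n - i - w + s3) * I j)) = ?T4 j i e m2 w s3 m1"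
      by (simp add: mult_ac power2_eq_square)
    finally show ?thesis .
  qed
  have step_m1: "(\<Sum>\<^sub>\<int> m1. ?T4 j i e m2 w s3 m1) =
      F n ^ 3 * (I m2 * I (i - j) * I (i - e - m2) * I (j - e) * I (n - i + e) * F (n + j) * I j ^ 2
       * I n * F (n - m2) * I (w - m2) * I (n - w) * I (n - j - m2))
       * (I s3 * I (w - s3) * I (e + m2 - s3) * I (n - i - w + s3))"
    (is "_ = ?T5 j i e m2 w s3") for j i e m2 w s3
  proof -
    have "(\<Sum>\<^sub>\<int> m1. ?T4 j i e m2 w s3 m1) = ?T5 j i e m2 w s3"
      using Chu_Vandermonde_zsum[of "F n ^ 3 * (I m2 * I (w - s3) * I (n - i - w + s3) * I (i - j) * I s3 * I (i - e - m2)
       * I (e + m2 - s3) * I (j - e) * I (n - i + e) * F (n + j) * I j * I n)"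
        "j" "w - m2" "n - j - w"]
      by (simp add: algebra_simps power2_eq_square power3_eq_cube)
    then show ?thesis .
  qed
  have step_s3: "(\<Sum>\<^sub>\<int> s3. ?T5 j i e m2 w s3) =
      F n ^ 3 * (I m2 * I (i - j) * I (i - e - m2) * I (j - e) * I (n - i + e) * F (n + j) * I j ^ 2
       * I n * F (n - m2) * I (n - j - m2) * F (n - i + e + m2) * I (e + m2) * I (n - i))
       * (I (n - w) * I w * I (w - m2) * I (n - i + e + m2 - w))"
    (is "_ = ?T6 j i e m2 w") for j i e m2 w
  proof -
    have "(\<Sum>\<^sub>\<int> s3. ?T5 j i e m2 w s3) = ?T6 j i e m2 w"
      using Chu_Vandermonde_zsum[of "F n ^ 3 * (I m2 * I (i - j) * I (i - e - m2) * I (j - e) * I (n - i + e) * F (n + j) * I j ^ 2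
       * I n * F (n - m2) * I (w - m2) * I (n - w) * I (n - j - m2))"
        "w" "e + m2" "n - i - w"]
      by (simp add: algebra_simps power2_eq_square power3_eq_cube)
    then show ?thesis .
  qed
  have step_w: "(\<Sum>\<^sub>\<int> w. ?T6 j i e m2 w) =
      F n ^ 3 * (I (i - j) * I (j - e) * I (n - i + e) ^ 2 * F (n + j) * I j ^ 2 * I n ^ 2 * I (n - i)
       * F (2 * n - i + e))
       * (I m2 * I (n - j - m2) * I (i - e - m2) * I (e + m2))"
    (is "_ = ?T7 j i e m2") for j i e m2
  proof -
    have "(\<Sum>\<^sub>\<int> w. ?T6 j i e m2 w) = (\<Sum>\<^sub>\<int> w. ?T6 j i e m2 (n - w))"
      by (rule zsum_reflect[of "\<lambda>w. ?T6 j i e m2 w" "n", symmetric])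
    also have "\<dots> = F n ^ 3 * (I (i - j) * I (j - e) * I (n - i + e) ^ 2 * F (n + j) * I j * I n ^ 2 * F (2 * n - i + e)) * (I m2 * I (i - e - m2))
      * ((I (n - j - m2) * I j * (F (n - m2) * I (n - m2))) * (I (e + m2) * I (n - i) * (F (n - i + e + m2) * I (n - i + e + m2))))"
      using Chu_Vandermonde_zsum[of "F n ^ 3 * (I m2 * I (i - j) * I (i - e - m2) * I (j - e) * I (n - i + e) * F (n + j) * I j ^ 2
       * I n * F (n - m2) * I (n - j - m2) * F (n - i + e + m2) * I (e + m2) * I (n - i))"
        "n" "n - m2" "e + m2 - i"]
      by (simp add: algebra_simps power2_eq_square power3_eq_cube)
    also have "I (n - j - m2) * I j * (F (n - m2) * I (n - m2)) = I (n - j - m2) * I j"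
      by (rule cancel_fact) (use n in \<open>auto dest!: I_nonzero\<close>)
    also have "I (e + m2) * I (n - i) * (F (n - i + e + m2) * I (n - i + e + m2)) = I (e + m2) * I (n - i)"
      by (rule cancel_fact) (use n in \<open>auto dest!: I_nonzero\<close>)
    also have "F n ^ 3 * (I (i - j) * I (j - e) * I (n - i + e) ^ 2 * F (n + j) * I j * I n ^ 2 * F (2 * n - i + e)) * (I m2 * I (i - e - m2))
      * ((I (n - j - m2) * I j) * (I (e + m2) * I (n - i))) = ?T7 j i e m2"
      by (simp add: mult_ac power2_eq_square)
    finally show ?thesis .
  qed
  have step_m2: "(\<Sum>\<^sub>\<int> m2. ?T7 j i e m2) =
      F n ^ 3 * (I (i - j) * I (j - e) * F (n + j) * I j ^ 2 * I (n - i) * F (n - j + i) * I (n - j)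
       * I (i - e) * I (n - j + e) * I i)
       * (F (2 * n - i + e) * I (n - i + e) ^ 2 * I n ^ 2)"
    (is "_ = ?T8 j i e") for j i e
  proof -
    have "(\<Sum>\<^sub>\<int> m2. ?T7 j i e m2) = ?T8 j i e"
      using Chu_Vandermonde_zsum[of "F n ^ 3 * (I (i - j) * I (j - e) * I (n - i + e) ^ 2 * F (n + j) * I j ^ 2 * I n ^ 2 * I (n - i)
       * F (2 * n - i + e))"
        "n - j" "i - e" "e"]
      by (simp add: algebra_simps power2_eq_square power3_eq_cube)
    then show ?thesis .
  qed
  \<comment> \<open>Chu--Vandermonde from right to left, with \<open>p = n\<close>, \<open>q = n - i + e\<close>, \<open>r = 0\<close>.\<close>
  have insert_k: "(\<Sum>\<^sub>\<int> k. F n ^ 3 * (I (i - j) * F (n + j) * I j ^ 2 * I (n - i) * F (n - j + i) * I (n - j) * I i * I k ^ 2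
       * I (n - k))
       * (I (j - e) * I (n - i + e - k) * I (i - e) * I (n - j + e))) = ?T8 j i e"
    (is "(\<Sum>\<^sub>\<int> k. ?T9 j i e k) = _") for j i e
    using Chu_Vandermonde_zsum[of "F n ^ 3 * (I (i - j) * I (j - e) * F (n + j) * I j ^ 2 * I (n - i) * F (n - j + i) * I (n - j)
       * I (i - e) * I (n - j + e) * I i)" n "n - i + e" 0]
    by (simp add: algebra_simps power2_eq_square)
  have step_e: "(\<Sum>\<^sub>\<int> e. ?T9 j i e k) =
      F n ^ 3 * (F (n + j) * I j ^ 2 * I (n - j) * I n * I k ^ 2 * I (n - k) ^ 2 * F (2 * n - k))
       * (I (i - j) * I (n - i) * I i * I (n - i + j - k))"
    (is "_ = ?T10 j i k") for j i k
  proof -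
    have "(\<Sum>\<^sub>\<int> e. ?T9 j i e k) = (\<Sum>\<^sub>\<int> e. ?T9 j i (j - e) k)"
      by (rule zsum_reflect[of "\<lambda>e. ?T9 j i e k" "j", symmetric])
    also have "\<dots> = F n ^ 3 * (F (n + j) * I j ^ 2 * I (n - j) * I k ^ 2 * I (n - k) ^ 2 * F (2 * n - k)) * (I (n - i) * I i * I (n - i + j - k))
      * ((I (i - j) * I n * (F (n - j + i) * I (n - j + i))))"
      using Chu_Vandermonde_zsum[of "F n ^ 3 * (I (i - j) * F (n + j) * I j ^ 2 * I (n - i) * F (n - j + i) * I (n - j) * I i * I k ^ 2
       * I (n - k))"
        "n" "n - i + j - k" "i - j"]
      by (simp add: algebra_simps power2_eq_square power3_eq_cube)
    also have "I (i - j) * I n * (F (n - j + i) * I (n - j + i)) = I (i - j) * I n"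
      by (rule cancel_fact) (use n in \<open>auto dest!: I_nonzero\<close>)
    also have "F n ^ 3 * (F (n + j) * I j ^ 2 * I (n - j) * I k ^ 2 * I (n - k) ^ 2 * F (2 * n - k)) * (I (n - i) * I i * I (n - i + j - k))
      * ((I (i - j) * I n)) = ?T10 j i k"
      by (simp add: mult_ac power2_eq_square)
    finally show ?thesis .
  qed
  have step_i: "(\<Sum>\<^sub>\<int> i. ?T10 j i k) =
      F n ^ 3 * (I n ^ 2 * F (n + j) * I j ^ 2 * I (n - j) ^ 2 * I k ^ 2 * I (n - k) ^ 3 * F (2 * n - k) ^ 2)
       * I (n - k + j)"
    (is "_ = ?T11 j k") for j k
  proof -
    have "(\<Sum>\<^sub>\<int> i. ?T10 j i k) = (\<Sum>\<^sub>\<int> i. ?T10 j (i + j) k)"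
      by (rule zsum_shift[of "\<lambda>i. ?T10 j i k" j, symmetric])
    also have "\<dots> = ?T11 j k"
      using Chu_Vandermonde_zsum[of "F n ^ 3 * (F (n + j) * I j ^ 2 * I (n - j) * I n * I k ^ 2 * I (n - k) ^ 2 * F (2 * n - k))"
        "n - j" "n - k" "j"]
      by (simp add: algebra_simps power2_eq_square power3_eq_cube)
    finally show ?thesis .
  qed
  have reindexed: "?T11 (n - j) k = F n * F (2 * n - k) ^ 2 * F (2 * n - j) * I k ^ 2 * I (n - k) ^ 3 * I j ^ 2
        * I (n - j) ^ 2 * I (2 * n - k - j)" for j k
  proof -
    have "F n * (F n * I n) * (F n * I n) = F n"
      using cancel_fact[of "F n" n] n by simp
    moreover have "?T11 (n - j) k = (F n * (F n * I n) * (F n * I n)) * (F (2 * n - k) ^ 2 * F (2 * n - j)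
        * I k ^ 2 * I (n - k) ^ 3 * I j ^ 2 * I (n - j) ^ 2 * I (2 * n - k - j))"
      by (simp add: algebra_simps power2_eq_square power3_eq_cube)
    ultimately show ?thesis by (simp add: mult_ac)
  qed
  have "(\<Sum>\<^sub>\<int> j i e m2 w s3 m1 t m0 m11 m6. ?T0 j i e m2 w s3 m1 t m0 m11 m6) =
      (\<Sum>\<^sub>\<int> j i e k. ?T9 j i e k)"
    by (simp only: step_m6 step_m11 step_m0 step_t step_m1 step_s3 step_w step_m2 insert_k)
  also have "\<dots> = (\<Sum>\<^sub>\<int> j i k. ?T10 j i k)"
    by (subst zsum_swap) (simp only: step_e)
  also have "\<dots> = (\<Sum>\<^sub>\<int> j k. ?T11 j k)"
    by (subst zsum_swap) (simp only: step_i)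
  also have "\<dots> = (\<Sum>\<^sub>\<int> j k. ?T11 (n - j) k)"
    by (rule zsum_reflect[of "\<lambda>j. \<Sum>\<^sub>\<int> k. ?T11 j k" n, symmetric])
  also have "\<dots> = (\<Sum>\<^sub>\<int> j k. F n * F (2 * n - k) ^ 2 * F (2 * n - j) * I k ^ 2 * I (n - k) ^ 3 * I j ^ 2
        * I (n - j) ^ 2 * I (2 * n - k - j))"
    by (simp only: reindexed)
  finally show ?thesis .
qed

text \<open>
  The summand of the period in the variables in which the sum can be evaluated. Its eighteen
  reciprocal factorials belong, in this order, to \<open>m\<^sub>0, m\<^sub>1, m\<^sub>2, m\<^sub>3, m\<^sub>4, m\<^sub>5, m\<^sub>6, m\<^sub>7, m\<^sub>8, m\<^sub>9, m\<^sub>1\<^sub>0, m\<^sub>1\<^sub>1\<close> and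
  \<open>f\<^sub>1, f\<^sub>2, f\<^sub>3, f\<^sub>4, f\<^sub>5, f\<^sub>6\<close>.
\<close>

definition substituted_term :: "int \<Rightarrow> int \<times> int \<times> int \<times> int \<times> int \<times> int \<times> int \<times> int \<times> int \<times> int \<times> int \<Rightarrow> ennreal" where
  "substituted_term n = (\<lambda>(j, i, e, m2, w, s3, m1, t, m0, m11, m6).
     F n ^ 3 * (I m0 * I m1 * I m2 * I (j - m1) * I (w - s3) * I (s3 - m6) * I m6
       * I (i - e - m2 - t + m11 + m6) * I (t - m11 - m6) * I (n - i - w + s3)
       * I (e + m2 - s3 - m11) * I m11
       * I (w - m1 - m2) * I (m0 + n + t - i + e - j) * I (i - j) * I (n - j + m1 - w)
       * I (j - t - m0) * I (j - e - m0)))"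

definition period_term :: "nat \<Rightarrow> (nat \<Rightarrow> nat) \<Rightarrow> real" where
  "period_term n m = fact n ^ 3 /
     ((\<Prod>i<12. fact (m i)) * (\<Prod>x\<leftarrow>lin_forms (\<lambda>i. int (m i)). fact (nat x)))"

text \<open>
  The exponent \<open>m\<^sub>9\<close> is missing because the others and \<open>n = m\<^sub>4 + \<dots> + m\<^sub>1\<^sub>1\<close> determine it.
\<close>

definition substitution :: "(nat \<Rightarrow> int) \<Rightarrow> int \<times> int \<times> int \<times> int \<times> int \<times> int \<times> int \<times> int \<times> int \<times> int \<times> int" where
  "substitution m = (m 1 + m 3, m 5 + m 6 + m 7 + m 8 + m 10 + m 11, m 5 + m 6 + m 10 + m 11 - m 2, m 2,
     m 4 + m 5 + m 6, m 5 + m 6, m 1, m 6 + m 8 + m 11, m 0, m 11, m 6)"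

lemma sum_4_11: "(\<Sum>i=4..(11::nat). f i) = f 4 + f 5 + f 6 + f 7 + f 8 + f 9 + f 10 + (f 11 :: 'a :: comm_monoid_add)"
  by (simp add: numeral_eq_Suc add.assoc)

lemma substituted_term_eq:
  assumes "m \<in> index_set n"
  shows "substituted_term (int n) (substitution (\<lambda>i. int (m i))) = ennreal (period_term n m)"
proof -
  have s: "int n = int (m 4) + int (m 5) + int (m 6) + int (m 7) + int (m 8) + int (m 9) + int (m 10) + int (m 11)"
    using assms by (auto simp: index_set_def sum_4_11)
  have forms: "\<forall>x\<in>set (lin_forms (\<lambda>i. int (m i))). x \<ge> 0"
    using assms by (simp add: index_set_def)
  have "period_term n m = fact n ^ 3 * ((\<Prod>i<12. 1 / fact (m i)) *
      (\<Prod>x\<leftarrow>lin_forms (\<lambda>i. int (m i)). 1 / fact (nat x)))"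
    by (simp add: period_term_def prod_dividef lin_forms_def)
  also have "ennreal \<dots> = F (int n) ^ 3 * ((\<Prod>i<12. I (int (m i))) *
      (\<Prod>x\<leftarrow>lin_forms (\<lambda>i. int (m i)). I x))"
  proof -
    have "ennreal (\<Prod>i<12. 1 / fact (m i)) = (\<Prod>i<12. I (int (m i)))"
      by (simp add: prod_ennreal[symmetric] I_def invf_def)
    moreover have "ennreal (\<Prod>x\<leftarrow>lin_forms (\<lambda>i. int (m i)). 1 / fact (nat x)) =
        (\<Prod>x\<leftarrow>lin_forms (\<lambda>i. int (m i)). I x)"
    proof -
      have "(\<Prod>x\<leftarrow>xs. invf x) \<ge> 0 \<and> ennreal (\<Prod>x\<leftarrow>xs. invf x) = (\<Prod>x\<leftarrow>xs. I x)" for xs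
        by (induction xs) (simp_all add: ennreal_mult invf_nonneg I_def)
      moreover have "map (\<lambda>x. 1 / fact (nat x)) (lin_forms (\<lambda>i. int (m i))) =
          map invf (lin_forms (\<lambda>i. int (m i)))"
        using forms by (intro map_cong) (auto simp: invf_def)
      ultimately show ?thesis by (simp only:)
    qed
    moreover have "ennreal (fact n ^ 3) = F (int n) ^ 3"
      by (simp add: F_def factz_def ennreal_power)
    moreover have "(\<Prod>i<12. 1 / fact (m i) :: real) \<ge> 0"
      by (intro prod_nonneg) simp
    ultimately show ?thesis
      by (simp add: ennreal_mult')
  qed
  also have "\<dots> = substituted_term (int n) (substitution (\<lambda>i. int (m i)))"
    unfolding substituted_term_def substitution_def s prod.case lin_forms_def
    by (simp add: eval_nat_numeral lessThan_Suc algebra_simps)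
  finally show ?thesis ..
qed

text \<open>
  A nonzero term has nonnegative arguments in all its reciprocal factorials, and these are exactly the
  numbers that the index set requires to be nonnegative.
\<close>

lemma substituted_term_nonzeroD:
  assumes "substituted_term (int n) z \<noteq> 0"
  shows "z \<in> (\<lambda>m. substitution (\<lambda>i. int (m i))) ` index_set n"
proof -
  obtain j i e m2 w s3 m1 t m0 m11 m6 where z: "z = (j, i, e, m2, w, s3, m1, t, m0, m11, m6)"
    by (cases z) auto
  have nonneg: "m0 \<ge> 0" "m1 \<ge> 0" "m2 \<ge> 0" "j - m1 \<ge> 0" "w - s3 \<ge> 0" "s3 - m6 \<ge> 0" "m6 \<ge> 0"
    "i - e - m2 - t + m11 + m6 \<ge> 0" "t - m11 - m6 \<ge> 0" "int n - i - w + s3 \<ge> 0"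
    "e + m2 - s3 - m11 \<ge> 0" "m11 \<ge> 0" "w - m1 - m2 \<ge> 0" "m0 + int n + t - i + e - j \<ge> 0" "i - j \<ge> 0"
    "int n - j + m1 - w \<ge> 0" "j - t - m0 \<ge> 0" "j - e - m0 \<ge> 0"
    using assms by (auto simp: z substituted_term_def dest!: I_nonzero)
  \<comment> \<open>The inverse of the substitution.\<close>
  define v where "v = [m0, m1, m2, j - m1, w - s3, s3 - m6, m6, i - e - m2 - t + m11 + m6, t - m11 - m6,
    int n - i - w + s3, e + m2 - s3 - m11, m11]"
  define m where "m = (\<lambda>i\<in>{..<12}. nat (v ! i))"
  have m: "int (m 0) = m0" "int (m 1) = m1" "int (m 2) = m2" "int (m 3) = j - m1" "int (m 4) = w - s3"
    "int (m 5) = s3 - m6" "int (m 6) = m6" "int (m 7) = i - e - m2 - t + m11 + m6"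
    "int (m 8) = t - m11 - m6" "int (m 9) = int n - i - w + s3" "int (m 10) = e + m2 - s3 - m11"
    "int (m 11) = m11"
    using nonneg by (simp_all add: m_def v_def)
  have "int (\<Sum>i=4..11. m i) = int n"
    unfolding sum_4_11 of_nat_add m by simp
  then have "(\<Sum>i=4..11. m i) = n" by linarith
  moreover have "\<forall>x\<in>set (lin_forms (\<lambda>i. int (m i))). x \<ge> 0"
    unfolding lin_forms_def m using nonneg by simp
  moreover have "m \<in> {..<12} \<rightarrow>\<^sub>E UNIV" by (simp add: m_def)
  ultimately have "m \<in> index_set n" by (simp add: index_set_def)
  moreover have "substitution (\<lambda>i. int (m i)) = z"
    unfolding substitution_def m z by simp
  ultimately show ?thesis by blast
qed

lemma inj_substitution: "inj_on (\<lambda>m. substitution (\<lambda>i. int (m i))) (index_set n)"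
proof (rule inj_onI)
  fix m m' assume m: "m \<in> index_set n" "m' \<in> index_set n"
    and eq: "substitution (\<lambda>i. int (m i)) = substitution (\<lambda>i. int (m' i))"
  have size: "m 4 + m 5 + m 6 + m 7 + m 8 + m 9 + m 10 + m 11 = m' 4 + m' 5 + m' 6 + m' 7 + m' 8 + m' 9 + m' 10 + m' 11"
    using m by (simp add: index_set_def sum_4_11)
  have "m 0 = m' 0" "m 1 = m' 1" "m 2 = m' 2" "m 3 = m' 3" "m 4 = m' 4" "m 5 = m' 5"
    "m 6 = m' 6" "m 7 = m' 7" "m 8 = m' 8" "m 9 = m' 9" "m 10 = m' 10" "m 11 = m' 11"
  proof -
    have "int (m 1) + int (m 3) = int (m' 1) + int (m' 3)"
      "int (m 5) + int (m 6) + int (m 7) + int (m 8) + int (m 10) + int (m 11) =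
        int (m' 5) + int (m' 6) + int (m' 7) + int (m' 8) + int (m' 10) + int (m' 11)"
      "int (m 5) + int (m 6) + int (m 10) + int (m 11) - int (m 2) =
        int (m' 5) + int (m' 6) + int (m' 10) + int (m' 11) - int (m' 2)"
      "int (m 2) = int (m' 2)" "int (m 4) + int (m 5) + int (m 6) = int (m' 4) + int (m' 5) + int (m' 6)"
      "int (m 5) + int (m 6) = int (m' 5) + int (m' 6)" "int (m 1) = int (m' 1)"
      "int (m 6) + int (m 8) + int (m 11) = int (m' 6) + int (m' 8) + int (m' 11)"
      "int (m 0) = int (m' 0)" "int (m 11) = int (m' 11)" "int (m 6) = int (m' 6)"
      using eq unfolding substitution_def prod.inject by blast+
    then show "m 0 = m' 0" "m 1 = m' 1" "m 2 = m' 2" "m 3 = m' 3" "m 4 = m' 4" "m 5 = m' 5"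
      "m 6 = m' 6" "m 7 = m' 7" "m 8 = m' 8" "m 9 = m' 9" "m 10 = m' 10" "m 11 = m' 11"
      using size by linarith+
  qed
  then have "m i = m' i" if "i \<in> {0, 1, 2, 3, 4, 5, 6, 7, 8, 9, 10, 11}" for i
    using that by auto
  moreover have "{..<12} = {0, 1, 2, 3, 4, 5, 6, 7, 8, 9, 10, 11::nat}"
    by (rule set_eqI) (simp, presburger)
  ultimately show "m = m'"
    using m by (intro PiE_ext[of m "{..<12}" "\<lambda>_. UNIV" m']) (simp_all add: index_set_def)
qed

lemma sum_period_term: "(\<Sum>m\<in>index_set n. period_term n m) = seqA n"
proof -
  have period_nonneg: "period_term n m \<ge> 0" for m
    by (simp add: period_term_def lin_forms_def prod_nonneg)
  have summand_nonneg: "summand n j k \<ge> 0" for j k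
    by (simp add: summand_def invf_nonneg less_imp_le[OF factz_pos])
  have "ennreal (\<Sum>m\<in>index_set n. period_term n m) =
      (\<Sum>m\<in>index_set n. substituted_term (int n) (substitution (\<lambda>i. int (m i))))"
    by (simp add: substituted_term_eq period_nonneg flip: sum_ennreal)
  also have "\<dots> = (\<integral>\<^sup>+ z. substituted_term (int n) z \<partial>count_space UNIV)"
  proof (subst nn_integral_count_space')
    let ?A = "(\<lambda>m. substitution (\<lambda>i. int (m i))) ` index_set n"
    show "substituted_term (int n) z = 0" if "z \<notin> ?A" for z
      using that substituted_term_nonzeroD by blast
    show "(\<Sum>m\<in>index_set n. substituted_term (int n) (substitution (\<lambda>i. int (m i)))) =
        sum (substituted_term (int n)) ?A"
      by (simp add: sum.reindex[OF inj_substitution])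
  qed (simp_all add: finite_index_set)
  also have "\<dots> = (\<Sum>\<^sub>\<int> j k. F (int n) * F (2 * int n - k) ^ 2 * F (2 * int n - j) * I k ^ 2
      * I (int n - k) ^ 3 * I j ^ 2 * I (int n - j) ^ 2 * I (2 * int n - k - j))"
    unfolding substituted_term_def nn_integral_count_space_Pair prod.case
    unfolding zsum_def[symmetric]
    by (rule eleven_fold_sum_eq_double_sum) simp
  also have "\<dots> = (\<Sum>\<^sub>\<int> j k. ennreal (summand n j k))"
    by (simp add: F_def I_def summand_def ennreal_mult'' invf_nonneg less_imp_le[OF factz_pos] factz_def
        ennreal_power zero_le_power flip: ennreal_power)
  also have "\<dots> = (\<Sum>j\<in>int ` {..n}. \<Sum>k\<in>int ` {..n}. ennreal (summand n j k))"
  proof -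
    have zero: "summand n j k = 0" if "j \<notin> int ` {..n} \<or> k \<notin> int ` {..n}" for j k
    proof -
      have "x < 0 \<or> x > int n" if "x \<notin> int ` {..n}" for x
        using that by (metis atMost_iff image_eqI int_nat_eq linorder_not_le nat_le_iff)
      then show ?thesis using that by (force simp: summand_def invf_def)
    qed
    have "(\<Sum>\<^sub>\<int> k. ennreal (summand n j k)) = (\<Sum>k\<in>int ` {..n}. ennreal (summand n j k))" for j
      by (rule zsum_finite) (simp_all add: zero)
    then show ?thesis
      by (simp only:) (rule zsum_finite, simp_all add: zero)
  qed
  also have "\<dots> = ennreal (\<Sum>j\<le>n. \<Sum>k\<le>n. summand n (int j) (int k))"
    by (simp add: sum.reindex sum_nonneg summand_nonneg flip: sum_ennreal)
  also have "(\<Sum>j\<le>n. \<Sum>k\<le>n. summand n (int j) (int k)) = seqA n"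
    unfolding seqA_def weighted_sum_def by (subst sum.swap) simp
  finally show ?thesis
    by (subst (asm) ennreal_inj)
      (auto simp: period_nonneg summand_nonneg seqA_def weighted_sum_def intro!: sum_nonneg)
qed

lemma Phi_0_nth: "fps_nth Phi_0 n = of_real (seqA n)"
  unfolding sum_period_term[symmetric] Phi_0_def period_term_def by (simp add: lin_forms_def)

section \<open>Creative telescoping\<close>

text \<open>
  A common denominator: \<open>summand n\<close> and \<open>summand (Suc n)\<close> are polynomial multiples of it.
\<close>

definition summand_base :: "nat \<Rightarrow> int \<Rightarrow> int \<Rightarrow> real" where
  "summand_base n j k = fact n * factz (2 * int n - k) ^ 2 * factz (2 * int n - j) *
     invf k ^ 2 * invf (int n + 1 - k) ^ 3 * invf j ^ 2 * invf (int n + 1 - j) ^ 2 *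
     invf (2 * int n + 2 - k - j)"

lemma summand_eq_base:
  fixes n :: nat and j k :: int
  defines "N \<equiv> real n + 1"
  shows "summand n j k =
    (N - k) ^ 3 * (N - j) ^ 2 * (2 * N - 1 - k - j) * (2 * N - k - j) * summand_base n j k"
proof -
  have a: "invf (int n - k) = (N - k) * invf (int n + 1 - k)" for k
    using invf_rec[of "int n + 1 - k"] by (simp add: N_def)
  have b: "invf (2 * int n - k - j) = (2 * N - 1 - k - j) * (2 * N - k - j) * invf (2 * int n + 2 - k - j)"
  proof -
    have "invf (2 * int n + 1 - k - j) = (2 * N - k - j) * invf (2 * int n + 2 - k - j)"
      using invf_rec[of "2 * int n + 2 - k - j"] by (simp add: N_def algebra_simps)
    moreover have "invf (2 * int n - k - j) = (2 * N - 1 - k - j) * invf (2 * int n + 1 - k - j)"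
      using invf_rec[of "2 * int n + 1 - k - j"] by (simp add: N_def algebra_simps)
    ultimately show ?thesis by simp
  qed
  show ?thesis
    unfolding summand_def summand_base_def a b by (simp add: power_mult_distrib)
qed

lemma summand_Suc_eq_base:
  fixes n :: nat and j k :: int
  defines "N \<equiv> real n + 1"
  assumes "j \<le> 2 * int n" "k \<le> 2 * int n"
  shows "summand (Suc n) j k =
    N * (2 * N - 1 - k) ^ 2 * (2 * N - k) ^ 2 * (2 * N - 1 - j) * (2 * N - j) * summand_base n j k"
proof -
  have a: "factz (2 * int (Suc n) - k) = (2 * N - 1 - k) * (2 * N - k) * factz (2 * int n - k)"
    if "k \<le> 2 * int n" for k
  proof -
    have "factz (2 * int n + 1 - k) = (2 * N - 1 - k) * factz (2 * int n - k)"
      using factz_rec[of "2 * int n + 1 - k"] that by (simp add: N_def algebra_simps)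
    moreover have "factz (2 * int (Suc n) - k) = (2 * N - k) * factz (2 * int n + 1 - k)"
      using factz_rec[of "2 * int n + 2 - k"] that by (simp add: N_def algebra_simps)
    ultimately show ?thesis by simp
  qed
  have b: "fact (Suc n) = N * fact n" by (simp add: N_def)
  have c: "int (Suc n) - k = int n + 1 - k" "2 * int (Suc n) - k - j = 2 * int n + 2 - k - j" for k j
    by simp_all
  show ?thesis
    unfolding summand_def summand_base_def a[OF assms(2)] a[OF assms(3)] b c
    by (simp add: power_mult_distrib)
qed

lemma base_shift_j:
  fixes n :: nat and j k :: int
  defines "N \<equiv> real n + 1"
  assumes "1 \<le> n" "j \<le> int n + 1"
  shows "(real_of_int j + 1) ^ 2 * (2 * N - 2 - j) * summand_base n (j + 1) k =
    (N - j) ^ 2 * (2 * N - k - j) * summand_base n j k"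
proof (cases "j = int n + 1")
  case True
  then show ?thesis by (simp add: summand_base_def invf_def N_def)
next
  case False
  have a: "invf (int n + 1 - (j + 1)) = (N - j) * invf (int n + 1 - j)"
    using invf_rec[of "int n + 1 - j"] by (simp add: N_def algebra_simps)
  have b: "invf (2 * int n + 2 - k - (j + 1)) = (2 * N - k - j) * invf (2 * int n + 2 - k - j)"
    using invf_rec[of "2 * int n + 2 - k - j"] by (simp add: N_def algebra_simps)
  have c: "invf j = (real_of_int j + 1) * invf (j + 1)"
    using invf_rec[of "j + 1"] by simp
  have d: "factz (2 * int n - j) = (2 * N - 2 - j) * factz (2 * int n - (j + 1))"
    using factz_rec[of "2 * int n - j"] False assms by (simp add: N_def algebra_simps)
  show ?thesis
    unfolding summand_base_def a b c d by (simp add: power_mult_distrib)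
qed

lemma base_shift_k:
  fixes n :: nat and j k :: int
  defines "N \<equiv> real n + 1"
  assumes "1 \<le> n" "k \<le> int n + 1"
  shows "(real_of_int k + 1) ^ 2 * (2 * N - 2 - k) ^ 2 * summand_base n j (k + 1) =
    (N - k) ^ 3 * (2 * N - k - j) * summand_base n j k"
proof (cases "k = int n + 1")
  case True
  then show ?thesis by (simp add: summand_base_def invf_def N_def)
next
  case False
  have a: "invf (int n + 1 - (k + 1)) = (N - k) * invf (int n + 1 - k)"
    using invf_rec[of "int n + 1 - k"] by (simp add: N_def algebra_simps)
  have b: "invf (2 * int n + 2 - (k + 1) - j) = (2 * N - k - j) * invf (2 * int n + 2 - k - j)"
    using invf_rec[of "2 * int n + 2 - k - j"] by (simp add: N_def algebra_simps)
  have c: "invf k = (real_of_int k + 1) * invf (k + 1)"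
    using invf_rec[of "k + 1"] by simp
  have d: "factz (2 * int n - k) = (2 * N - 2 - k) * factz (2 * int n - (k + 1))"
    using factz_rec[of "2 * int n - k"] False assms by (simp add: N_def algebra_simps)
  show ?thesis
    unfolding summand_base_def a b c d by (simp add: power_mult_distrib)
qed

lemma sum_telescope_int:
  fixes g :: "int \<Rightarrow> real"
  shows "(\<Sum>j\<le>m. g (int j + 1) - g (int j)) = g (int m + 1) - g 0"
  by (induction m) (simp_all add: algebra_simps)

text \<open>
  By the certificate, \<open>a * summand (Suc n) - b * summand n\<close> is the difference in \<open>j\<close> of
  \<open>c j k * j^2 * (2 * N - 1 - j) * summand_base n j k\<close> plus the difference in \<open>k\<close> of
  \<open>d j k * k^2 * (2 * N - 1 - k)^2 * summand_base n j k\<close>. Both expressions vanish at 0, because of \<open>j^2\<close> and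
  \<open>k^2\<close>, and at \<open>n + 2\<close>, because of the reciprocal factorials; so the sum over \<open>0 \<le> j, k \<le> n + 1\<close> is 0. The
  condition \<open>1 \<le> n\<close> keeps the arguments of \<open>factz\<close> nonnegative in this range.
\<close>

lemma weighted_sum_step:
  fixes a b c d :: "real \<Rightarrow> real \<Rightarrow> real" and n :: nat
  defines "N \<equiv> real n + 1"
  assumes "1 \<le> n"
  assumes certificate: "\<And>j k.
      a j k * (N * (2 * N - 1 - k) ^ 2 * (2 * N - k) ^ 2 * (2 * N - 1 - j) * (2 * N - j))
    - b j k * ((N - k) ^ 3 * (N - j) ^ 2 * (2 * N - 1 - k - j) * (2 * N - k - j))
    = (c (j + 1) k * (N - j) ^ 2 * (2 * N - k - j) - c j k * j ^ 2 * (2 * N - 1 - j))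
    + (d j (k + 1) * (N - k) ^ 3 * (2 * N - k - j) - d j k * k ^ 2 * (2 * N - 1 - k) ^ 2)"
  shows "weighted_sum (Suc n) a = weighted_sum n b"
proof -
  let ?m = "n + 1"
  define f where "f j k = c j k * j ^ 2 * (2 * N - 1 - j) * summand_base n j k" for j k :: int
  define g where "g k j = d j k * k ^ 2 * (2 * N - 1 - k) ^ 2 * summand_base n j k" for j k :: int
  have step: "a j k * summand (Suc n) j k - b j k * summand n j k
      = (f (j + 1) k - f j k) + (g (k + 1) j - g k j)"
    if "j \<le> int ?m" "k \<le> int ?m" for j k :: int
  proof -
    have "a j k * summand (Suc n) j k - b j k * summand n j k =
      (a j k * (N * (2 * N - 1 - k) ^ 2 * (2 * N - k) ^ 2 * (2 * N - 1 - j) * (2 * N - j))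
      - b j k * ((N - k) ^ 3 * (N - j) ^ 2 * (2 * N - 1 - k - j) * (2 * N - k - j)))
      * summand_base n j k"
    proof -
      have "j \<le> 2 * int n" "k \<le> 2 * int n" using that assms(2) by auto
      then show ?thesis
        by (simp only: summand_eq_base[of n j k] summand_Suc_eq_base[of j n k] N_def[symmetric])
          (simp only: left_diff_distrib mult.assoc)
    qed
    also have "\<dots> = (c (j + 1) k * ((N - j) ^ 2 * (2 * N - k - j) * summand_base n j k) - f j k)
       + (d j (k + 1) * ((N - k) ^ 3 * (2 * N - k - j) * summand_base n j k) - g k j)"
      unfolding certificate by (simp add: f_def g_def algebra_simps)
    also have "\<dots> = (f (j + 1) k - f j k) + (g (k + 1) j - g k j)"
    proof -
      have "c (j + 1) k * ((N - j) ^ 2 * (2 * N - k - j) * summand_base n j k) = f (j + 1) k"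
        using base_shift_j[of n j k] that assms(2) by (simp add: f_def N_def mult_ac)
      moreover have "d j (k + 1) * ((N - k) ^ 3 * (2 * N - k - j) * summand_base n j k) = g (k + 1) j"
        using base_shift_k[of n k j] that assms(2) by (simp add: g_def N_def mult_ac)
      ultimately show ?thesis by simp
    qed
    finally show ?thesis .
  qed
  have f0: "f 0 k = 0" "g 0 k = 0" "f (int ?m + 1) k = 0" "g (int ?m + 1) k = 0" for k
    by (simp_all add: f_def g_def summand_base_def invf_def)
  have "weighted_sum (Suc n) a - weighted_sum n b =
     (\<Sum>k\<le>?m. \<Sum>j\<le>?m. a (int j) (int k) * summand (Suc n) (int j) (int k)
        - b (int j) (int k) * summand n (int j) (int k))"
    by (simp add: weighted_sum_extend[of n ?m] weighted_sum_extend[of "Suc n" ?m]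
        sum_subtractf del: sum.atMost_Suc)
  also have "\<dots> = (\<Sum>k\<le>?m. \<Sum>j\<le>?m. (f (int j + 1) (int k) - f (int j) (int k))
      + (g (int k + 1) (int j) - g (int k) (int j)))"
    by (intro sum.cong refl step) simp_all
  also have "\<dots> = (\<Sum>k\<le>?m. \<Sum>j\<le>?m. f (int j + 1) (int k) - f (int j) (int k))
      + (\<Sum>j\<le>?m. \<Sum>k\<le>?m. g (int k + 1) (int j) - g (int k) (int j))"
    unfolding sum.distrib by (subst (2) sum.swap) (rule refl)
  also have "\<dots> = 0"
  proof -
    have "(\<Sum>j\<le>?m. f (int j + 1) k - f (int j) k) = 0"
      "(\<Sum>j\<le>?m. g (int j + 1) k - g (int j) k) = 0" for k
      using sum_telescope_int[of "\<lambda>j. f j k" ?m] sum_telescope_int[of "\<lambda>j. g j k" ?m]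
      by (simp_all only: f0 diff_self)
    then show ?thesis by (simp only: sum.neutral_const add_0)
  qed
  finally show ?thesis by simp
qed

text \<open>
  The polynomials \<open>c\<close> (here \<open>cert_j\<close>) and \<open>d\<close> (here \<open>cert_k\<close>) of \<open>weighted_sum_step\<close> for the three sums, with
  \<open>N = n + 1\<close>. They are solutions of a system of linear equations: one prescribes the monomials in \<open>j\<close> and \<open>k\<close>, of
  total degree at most 6 in \<open>c\<close> and at most 4 in \<open>d\<close>, and compares coefficients in the certificate
  identity.
\<close>

definition cert_j_A :: "real \<Rightarrow> real \<Rightarrow> real \<Rightarrow> real" where
  "cert_j_A N j k =
     (-346*N^10 + 1148*N^9 - 1710*N^8 + 1216*N^7 - 542*N^6 + 126*N^5)
      + (1129*N^9 - 4084*N^8 + 6430*N^7 - 4734*N^6 + 2042*N^5 - 441*N^4)*k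
      + (-1180*N^8 + 4975*N^7 - 8214*N^6 + 5574*N^5 - 1493*N^4 - 292*N^3 + 294*N^2 - 42*N)*k^2
      + (629*N^7 - 3610*N^6 + 7193*N^5 - 5805*N^4 + 2079*N^3 - 210*N^2 - 42*N)*k^3
      + (-139*N^6 + 1156*N^5 - 2867*N^4 + 2297*N^3 - 690*N^2 + 63*N)*k^4
      + (-78*N^4 + 432*N^3 - 288*N^2 + 42*N)*k^5 + (-39*N^2 + 21*N)*k^6
      + (215*N^9 - 1018*N^8 + 1713*N^7 - 1352*N^6 + 565*N^5 - 105*N^4)*j
      + (-627*N^8 + 3315*N^7 - 5875*N^6 + 4712*N^5 - 1915*N^4 + 336*N^3)*j*k
      + (1033*N^7 - 5346*N^6 + 9563*N^5 - 7472*N^4 + 2606*N^3 - 171*N^2 - 126*N + 21)*j*k^2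
      + (-412*N^6 + 2456*N^5 - 4861*N^4 + 3705*N^3 - 1155*N^2 + 84*N + 21)*j*k^3
      + (-18*N^5 - 201*N^4 + 858*N^3 - 681*N^2 + 189*N - 21)*j*k^4 + (-78*N^2 + 42*N)*j*k^5
      + (-21*N^8 + 222*N^7 - 429*N^6 + 372*N^5 - 147*N^4 + 21*N^3)*j^2
      + (63*N^7 - 666*N^6 + 1326*N^5 - 1137*N^4 + 441*N^3 - 63*N^2)*j^2*k
      + (-183*N^6 + 1212*N^5 - 2427*N^4 + 2193*N^3 - 1005*N^2 + 231*N - 21)*j^2*k^2
      + (81*N^5 - 465*N^4 + 936*N^3 - 747*N^2 + 273*N - 42)*j^2*k^3 + (-39*N^2 + 21*N)*j^2*k^4"

definition cert_k_A :: "real \<Rightarrow> real \<Rightarrow> real \<Rightarrow> real" where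
  "cert_k_A N j k =
     (32*N^9 + 154*N^8 - 296*N^7 + 344*N^6 - 126*N^5)
      + (52*N^8 - 323*N^7 + 400*N^6 - 246*N^5 + 63*N^4)*k + (44*N^7 + 3*N^6 - 6*N^5 - 5*N^4)*k^2
      + (-39*N^6 + 60*N^5 - 60*N^4 + 21*N^3)*k^3
      + (62*N^8 - 765*N^7 + 1392*N^6 - 1448*N^5 + 567*N^4 - 42*N^3)*j
      + (-63*N^7 + 359*N^6 - 598*N^5 + 545*N^4 - 210*N^3 + 21*N^2)*j*k
      + (-122*N^6 + 312*N^5 - 375*N^4 + 170*N^3 - 21*N^2)*j*k^2
      + (39*N^5 - 99*N^4 + 120*N^3 - 42*N^2)*j*k^3
      + (-541*N^7 + 2140*N^6 - 3426*N^5 + 3025*N^4 - 1363*N^3 + 315*N^2 - 42*N)*j^2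
      + (371*N^6 - 1321*N^5 + 2084*N^4 - 1764*N^3 + 837*N^2 - 210*N + 21)*j^3
      + (-60*N^5 + 243*N^4 - 390*N^3 + 312*N^2 - 126*N + 21)*j^4"

definition cert_j_J :: "real \<Rightarrow> real \<Rightarrow> real \<Rightarrow> real" where
  "cert_j_J N j k =
     (-178*N^10 + 588*N^9 - 858*N^8 + 600*N^7 - 260*N^6 + 60*N^5)
      + (555*N^9 - 1990*N^8 + 3093*N^7 - 2264*N^6 + 968*N^5 - 210*N^4)*k
      + (-567*N^8 + 2364*N^7 - 3875*N^6 + 2628*N^5 - 698*N^4 - 140*N^3 + 140*N^2 - 20*N)*k^2
      + (297*N^7 - 1690*N^6 + 3365*N^5 - 2730*N^4 + 982*N^3 - 100*N^2 - 20*N)*k^3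
      + (-65*N^6 + 538*N^5 - 1337*N^4 + 1082*N^3 - 328*N^2 + 30*N)*k^4
      + (-36*N^4 + 200*N^3 - 136*N^2 + 20*N)*k^5 + (-18*N^2 + 10*N)*k^6
      + (109*N^9 - 502*N^8 + 833*N^7 - 652*N^6 + 270*N^5 - 50*N^4)*j
      + (-307*N^8 + 1588*N^7 - 2795*N^6 + 2240*N^5 - 910*N^4 + 160*N^3)*j*k
      + (491*N^7 - 2522*N^6 + 4511*N^5 - 3540*N^4 + 1240*N^3 - 82*N^2 - 60*N + 10)*j*k^2
      + (-195*N^6 + 1154*N^5 - 2285*N^4 + 1754*N^3 - 550*N^2 + 40*N + 10)*j*k^3
      + (-8*N^5 - 94*N^4 + 400*N^3 - 322*N^2 + 90*N - 10)*j*k^4 + (-36*N^2 + 20*N)*j*k^5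
      + (-10*N^8 + 104*N^7 - 202*N^6 + 176*N^5 - 70*N^4 + 10*N^3)*j^2
      + (30*N^7 - 312*N^6 + 624*N^5 - 538*N^4 + 210*N^3 - 30*N^2)*j^2*k
      + (-86*N^6 + 568*N^5 - 1142*N^4 + 1038*N^3 - 478*N^2 + 110*N - 10)*j^2*k^2
      + (38*N^5 - 218*N^4 + 440*N^3 - 354*N^2 + 130*N - 20)*j^2*k^3 + (-18*N^2 + 10*N)*j^2*k^4"

definition cert_k_J :: "real \<Rightarrow> real \<Rightarrow> real \<Rightarrow> real" where
  "cert_k_J N j k =
     (16*N^9 + 68*N^8 - 136*N^7 + 160*N^6 - 60*N^5) + (24*N^8 - 150*N^7 + 188*N^6 - 116*N^5 + 30*N^4)*k
      + (20*N^7 + 2*N^6 - 4*N^5 - 2*N^4)*k^2 + (-18*N^6 + 28*N^5 - 28*N^4 + 10*N^3)*k^3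
      + (28*N^8 - 354*N^7 + 652*N^6 - 680*N^5 + 270*N^4 - 20*N^3)*j
      + (-30*N^7 + 170*N^6 - 284*N^5 + 258*N^4 - 100*N^3 + 10*N^2)*j*k
      + (-56*N^6 + 144*N^5 - 174*N^4 + 80*N^3 - 10*N^2)*j*k^2
      + (18*N^5 - 46*N^4 + 56*N^3 - 20*N^2)*j*k^3
      + (-252*N^7 + 1003*N^6 - 1616*N^5 + 1433*N^4 - 650*N^3 + 150*N^2 - 20*N)*j^2
      + (173*N^6 - 620*N^5 + 983*N^4 - 836*N^3 + 398*N^2 - 100*N + 10)*j^3
      + (-28*N^5 + 114*N^4 - 184*N^3 + 148*N^2 - 60*N + 10)*j^4"

definition cert_j_H :: "real \<Rightarrow> real \<Rightarrow> real \<Rightarrow> real" where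
  "cert_j_H N j k =
     (-120*N^11 + 48*N^10 + 564*N^9 - 1300*N^8 + 1032*N^7 - 500*N^6 + 126*N^5)
      + (392*N^10 - 274*N^9 - 1892*N^8 + 4842*N^7 - 4048*N^6 + 1896*N^5 - 441*N^4)*k
      + (-404*N^9 + 529*N^8 + 2150*N^7 - 6310*N^6 + 5054*N^5 - 1588*N^4 - 194*N^3 + 280*N^2 - 42*N)*k^2
      + (209*N^8 - 614*N^7 - 1110*N^6 + 5190*N^5 - 5092*N^4 + 2008*N^3 - 224*N^2 - 42*N)*k^3
      + (-43*N^7 + 260*N^6 + 149*N^5 - 2074*N^4 + 2064*N^3 - 669*N^2 + 63*N)*k^4
      + (-1*N^6 - 27*N^5 + 77*N^4 + 333*N^3 - 274*N^2 + 42*N)*k^5 + (-14*N^3 - 32*N^2 + 21*N)*k^6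
      + (74*N^10 - 136*N^9 - 432*N^8 + 1256*N^7 - 1162*N^6 + 530*N^5 - 105*N^4)*j
      + (-215*N^9 + 517*N^8 + 1302*N^7 - 4281*N^6 + 4069*N^5 - 1803*N^4 + 336*N^3)*j*k
      + (356*N^8 - 814*N^7 - 2067*N^6 + 7038*N^5 - 6602*N^4 + 2550*N^3 - 213*N^2 - 119*N + 21)*j*k^2
      + (-141*N^7 + 437*N^6 + 782*N^5 - 3608*N^4 + 3320*N^3 - 1127*N^2 + 91*N + 21)*j*k^3
      + (-7*N^6 - 88*N^5 + 100*N^4 + 627*N^3 - 618*N^2 + 182*N - 21)*j*k^4
      + (-28*N^3 - 64*N^2 + 42*N)*j*k^5
      + (-7*N^9 + 56*N^8 + 75*N^7 - 303*N^6 + 323*N^5 - 140*N^4 + 21*N^3)*j^2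
      + (21*N^8 - 168*N^7 - 211*N^6 + 941*N^5 - 990*N^4 + 420*N^3 - 63*N^2)*j^2*k
      + (-63*N^7 + 237*N^6 + 379*N^5 - 1685*N^4 + 1857*N^3 - 928*N^2 + 224*N - 21)*j^2*k^2
      + (28*N^6 - 80*N^5 - 143*N^4 + 684*N^3 - 656*N^2 + 259*N - 42)*j^2*k^3
      + (-14*N^3 - 32*N^2 + 21*N)*j^2*k^4"

definition cert_k_H :: "real \<Rightarrow> real \<Rightarrow> real \<Rightarrow> real" where
  "cert_k_H N j k =
     (80*N^9 + 108*N^8 - 214*N^7 + 294*N^6 - 118*N^5)
      + (32*N^9 - 50*N^8 - 266*N^7 + 379*N^6 - 225*N^5 + 55*N^4)*k
      + (10*N^8 + 41*N^7 + 38*N^6 - 42*N^5 + N^4 + 2*N^3)*k^2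
      + (-13*N^7 - 18*N^6 + 34*N^5 - 47*N^4 + 19*N^3)*k^3
      + (28*N^9 - 200*N^8 - 314*N^7 + 901*N^6 - 1247*N^5 + 549*N^4 - 42*N^3)*j
      + (-30*N^8 + 53*N^7 + 196*N^6 - 433*N^5 + 467*N^4 - 199*N^3 + 21*N^2)*j*k
      + (-39*N^7 - 12*N^6 + 164*N^5 - 303*N^4 + 162*N^3 - 22*N^2)*j*k^2
      + (13*N^6 + 5*N^5 - 55*N^4 + 103*N^3 - 41*N^2)*j*k^3
      + (-190*N^8 + 200*N^7 + 971*N^6 - 2404*N^5 + 2572*N^4 - 1258*N^3 + 301*N^2 - 42*N)*j^2
      + (130*N^7 - 85*N^6 - 610*N^5 + 1489*N^4 - 1484*N^3 + 767*N^2 - 203*N + 21)*j^3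
      + (-21*N^6 + 24*N^5 + 110*N^4 - 285*N^3 + 270*N^2 - 119*N + 21)*j^4"
lemma certificate_A:
  fixes N n j k :: real
  assumes N: "N = n + 1"
  shows "(n + 1)^4*n^2*1 * (N * (2*N - 1 - k)^2 * (2*N - k)^2 * (2*N - 1 - j) * (2*N - j))
    - ((173*n^4 + 284*n^3 + 186*n^2 + 65*n + 11) * n^2
       - (3*n*(20*n^2 + 19*n + 6)) * n^2 * j
       + (3*(n + 1)*(13*n + 6)) * (n^2 * (n + 3) * k + k^2))
      * ((N - k)^3 * (N - j)^2 * (2*N - 1 - k - j) * (2*N - k - j))
    = (cert_j_A N (j + 1) k * (N - j)^2 * (2*N - k - j) - cert_j_A N j k * j^2 * (2*N - 1 - j))
    + (cert_k_A N j (k + 1) * (N - k)^3 * (2*N - k - j) - cert_k_A N j k * k^2 * (2*N - 1 - k)^2)"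
proof -
  have "n = N - 1" using N by simp
  then show ?thesis unfolding cert_j_A_def cert_k_A_def by algebra
qed

lemma certificate_J:
  fixes N n j k :: real
  assumes N: "N = n + 1"
  shows "(n + 1)^3*n^2*j * (N * (2*N - 1 - k)^2 * (2*N - k)^2 * (2*N - 1 - j) * (2*N - j))
    - ((81*n^4 + 132*n^3 + 86*n^2 + 30*n + 5) * n^2
       - (2*n*(14*n^2 + 13*n + 4)) * n^2 * j
       + (2*(n + 1)*(9*n + 4)) * (n^2 * (n + 3) * k + k^2))
      * ((N - k)^3 * (N - j)^2 * (2*N - 1 - k - j) * (2*N - k - j))
    = (cert_j_J N (j + 1) k * (N - j)^2 * (2*N - k - j) - cert_j_J N j k * j^2 * (2*N - 1 - j))
    + (cert_k_J N j (k + 1) * (N - k)^3 * (2*N - k - j) - cert_k_J N j k * k^2 * (2*N - 1 - k)^2)"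
proof -
  have "n = N - 1" using N by simp
  then show ?thesis unfolding cert_j_J_def cert_k_J_def by algebra
qed

lemma certificate_H:
  fixes N n j k :: real
  assumes N: "N = n + 1"
  shows "(n + 1)*n^2*((n + 1)^2*(n + 4)*k + k^2) * (N * (2*N - 1 - k)^2 * (2*N - k)^2 * (2*N - 1 - j) * (2*N - j))
    - ((60*n^5 + 333*n^4 + 450*n^3 + 275*n^2 + 92*n + 15) * n^2
       - (n*(21*n^3 + 102*n^2 + 85*n + 25)) * n^2 * j
       + ((n + 1)*(14*n^2 + 60*n + 25)) * (n^2 * (n + 3) * k + k^2))
      * ((N - k)^3 * (N - j)^2 * (2*N - 1 - k - j) * (2*N - k - j))
    = (cert_j_H N (j + 1) k * (N - j)^2 * (2*N - k - j) - cert_j_H N j k * j^2 * (2*N - 1 - j))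
    + (cert_k_H N j (k + 1) * (N - k)^3 * (2*N - k - j) - cert_k_H N j k * k^2 * (2*N - 1 - k)^2)"
proof -
  have "n = N - 1" using N by simp
  then show ?thesis unfolding cert_j_H_def cert_k_H_def by algebra
qed

lemma weighted_sum_add:
  "weighted_sum n (\<lambda>j k. u j k + v j k) = weighted_sum n u + weighted_sum n v"
  by (simp add: weighted_sum_def sum.distrib distrib_right)

lemma weighted_sum_cmult:
  "weighted_sum n (\<lambda>j k. c * u j k) = c * weighted_sum n u"
  by (simp add: weighted_sum_def sum_distrib_left mult.assoc)

definition seqJ :: "nat \<Rightarrow> real" where
  "seqJ n = weighted_sum n (\<lambda>j k. j)"

text \<open>
  In the first-order system the weights \<open>k\<close> and \<open>k^2\<close> occur only in this combination. For \<open>n = 0\<close> only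
  \<open>k = 0\<close> contributes, so that the sum is 0.
\<close>

definition seqH :: "nat \<Rightarrow> real" where
  "seqH n = weighted_sum n (\<lambda>j k. (real n + 3) * k + k ^ 2 / real n ^ 2)"

text \<open>
  The right-hand sides of the three certificates are weights of this form.
\<close>

lemma weighted_sum_combination:
  assumes "1 \<le> n"
  shows "weighted_sum n (\<lambda>j k. p * real n ^ 2 - q * real n ^ 2 * j +
      r * (real n ^ 2 * (real n + 3) * k + k ^ 2)) =
    real n ^ 2 * (p * seqA n - q * seqJ n + r * seqH n)"
proof -
  have "weighted_sum n (\<lambda>j k. p * real n ^ 2 - q * real n ^ 2 * j +
      r * (real n ^ 2 * (real n + 3) * k + k ^ 2)) =
    weighted_sum n (\<lambda>j k. (p * real n ^ 2) * 1 + ((- q * real n ^ 2) * j +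
      (r * real n ^ 2) * ((real n + 3) * k + k ^ 2 / real n ^ 2)))"
    using assms by (intro arg_cong[of _ _ "weighted_sum n"] ext) (simp add: field_simps)
  also have "\<dots> = (p * real n ^ 2) * seqA n + ((- q * real n ^ 2) * seqJ n + (r * real n ^ 2) * seqH n)"
    unfolding seqA_def seqJ_def seqH_def
    by (subst weighted_sum_add, subst weighted_sum_add) (simp only: weighted_sum_cmult[of n "_ * real n ^ 2"])
  finally show ?thesis by (simp add: algebra_simps)
qed

lemma system_A:
  assumes "1 \<le> n"
  defines "x \<equiv> real n"
  shows "(x + 1) ^ 4 * seqA (Suc n) =
    (173*x^4 + 284*x^3 + 186*x^2 + 65*x + 11) * seqA n - 3*x*(20*x^2 + 19*x + 6) * seqJ n
    + 3*(x + 1)*(13*x + 6) * seqH n" (is "_ = ?rhs")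
proof -
  have "weighted_sum (Suc n) (\<lambda>j k. (x + 1) ^ 4 * x ^ 2 * 1) = x ^ 2 * ?rhs"
    unfolding x_def using assms(1)
    by (subst weighted_sum_step[OF assms(1) certificate_A[OF refl]], subst weighted_sum_combination) auto
  then have "(x + 1) ^ 4 * x ^ 2 * seqA (Suc n) = x ^ 2 * ?rhs"
    unfolding seqA_def weighted_sum_cmult .
  then show ?thesis using assms by simp
qed

lemma system_J:
  assumes "1 \<le> n"
  defines "x \<equiv> real n"
  shows "(x + 1) ^ 3 * seqJ (Suc n) =
    (81*x^4 + 132*x^3 + 86*x^2 + 30*x + 5) * seqA n - 2*x*(14*x^2 + 13*x + 4) * seqJ n
    + 2*(x + 1)*(9*x + 4) * seqH n" (is "_ = ?rhs")
proof -
  have "weighted_sum (Suc n) (\<lambda>j k. (x + 1) ^ 3 * x ^ 2 * j) = x ^ 2 * ?rhs"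
    unfolding x_def using assms(1)
    by (subst weighted_sum_step[OF assms(1) certificate_J[OF refl]], subst weighted_sum_combination) auto
  then show ?thesis
    using assms by (simp add: weighted_sum_cmult seqJ_def)
qed

lemma system_H:
  assumes "1 \<le> n"
  defines "x \<equiv> real n"
  shows "(x + 1) ^ 3 * seqH (Suc n) =
    (60*x^5 + 333*x^4 + 450*x^3 + 275*x^2 + 92*x + 15) * seqA n
    - x*(21*x^3 + 102*x^2 + 85*x + 25) * seqJ n + (x + 1)*(14*x^2 + 60*x + 25) * seqH n" (is "_ = ?rhs")
proof -
  have "weighted_sum (Suc n) (\<lambda>j k. (x + 1) * x ^ 2 * ((x + 1) ^ 2 * (x + 4) * k + k ^ 2)) = x ^ 2 * ?rhs"
    unfolding x_def using assms(1)
    by (subst weighted_sum_step[OF assms(1) certificate_H[OF refl]], subst weighted_sum_combination) auto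
  moreover have "weighted_sum (Suc n) (\<lambda>j k. (x + 1) * x ^ 2 * ((x + 1) ^ 2 * (x + 4) * k + k ^ 2)) =
      weighted_sum (Suc n) (\<lambda>j k. ((x + 1) ^ 3 * x ^ 2) *
        ((real (Suc n) + 3) * k + k ^ 2 / real (Suc n) ^ 2))"
  proof (intro arg_cong[of _ _ "weighted_sum (Suc n)"] ext)
    fix j k :: real
    have "(x + 1) ^ 3 * (k ^ 2 / (x + 1) ^ 2) = (x + 1) * k ^ 2"
      by (simp add: x_def power3_eq_cube power2_eq_square)
    then have "(x + 1) ^ 3 * ((x + 4) * k + k ^ 2 / (x + 1) ^ 2) =
        (x + 1) * ((x + 1) ^ 2 * (x + 4) * k + k ^ 2)"
      by algebra
    then show "(x + 1) * x ^ 2 * ((x + 1) ^ 2 * (x + 4) * k + k ^ 2) =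
      ((x + 1) ^ 3 * x ^ 2) * ((real (Suc n) + 3) * k + k ^ 2 / real (Suc n) ^ 2)"
      by (simp add: x_def add_ac)
  qed
  ultimately have "x ^ 2 * ((x + 1) ^ 3 * seqH (Suc n)) = x ^ 2 * ?rhs"
    unfolding weighted_sum_cmult seqH_def[symmetric] by (auto simp: mult_ac)
  then show ?thesis using assms by simp
qed

lemma values_at_1:
  "seqA 0 = 1" "seqA 1 = 11" "seqJ 1 = 5" "seqH 1 = 15"
  by (simp_all add: seqA_def seqJ_def seqH_def weighted_sum_def summand_def invf_def factz_def
      numeral_2_eq_2 fact_numeral)

section \<open>The recurrence for the coefficients\<close>

lemma values_at_0: "seqA 0 = 1" "seqJ 0 = 0" "seqH 0 = 0"
  by (simp_all add: seqA_def seqJ_def seqH_def weighted_sum_def summand_def invf_def factz_def)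

lemma first_order_system:
  shows "(real n + 1) ^ 4 * seqA (Suc n) =
    (173*real n^4 + 284*real n^3 + 186*real n^2 + 65*real n + 11) * seqA n
    - 3*real n*(20*real n^2 + 19*real n + 6) * seqJ n + 3*(real n + 1)*(13*real n + 6) * seqH n"
  and "(real n + 1) ^ 3 * seqJ (Suc n) =
    (81*real n^4 + 132*real n^3 + 86*real n^2 + 30*real n + 5) * seqA n
    - 2*real n*(14*real n^2 + 13*real n + 4) * seqJ n + 2*(real n + 1)*(9*real n + 4) * seqH n"
  and "(real n + 1) ^ 3 * seqH (Suc n) =
    (60*real n^5 + 333*real n^4 + 450*real n^3 + 275*real n^2 + 92*real n + 15) * seqA n
    - real n*(21*real n^3 + 102*real n^2 + 85*real n + 25) * seqJ n
    + (real n + 1)*(14*real n^2 + 60*real n + 25) * seqH n"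
  using system_A[of n] system_J[of n] system_H[of n] values_at_1 values_at_0
  by (cases "n = 0"; simp)+

text \<open>
  The recurrence has six terms. By the first-order system, its partial sums from the term of highest index
  down to the term of index \<open>n\<close> are linear forms in \<open>seqA n\<close>, \<open>seqJ n\<close>, \<open>seqH n\<close>; \<open>carry4\<close>, \<open>carry3\<close>, \<open>carry2\<close>, \<open>carry1\<close> are
  these forms after two, three, four and five terms. Remarkably their coefficients remain polynomials of
  degree at most 4 in \<open>n\<close>.
\<close>

definition carry4 :: "nat \<Rightarrow> real" where
  "carry4 n = (532*real n^4 - 1512*real n^3 - 2667*real n^2 - 882*real n) * seqA n
     - (2940*real n^3 + 2793*real n^2 + 882*real n) * seqJ n
     + (1911*real n^2 + 2793*real n + 882) * seqH n"

definition carry3 :: "nat \<Rightarrow> real" where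
  "carry3 n = (- 2721*real n^4 + 5190*real n^3 + 2340*real n^2 - 5208*real n) * seqA n
     + (10269*real n^3 + 1596*real n^2 - 5208*real n) * seqJ n
     + (- 5418*real n^2 - 1596*real n + 5208) * seqH n"

definition carry2 :: "nat \<Rightarrow> real" where
  "carry2 n = (3850*real n^4 - 3498*real n^3 + 4521*real n^2 - 924*real n) * seqA n
     + (- 10494*real n^3 + 4389*real n^2 - 924*real n) * seqJ n
     + (2871*real n^2 - 4389*real n + 924) * seqH n"

definition carry1 :: "nat \<Rightarrow> real" where
  "carry1 n = (- 1694*real n^4 - 1452*real n^3) * seqA n + 2541*real n^3 * seqJ n
     + 1452*real n^2 * seqH n"

lemma carry_0: "carry4 0 = 0" "carry3 0 = 0" "carry2 0 = 0" "carry1 0 = 0"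
  by (simp_all add: carry4_def carry3_def carry2_def carry1_def values_at_0)

definition rec_coeff :: "nat \<Rightarrow> nat \<Rightarrow> real" where
  "rec_coeff k m = (
     if k = 0 then 49 * real m ^ 4
     else if k = 1 then - 7 * (1135*real m^4 + 2204*real m^3 + 1683*real m^2 + 581*real m + 77)
     else if k = 2 then 28723*real m^4 + 40708*real m^3 + 13260*real m^2 - 1337*real m - 896
     else if k = 3 then - (32126*real m^4 + 38514*real m^3 + 26511*real m^2 + 10731*real m + 1806)
     else if k = 4 then 77 * (130*real m^4 + 254*real m^3 + 192*real m^2 + 65*real m + 8)
     else if k = 5 then 121 * (real m + 1) ^ 4
     else 0)"

text \<open>
  Horner's scheme for the recurrence. The last line says that nothing is left over.
\<close>

lemma carry_step:
  shows "rec_coeff 0 (Suc n) * seqA (Suc n) + rec_coeff 1 n * seqA n = carry4 n" (is ?s4)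
    and "carry4 (Suc n) + rec_coeff 2 n * seqA n = carry3 n" (is ?s3)
    and "carry3 (Suc n) + rec_coeff 3 n * seqA n = carry2 n" (is ?s2)
    and "carry2 (Suc n) + rec_coeff 4 n * seqA n = carry1 n" (is ?s1)
    and "carry1 (Suc n) + rec_coeff 5 n * seqA n = 0" (is ?s0)
proof -
  define x where "x = real n"
  have x: "real n = x" "real (Suc n) = x + 1" by (simp_all add: x_def)
  have nz: "x + 1 \<noteq> 0" by (simp add: x_def)
  note s = first_order_system[of n, unfolded x]
  have c: "rec_coeff 0 (Suc n) = 49 * (x + 1) ^ 4"
    "rec_coeff 1 n = - 7 * (1135*x^4 + 2204*x^3 + 1683*x^2 + 581*x + 77)"
    "rec_coeff 2 n = 28723*x^4 + 40708*x^3 + 13260*x^2 - 1337*x - 896"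
    "rec_coeff 3 n = - (32126*x^4 + 38514*x^3 + 26511*x^2 + 10731*x + 1806)"
    "rec_coeff 4 n = 77 * (130*x^4 + 254*x^3 + 192*x^2 + 65*x + 8)"
    "rec_coeff 5 n = 121 * (x + 1) ^ 4"
    unfolding x(1)[symmetric] by (simp_all add: rec_coeff_def add_ac)
  \<comment> \<open>The factor \<open>(x + 1) ^ 4\<close> clears the denominators of the first-order system.\<close>
  have combine: "(x + 1) ^ 4 * (a * seqA (Suc n) + b * seqJ (Suc n) + c * seqH (Suc n)) =
    a * ((173*x^4 + 284*x^3 + 186*x^2 + 65*x + 11) * seqA n - 3*x*(20*x^2 + 19*x + 6) * seqJ n + 3*(x + 1)*(13*x + 6) * seqH n)
    + b * (x + 1) * ((81*x^4 + 132*x^3 + 86*x^2 + 30*x + 5) * seqA n - 2*x*(14*x^2 + 13*x + 4) * seqJ n + 2*(x + 1)*(9*x + 4) * seqH n)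
    + c * (x + 1) * ((60*x^5 + 333*x^4 + 450*x^3 + 275*x^2 + 92*x + 15) * seqA n - x*(21*x^3 + 102*x^2 + 85*x + 25) * seqJ n + (x + 1)*(14*x^2 + 60*x + 25) * seqH n)" for a b c
    unfolding s[symmetric] by algebra
  show ?s4
    unfolding carry4_def c x mult.assoc[of 49] s(1) by algebra
  have "(x + 1) ^ 4 * (carry4 (Suc n) + rec_coeff 2 n * seqA n) = (x + 1) ^ 4 * carry3 n"
    using combine[of "532*(x + 1)^4 - 1512*(x + 1)^3 - 2667*(x + 1)^2 - 882*(x + 1)" "- (2940*(x + 1)^3 + 2793*(x + 1)^2 + 882*(x + 1))" "1911*(x + 1)^2 + 2793*(x + 1) + 882"]
    unfolding carry4_def carry3_def c x by algebra
  then show ?s3 using nz by simp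
  have "(x + 1) ^ 4 * (carry3 (Suc n) + rec_coeff 3 n * seqA n) = (x + 1) ^ 4 * carry2 n"
    using combine[of "- 2721*(x + 1)^4 + 5190*(x + 1)^3 + 2340*(x + 1)^2 - 5208*(x + 1)" "10269*(x + 1)^3 + 1596*(x + 1)^2 - 5208*(x + 1)" "- 5418*(x + 1)^2 - 1596*(x + 1) + 5208"]
    unfolding carry3_def carry2_def c x by algebra
  then show ?s2 using nz by simp
  have "(x + 1) ^ 4 * (carry2 (Suc n) + rec_coeff 4 n * seqA n) = (x + 1) ^ 4 * carry1 n"
    using combine[of "3850*(x + 1)^4 - 3498*(x + 1)^3 + 4521*(x + 1)^2 - 924*(x + 1)" "- 10494*(x + 1)^3 + 4389*(x + 1)^2 - 924*(x + 1)" "2871*(x + 1)^2 - 4389*(x + 1) + 924"]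
    unfolding carry2_def carry1_def c x by algebra
  then show ?s1 using nz by simp
  have "(x + 1) ^ 4 * (carry1 (Suc n) + rec_coeff 5 n * seqA n) = (x + 1) ^ 4 * 0"
    using combine[of "- 1694*(x + 1)^4 - 1452*(x + 1)^3" "2541*(x + 1)^3" "1452*(x + 1)^2"]
    unfolding carry1_def c x by algebra
  then show ?s0 using nz by simp
qed

definition P_Y :: "complex poly poly" where
  "P_Y = [: [:0, 0, 0, 0, 49:],
            smult (- 7) [:77, 581, 1683, 2204, 1135:],
            [:- 896, - 1337, 13260, 40708, 28723:],
            - [:1806, 10731, 26511, 38514, 32126:],
            smult 77 [:8, 65, 192, 254, 130:],
            smult 121 ([:1, 1:] ^ 4) :]"

lemma D_Y_eq_normal_op: "D_Y = normal_op P_Y"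
proof
  fix f
  have zero: "theta_poly 0 f = 0" "normal_op 0 f = 0"
    by (simp_all add: theta_poly_def normal_op_def)
  have smult: "theta_poly (smult c p) f = fps_const c * theta_poly p f" for c p
    by (rule fps_ext) (simp add: theta_poly_nth mult.assoc)
  have minus: "theta_poly (- p) f = - theta_poly p f" for p
    by (rule fps_ext) (simp add: theta_poly_nth)
  have "normal_op [:p0, smult (- 7) p1, p2, - p3, smult 77 p4, smult 121 p5:] f =
      theta_poly p0 f - 7 * fps_X * theta_poly p1 f + fps_X^2 * theta_poly p2 f
      - fps_X^3 * theta_poly p3 f + 77 * fps_X^4 * theta_poly p4 f + 11^2 * fps_X^5 * theta_poly p5 f"
    for p0 p1 p2 p3 p4 p5
    unfolding normal_op_pCons smult minus zero
    by (simp add: numeral_fps_const[symmetric] fps_const_neg[symmetric] algebra_simps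
        power_numeral_reduce del: fps_const_neg)
  moreover have "theta_poly [:0, 0, 0, 0, 49:] f = 7^2 * (theta ^^ 4) f"
    by (rule fps_ext)
      (simp add: theta_poly_nth theta_funpow_nth numeral_fps_const power4_eq_xxxx mult_ac)
  ultimately show "D_Y f = normal_op P_Y f"
    unfolding P_Y_def D_Y_def by (simp only:)
qed

lemma poly_coeff_P_Y: "poly (coeff P_Y k) (of_nat m) = of_real (rec_coeff k m)"
proof -
  consider "k = 0" | "k = 1" | "k = 2" | "k = 3" | "k = 4" | "k = 5" | "k > 5" by linarith
  then show ?thesis
    by cases (simp_all add: rec_coeff_def P_Y_def eval_nat_numeral algebra_simps coeff_pCons
        split: nat.splits)
qed

text \<open>
  For \<open>n < 5\<close> the chain of carries starts at a carry at index 0, all of which vanish.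
\<close>

lemma seqA_recurrence: "(\<Sum>k\<le>n. rec_coeff k (n - k) * seqA (n - k)) = 0"
proof -
  note w = carry_step
  consider "n = 0" | "n = 1" | "n = 2" | "n = 3" | "n = 4" | m where "n = m + 5"
  proof -
    have "n = 0 \<or> n = 1 \<or> n = 2 \<or> n = 3 \<or> n = 4 \<or> n = (n - 5) + 5" by linarith
    then show ?thesis using that by blast
  qed
  then show ?thesis
  proof cases
    case 1
    then show ?thesis by (simp add: rec_coeff_def)
  next
    case 2
    then show ?thesis using w(1)[of 0] carry_0(1) by simp
  next
    case 3
    then show ?thesis using w(1)[of 1] w(2)[of 0] carry_0(2) by (simp add: numeral_eq_Suc)
  next
    case 4
    then show ?thesis using w(1)[of 2] w(2)[of 1] w(3)[of 0] carry_0(3) by (simp add: numeral_eq_Suc)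
  next
    case 5
    then show ?thesis using w(1)[of 3] w(2)[of 2] w(3)[of 1] w(4)[of 0] carry_0(4)
      by (simp add: numeral_eq_Suc)
  next
    case 6
    have "(\<Sum>k\<le>n. rec_coeff k (n - k) * seqA (n - k)) = (\<Sum>k\<le>5. rec_coeff k (n - k) * seqA (n - k))"
      using 6 by (intro sum.mono_neutral_right) (auto simp: rec_coeff_def)
    then show ?thesis
      using 6 w(1)[of "m + 4"] w(2)[of "m + 3"] w(3)[of "m + 2"] w(4)[of "m + 1"] w(5)[of m]
      by (simp add: numeral_eq_Suc)
  qed
qed

lemma D_Y_annihilates:
  assumes "\<And>n. fps_nth \<Phi> n = of_real (seqA n)"
  shows "D_Y \<Phi> = 0"
proof (rule fps_ext)
  fix n
  have "fps_nth (D_Y \<Phi>) n = of_real (\<Sum>k\<le>n. rec_coeff k (n - k) * seqA (n - k))"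
    unfolding D_Y_eq_normal_op normal_op_nth assms poly_coeff_P_Y by simp
  then show "fps_nth (D_Y \<Phi>) n = fps_nth 0 n"
    unfolding seqA_recurrence by simp
qed

section \<open>Indicial polynomials\<close>

text \<open>
  The operators act on polynomials as well, and polynomials, unlike formal power series in \<open>z\<close>, can be
  expanded at every point and at infinity.
\<close>

definition poly_op :: "(nat \<Rightarrow> complex poly) \<Rightarrow> nat \<Rightarrow> complex poly \<Rightarrow> complex poly" where
  "poly_op c n f = (\<Sum>j\<le>n. c j * (pderiv ^^ j) f)"

text \<open>
  The operator \<open>z^j (d/dz)^j\<close> multiplies \<open>z^N\<close> by the value of this polynomial at \<open>N\<close>.
\<close>

definition falling :: "nat \<Rightarrow> complex poly" where
  "falling j = (\<Prod>i<j. [:- of_nat i, 1:])"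

lemma coeff_monom_pderiv:
  "coeff (monom 1 j * (pderiv ^^ j) f) N = poly (falling j) (of_nat N) * coeff f N"
proof (induction j arbitrary: N)
  case (Suc j)
  let ?g = "(pderiv ^^ j) f"
  have shift: "monom 1 (Suc j) * pderiv ?g =
      monom 1 (Suc 0) * pderiv (monom 1 j * ?g) - smult (of_nat j) (monom 1 j * ?g)"
  proof -
    have "monom 1 (Suc 0) * pderiv (monom 1 j) = smult (of_nat j) (monom (1 :: complex) j)"
      by (cases j) (simp_all add: pderiv_monom mult_monom smult_monom)
    moreover have "monom 1 (Suc 0) * pderiv (monom 1 j * ?g) =
        (monom 1 (Suc 0) * monom 1 j) * pderiv ?g + (monom 1 (Suc 0) * pderiv (monom 1 j)) * ?g"
      by (simp only: pderiv_mult ring_distribs mult_ac)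
    ultimately show ?thesis by (simp add: mult_monom)
  qed
  have euler: "coeff (monom 1 (Suc 0) * pderiv h) N = of_nat N * coeff h N" for h :: "complex poly"
    by (cases N) (simp_all add: monom_Suc coeff_pderiv coeff_monom_mult del: of_nat_Suc)
  have "falling (Suc j) = falling j * [:- of_nat j, 1:]"
    by (simp add: falling_def)
  then have "poly (falling (Suc j)) (of_nat N) = of_nat N * poly (falling j) (of_nat N)
      - of_nat j * poly (falling j) (of_nat N)"
    by (simp only: poly_mult) (simp add: algebra_simps)
  moreover have "coeff (monom 1 (Suc j) * pderiv ?g) N =
      of_nat N * (poly (falling j) (of_nat N) * coeff f N) - of_nat j * (poly (falling j) (of_nat N) * coeff f N)"
    by (simp only: shift coeff_diff coeff_smult euler Suc)
  ultimately show ?case by (simp only: left_diff_distrib mult.assoc funpow.simps o_apply)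
qed (simp add: falling_def)

lemma degree_falling: "degree (falling j) = j"
  by (simp add: falling_def degree_prod_sum_eq)

lemma coeff_falling: "coeff (falling j) j = 1" "coeff (falling (Suc j)) j = - of_nat (Suc j choose 2)"
proof -
  have 1: "coeff (falling j) j = 1" for j
  proof -
    have "lead_coeff (falling j) = 1"
      unfolding falling_def lead_coeff_prod by simp
    then show ?thesis by (simp add: degree_falling)
  qed
  show "coeff (falling j) j = 1" by (rule 1)
  have step: "falling (Suc j) = pCons 0 (falling j) - smult (of_nat j) (falling j)" for j
    by (simp add: falling_def)
  show "coeff (falling (Suc j)) j = - of_nat (Suc j choose 2)"
  proof (induction j)
    case 0
    then show ?case by (simp add: falling_def)
  next
    case (Suc j)
    have "coeff (falling (Suc (Suc j))) (Suc j) = coeff (falling (Suc j)) j - of_nat (Suc j)"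
      by (subst step) (simp add: 1)
    also have "\<dots> = - of_nat (Suc (Suc j) choose 2)"
      unfolding Suc by (simp add: numeral_2_eq_2)
    finally show ?case .
  qed
qed

text \<open>
  If \<open>L\<close> is the operator with coefficients \<open>c\<close>, then \<open>z^n L\<close> maps \<open>z^N\<close> to the sum of
  \<open>poly (indicial c n a) N * z^(N + a)\<close> over all \<open>a\<close>. For the smallest \<open>a\<close> with nonzero \<open>indicial c n a\<close> this is the
  indicial polynomial at 0, for the largest \<open>a\<close> the one at infinity.
\<close>

definition indicial :: "(nat \<Rightarrow> complex poly) \<Rightarrow> nat \<Rightarrow> nat \<Rightarrow> complex poly" where
  "indicial c n a = (\<Sum>j\<le>n. smult (coeff (monom 1 (n - j) * c j) a) (falling j))"

lemma coeff_poly_op: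
  "coeff (monom 1 n * poly_op c n f) N =
     (\<Sum>a\<le>N. poly (indicial c n a) (of_nat (N - a)) * coeff f (N - a))"
proof -
  have "monom 1 n * (c j * (pderiv ^^ j) f) = (monom 1 (n - j) * c j) * (monom 1 j * (pderiv ^^ j) f)"
    if "j \<le> n" for j
  proof -
    have "monom (1 :: complex) n = monom 1 (n - j) * monom 1 j"
      using that by (simp add: mult_monom)
    then show ?thesis by (simp only: mult_ac)
  qed
  then have "monom 1 n * poly_op c n f =
      (\<Sum>j\<le>n. (monom 1 (n - j) * c j) * (monom 1 j * (pderiv ^^ j) f))"
    unfolding poly_op_def sum_distrib_left by (intro sum.cong) auto
  then have "coeff (monom 1 n * poly_op c n f) N = (\<Sum>j\<le>n. \<Sum>a\<le>N.
      coeff (monom 1 (n - j) * c j) a * (poly (falling j) (of_nat (N - a)) * coeff f (N - a)))"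
    by (simp only: coeff_sum coeff_mult[of "monom 1 (n - _) * _"] coeff_monom_pderiv)
  also have "\<dots> = (\<Sum>a\<le>N. poly (indicial c n a) (of_nat (N - a)) * coeff f (N - a))"
    by (subst sum.swap) (simp add: indicial_def poly_sum sum_distrib_right mult.assoc)
  finally show ?thesis .
qed

lemma degree_indicial: "degree (indicial c n a) \<le> n"
  unfolding indicial_def
  by (intro degree_sum_le) (auto intro: order.trans[OF degree_smult_le] simp: degree_falling)

lemma coeff_indicial_top: "coeff (indicial c n a) n = coeff (c n) a"
proof -
  have "coeff (indicial c n a) n = (\<Sum>j\<le>n. if j = n then coeff (c n) a else 0)"
    unfolding indicial_def coeff_sum
    by (intro sum.cong) (auto simp: coeff_falling coeff_eq_0 degree_falling)
  then show ?thesis by simp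
qed

lemma coeff_indicial_below_top:
  "coeff (indicial c (Suc n) a) n =
     coeff (monom 1 1 * c n) a - of_nat (Suc n choose 2) * coeff (c (Suc n)) a"
proof -
  have "(\<Sum>j\<le>n. coeff (smult (coeff (monom 1 (Suc n - j) * c j) a) (falling j)) n) =
      (\<Sum>j\<le>n. if j = n then coeff (monom 1 1 * c n) a else 0)"
    by (intro sum.cong) (auto simp: coeff_falling coeff_eq_0 degree_falling)
  then show ?thesis
    unfolding indicial_def coeff_sum by (simp add: coeff_falling)
qed

text \<open>
  The relation \<open>R\<close> is \<open>\<le>\<close> or \<open>\<ge>\<close>, so that lowest and highest terms, i.e. the points 0 and infinity, are treated
  at the same time.
\<close>

definition end_at :: "(nat \<Rightarrow> nat \<Rightarrow> bool) \<Rightarrow> (nat \<Rightarrow> 'a :: zero) \<Rightarrow> nat \<Rightarrow> bool" where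
  "end_at R \<phi> e \<longleftrightarrow> (\<forall>a. \<phi> a \<noteq> 0 \<longrightarrow> R e a)"

lemma end_at_exists:
  fixes \<phi> :: "nat \<Rightarrow> 'a :: zero"
  assumes "R = (\<le>) \<or> R = (\<ge>)" "\<phi> b \<noteq> 0" "\<And>a. \<phi> a \<noteq> 0 \<Longrightarrow> a \<le> m"
  shows "\<exists>e. \<phi> e \<noteq> 0 \<and> end_at R \<phi> e"
  using assms(1)
proof
  assume R: "R = (\<le>)"
  show ?thesis
    using LeastI[of "\<lambda>a. \<phi> a \<noteq> 0", OF assms(2)] Least_le[of "\<lambda>a. \<phi> a \<noteq> 0"]
    by (auto simp: R end_at_def)
next
  assume R: "R = (\<ge>)"
  show ?thesis
    using GreatestI_nat[of "\<lambda>a. \<phi> a \<noteq> 0" b m] Greatest_le_nat[of "\<lambda>a. \<phi> a \<noteq> 0" _ m] assms(2,3)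
    by (auto simp: R end_at_def)
qed

lemma end_at_mult:
  fixes p q :: "complex poly"
  assumes "R = (\<le>) \<or> R = (\<ge>)" "end_at R (coeff p) e" "end_at R (coeff q) m"
  shows "end_at R (coeff (p * q)) (e + m)" "coeff (p * q) (e + m) = coeff p e * coeff q m"
proof -
  have "end_at R (coeff (p * q)) (e + m)"
    unfolding end_at_def
  proof (intro allI impI)
    fix N assume "coeff (p * q) N \<noteq> 0"
    then obtain a where "a \<le> N" "coeff p a \<noteq> 0" "coeff q (N - a) \<noteq> 0"
      unfolding coeff_mult by (metis (no_types, lifting) atMost_iff mult_eq_0_iff sum.neutral)
    then have "R e a" "R m (N - a)" using assms(2,3) by (auto simp: end_at_def)
    then show "R (e + m) N" using assms(1) \<open>a \<le> N\<close> by auto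
  qed
  moreover have "coeff (p * q) (e + m) = (\<Sum>a\<le>e+m. if a = e then coeff p e * coeff q m else 0)"
    unfolding coeff_mult
  proof (intro sum.cong refl)
    fix a assume "a \<in> {..e+m}"
    moreover have "coeff p a * coeff q (e + m - a) = 0" if "a \<noteq> e"
    proof (rule ccontr)
      assume "coeff p a * coeff q (e + m - a) \<noteq> 0"
      then have "R e a" "R m (e + m - a)" using assms(2,3) by (auto simp: end_at_def)
      then show False using assms(1) that \<open>a \<in> {..e+m}\<close> by auto
    qed
    ultimately show "coeff p a * coeff q (e + m - a) = (if a = e then coeff p e * coeff q m else 0)"
      by auto
  qed
  ultimately show "end_at R (coeff (p * q)) (e + m)" "coeff (p * q) (e + m) = coeff p e * coeff q m"
    by simp_all
qed

lemma end_at_poly_op: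
  assumes "R = (\<le>) \<or> R = (\<ge>)" "end_at R (indicial c n) e" "end_at R (coeff f) m"
  shows "end_at R (coeff (monom 1 n * poly_op c n f)) (e + m)"
    "coeff (monom 1 n * poly_op c n f) (e + m) = poly (indicial c n e) (of_nat m) * coeff f m"
proof -
  have "end_at R (coeff (monom 1 n * poly_op c n f)) (e + m)"
    unfolding end_at_def
  proof (intro allI impI)
    fix N assume "coeff (monom 1 n * poly_op c n f) N \<noteq> 0"
    then obtain a where "a \<le> N" "poly (indicial c n a) (of_nat (N - a)) \<noteq> 0" "coeff f (N - a) \<noteq> 0"
      unfolding coeff_poly_op by (metis (no_types, lifting) atMost_iff mult_eq_0_iff sum.neutral)
    moreover from this have "indicial c n a \<noteq> 0" by (metis poly_0)
    ultimately have "R e a" "R m (N - a)" using assms(2,3) by (simp_all add: end_at_def)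
    then show "R (e + m) N" using assms(1) \<open>a \<le> N\<close> by auto
  qed
  moreover have "coeff (monom 1 n * poly_op c n f) (e + m) =
      (\<Sum>a\<le>e+m. if a = e then poly (indicial c n e) (of_nat m) * coeff f m else 0)"
    unfolding coeff_poly_op
  proof (intro sum.cong refl)
    fix a assume "a \<in> {..e+m}"
    moreover have "poly (indicial c n a) (of_nat (e + m - a)) * coeff f (e + m - a) = 0" if "a \<noteq> e"
    proof (rule ccontr)
      assume "poly (indicial c n a) (of_nat (e + m - a)) * coeff f (e + m - a) \<noteq> 0"
      then have "indicial c n a \<noteq> 0" "coeff f (e + m - a) \<noteq> 0" by (metis poly_0 mult_zero_left mult_zero_right)+
      then have "R e a" "R m (e + m - a)" using assms(2,3) by (auto simp: end_at_def)
      then show False using assms(1) that \<open>a \<in> {..e+m}\<close> by auto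
    qed
    ultimately show "poly (indicial c n a) (of_nat (e + m - a)) * coeff f (e + m - a) =
        (if a = e then poly (indicial c n e) (of_nat m) * coeff f m else 0)"
      by auto
  qed
  ultimately show "end_at R (coeff (monom 1 n * poly_op c n f)) (e + m)"
    "coeff (monom 1 n * poly_op c n f) (e + m) = poly (indicial c n e) (of_nat m) * coeff f m"
    by simp_all
qed

lemma poly_eqI_large_nat:
  fixes p q :: "complex poly"
  assumes "\<And>m. m \<ge> r \<Longrightarrow> poly p (of_nat m) = poly q (of_nat m)"
  shows "p = q"
proof (rule ccontr)
  assume "p \<noteq> q"
  then have "finite {x. poly (p - q) x = 0}" using poly_roots_finite[of "p - q"] by simp
  moreover have "of_nat ` {r..} \<subseteq> {x. poly (p - q) x = 0}"
    using assms by auto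
  ultimately have "finite ((of_nat :: nat \<Rightarrow> complex) ` {r..})" by (rule finite_subset[rotated])
  then have "finite {r..}" by (rule finite_imageD) (simp add: inj_on_def)
  then show False by (simp add: infinite_Ici)
qed

text \<open>
  Apply both sides to \<open>z^m\<close> and compare the extremal terms. On the right, the inner operator sends \<open>z^m\<close> to a
  multiple of \<open>z^(m + ec - r)\<close> plus less extremal terms, and the outer operator is evaluated at this
  exponent; hence the shift of the argument of its indicial polynomial.
\<close>

lemma indicial_factor:
  assumes R: "R = (\<le>) \<or> R = (\<ge>)"
    and comp: "\<And>f. q * poly_op d (s + r) f = poly_op g s (poly_op c r f)"
    and q: "end_at R (coeff q) eq" "coeff q eq \<noteq> 0"
    and d: "end_at R (indicial d (s + r)) ed" "indicial d (s + r) ed \<noteq> 0"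
    and c: "end_at R (indicial c r) ec" "indicial c r ec \<noteq> 0"
    and g: "end_at R (indicial g s) eg" "indicial g s eg \<noteq> 0"
  shows "smult (coeff q eq) (indicial d (s + r) ed) =
    pcompose (indicial g s eg) [:of_nat ec - of_nat r, 1:] * indicial c r ec"
proof -
  let ?l = "smult (coeff q eq) (indicial d (s + r) ed)"
  let ?r = "pcompose (indicial g s eg) [:of_nat ec - of_nat r, 1:] * indicial c r ec"
  have refl_R: "R x x" for x using R by auto
  define H where "H m = monom 1 (s + r) * (q * poly_op d (s + r) (monom 1 m))" for m
  have left: "end_at R (coeff (H m)) (eq + (ed + m))" "coeff (H m) (eq + (ed + m)) = poly ?l (of_nat m)" for m
  proof -
    have f: "end_at R (coeff (monom 1 m)) m" for m
      using refl_R by (auto simp: end_at_def split: if_splits)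
    have "H m = q * (monom 1 (s + r) * poly_op d (s + r) (monom 1 m))"
      by (simp add: H_def mult_ac)
    then show "end_at R (coeff (H m)) (eq + (ed + m))" "coeff (H m) (eq + (ed + m)) = poly ?l (of_nat m)"
      using end_at_mult[OF R q(1) end_at_poly_op(1)[OF R d(1) f]] end_at_poly_op(2)[OF R d(1) f]
      by simp_all
  qed
  have right: "end_at R (coeff (H m)) (eg + (ec + m))" "coeff (H m) (eg + (ec + m)) = poly ?r (of_nat m)"
    if "m \<ge> r" for m
  proof -
    have f: "end_at R (coeff (monom 1 m)) m"
      using refl_R by (auto simp: end_at_def split: if_splits)
    define h where "h = poly_op c r (monom 1 m)"
    have monom: "end_at R (coeff (monom 1 r)) r"
      using refl_R by (auto simp: end_at_def split: if_splits)
    have shift: "coeff h N = coeff (monom 1 r * h) (N + r)" for N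
      by (simp add: coeff_monom_mult)
    have h: "end_at R (coeff h) (ec + m - r)" "coeff h (ec + m - r) = poly (indicial c r ec) (of_nat m)"
    proof -
      have ends: "end_at R (coeff (monom 1 r * h)) (ec + m)"
        "coeff (monom 1 r * h) (ec + m) = poly (indicial c r ec) (of_nat m)"
        using end_at_poly_op[OF R c(1) f] by (simp_all add: h_def)
      have "R (ec + m - r) N" if "coeff h N \<noteq> 0" for N
      proof -
        have "R (ec + m) (N + r)" using ends(1) that shift unfolding end_at_def by metis
        then show ?thesis using R by auto
      qed
      then show "end_at R (coeff h) (ec + m - r)" by (simp add: end_at_def)
      show "coeff h (ec + m - r) = poly (indicial c r ec) (of_nat m)"
        using ends(2) shift[of "ec + m - r"] that by simp
    qed
    have H: "H m = monom 1 r * (monom 1 s * poly_op g s h)"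
    proof -
      have "monom (1 :: complex) (s + r) = monom 1 r * monom 1 s"
        by (simp add: mult_monom add.commute)
      then show ?thesis unfolding H_def comp h_def[symmetric] by (simp only: mult.assoc)
    qed
    have degrees: "r + (eg + (ec + m - r)) = eg + (ec + m)" using that by simp
    note outer = end_at_mult[OF R monom end_at_poly_op(1)[OF R g(1) h(1)], unfolded degrees, folded H]
    show "end_at R (coeff (H m)) (eg + (ec + m))" by (rule outer(1))
    have "coeff (H m) (eg + (ec + m)) =
        poly (indicial g s eg) (of_nat (ec + m - r)) * poly (indicial c r ec) (of_nat m)"
      unfolding outer(2) end_at_poly_op(2)[OF R g(1) h(1)] h(2) by simp
    moreover have "of_nat (ec + m - r) = (of_nat ec - of_nat r + of_nat m :: complex)"
      using that by (simp add: of_nat_diff)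
    ultimately show "coeff (H m) (eg + (ec + m)) = poly ?r (of_nat m)"
      by (simp only: poly_mult poly_pcompose poly_pCons poly_0 mult_zero_right add_0_right mult_1_right)
  qed
  have "?l * ?r \<noteq> 0"
    using q d c g by (simp add: pcompose_eq_0_iff)
  then obtain m where m: "m \<ge> r" "poly (?l * ?r) (of_nat m) \<noteq> 0"
    using poly_eqI_large_nat[of r "?l * ?r" 0] by (metis poly_0)
  have "poly ?l (of_nat m) \<noteq> 0" "poly ?r (of_nat m) \<noteq> 0"
    using m(2) by (metis poly_mult mult_zero_left mult_zero_right)+
  then have "R (eg + (ec + m)) (eq + (ed + m))" "R (eq + (ed + m)) (eg + (ec + m))"
    using left[of m] right[OF m(1)] by (metis end_at_def)+
  then have "eq + (ed + m) = eg + (ec + m)"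
    using R by auto
  then have "eq + (ed + k) = eg + (ec + k)" for k by simp
  then have "poly ?l (of_nat k) = poly ?r (of_nat k)" if "k \<ge> r" for k
    using left(2)[of k] right(2)[OF that] by metis
  then show ?thesis by (rule poly_eqI_large_nat)
qed
lemma indicial_end_exists:
  assumes R: "R = (\<le>) \<or> R = (\<ge>)" and nz: "indicial c n b \<noteq> 0"
  shows "\<exists>e. indicial c n e \<noteq> 0 \<and> end_at R (indicial c n) e"
proof (rule end_at_exists[where \<phi> = "indicial c n", OF R nz])
  fix a assume "indicial c n a \<noteq> 0"
  then obtain j where j: "j \<le> n" "coeff (monom 1 (n - j) * c j) a \<noteq> 0"
    unfolding indicial_def by (metis (no_types, lifting) atMost_iff smult_0_left sum.neutral)
  then have "a \<le> degree (monom 1 (n - j) * c j)" by (rule_tac le_degree)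
  also have "\<dots> \<le> (\<Sum>j\<le>n. degree (monom 1 (n - j) * c j))"
    using j(1) by (intro member_le_sum) auto
  finally show "a \<le> (\<Sum>j\<le>n. degree (monom 1 (n - j) * c j))" .
qed

text \<open>
  A right factor of an operator that is regular singular (at 0 or at infinity) is regular singular, and its
  exponents are exponents of the operator: the indicial polynomials of the two factors have degrees at
  most \<open>s\<close> and \<open>r\<close>, and their product, up to a shift, has degree \<open>s + r\<close>.
\<close>

lemma indicial_right_factor:
  assumes R: "R = (\<le>) \<or> R = (\<ge>)"
    and comp: "\<And>f. q * poly_op d (s + r) f = poly_op g s (poly_op c r f)"
    and q: "q \<noteq> 0" and c: "c r \<noteq> 0"
    and d: "end_at R (indicial d (s + r)) ed" "degree (indicial d (s + r) ed) = s + r"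
      "indicial d (s + r) ed \<noteq> 0"
  obtains e where "end_at R (indicial c r) e" "degree (indicial c r e) = r" "indicial c r e \<noteq> 0"
    "indicial c r e dvd indicial d (s + r) ed"
proof -
  obtain b where "coeff q b \<noteq> 0" using q by (auto simp: poly_eq_iff)
  then obtain eq where eq: "coeff q eq \<noteq> 0" "end_at R (coeff q) eq"
    using end_at_exists[OF R, of "coeff q" b "degree q"] le_degree by metis
  obtain b where "coeff (c r) b \<noteq> 0" using c by (auto simp: poly_eq_iff)
  then have "indicial c r b \<noteq> 0" using coeff_indicial_top[of c r b] by auto
  then obtain ec where ec: "indicial c r ec \<noteq> 0" "end_at R (indicial c r) ec"
    using indicial_end_exists[OF R] by metis
  have "\<exists>b. indicial g s b \<noteq> 0"
  proof (rule ccontr)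
    assume "\<not> ?thesis"
    then have "monom 1 s * poly_op g s f = 0" for f
      by (intro poly_eqI) (simp add: coeff_poly_op)
    then have "poly_op g s f = 0" for f by (simp add: monom_eq_0_iff)
    then have zero: "poly_op d (s + r) f = 0" for f
      using comp[of f] q by simp
    have "end_at R (coeff (monom 1 m)) m" for m
      using R by (auto simp: end_at_def)
    from end_at_poly_op(2)[OF R d(1) this] have "poly (indicial d (s + r) ed) (of_nat m) = 0" for m
      by (simp add: zero)
    then have "indicial d (s + r) ed = 0"
      by (intro poly_eqI_large_nat[of 0]) simp
    then show False using d(3) by simp
  qed
  then obtain eg where eg: "indicial g s eg \<noteq> 0" "end_at R (indicial g s) eg"
    using indicial_end_exists[OF R] by metis
  have factor: "smult (coeff q eq) (indicial d (s + r) ed) =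
      pcompose (indicial g s eg) [:of_nat ec - of_nat r, 1:] * indicial c r ec" (is "_ = ?g * _")
    by (rule indicial_factor[OF R comp eq(2,1) d(1,3) ec(2,1) eg(2,1)])
  then have "degree (smult (coeff q eq) (indicial d (s + r) ed)) = degree ?g + degree (indicial c r ec)"
    using ec eg by (simp only: factor) (subst degree_mult_eq, auto simp: pcompose_eq_0_iff)
  moreover have "degree ?g \<le> s"
    using degree_indicial[of g s eg] by (simp add: degree_pcompose)
  ultimately have "degree (indicial c r ec) = r"
    using degree_indicial[of c r ec] d(2) eq(1) by simp
  moreover have "indicial c r ec dvd indicial d (s + r) ed"
    using factor eq(1) by (metis dvd_smult_cancel dvd_triv_right)
  ultimately show ?thesis using that ec by blast
qed

section \<open>Sums of exponents and sums of residues\<close>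

lemma proots_subset_of_dvd:
  fixes p q :: "complex poly"
  assumes "p dvd q" "q \<noteq> 0"
  shows "proots p \<subseteq># proots q"
  using assms dvd_imp_order_le by (intro mset_subset_eqI) (cases "p = 0"; simp)

lemma dvd_of_order_le:
  fixes p q :: "complex poly"
  assumes "p \<noteq> 0" "q \<noteq> 0" "\<And>x. order x p \<le> order x q"
  shows "p dvd q"
proof -
  have "proots p \<subseteq># proots q"
    using assms by (intro mset_subset_eqI) simp
  then have "(\<Prod>x\<in>#proots p. [:- x, 1:]) dvd (\<Prod>x\<in>#proots q. [:- x, 1:])"
    by (intro prod_mset_subset_imp_dvd image_mset_subseteq_mono)
  then show ?thesis
    using assms(1,2) complex_poly_decompose_multiset[of p] complex_poly_decompose_multiset[of q]
    by (metis smult_dvd dvd_smult leading_coeff_0_iff)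
qed

lemma coeff_prod_linear_factors:
  fixes B :: "complex multiset"
  shows "coeff (\<Prod>x\<in>#B. [:- x, 1:]) (size B) = 1"
    and "B \<noteq> {#} \<Longrightarrow> coeff (\<Prod>x\<in>#B. [:- x, 1:]) (size B - 1) = - sum_mset B"
proof (induction B)
  case (add x B)
  have "degree (\<Prod>x\<in>#B. [:- x, 1:]) \<le> size B"
    by (induction B) (auto intro!: order.trans[OF degree_mult_le] simp del: mult_pCons_left mult_pCons_right)
  then have z: "coeff (\<Prod>x\<in>#B. [:- x, 1:]) (Suc (size B)) = 0" by (simp add: coeff_eq_0)
  {
    case 1
    then show ?case using add.IH(1) z by simp
  next
    case 2
    show ?case
    proof (cases "B = {#}")
      case False
      then obtain k where "size B = Suc k" by (metis gr0_implies_Suc nonempty_has_size)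
      then show ?thesis using add.IH False by simp
    qed simp
  }
qed simp_all

text \<open>
  Vieta's formula for the two highest coefficients of the indicial polynomial.
\<close>

lemma sum_of_exponents:
  fixes c :: "nat \<Rightarrow> complex poly"
  assumes "degree (indicial c (Suc k) e) = Suc k"
  shows "size (proots (indicial c (Suc k) e)) = Suc k"
    "sum_mset (proots (indicial c (Suc k) e)) =
      of_nat (Suc k choose 2) - coeff (monom 1 1 * c k) e / coeff (c (Suc k)) e"
    "coeff (c (Suc k)) e \<noteq> 0"
proof -
  let ?l = "indicial c (Suc k) e"
  show size: "size (proots ?l) = Suc k" using assms by (simp add: size_proots_complex)
  have lead: "lead_coeff ?l = coeff (c (Suc k)) e" using assms by (simp add: coeff_indicial_top)
  have "?l \<noteq> 0" using assms by auto
  then show nz: "coeff (c (Suc k)) e \<noteq> 0" using lead by (metis leading_coeff_0_iff)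
  have "coeff ?l k = lead_coeff ?l * coeff (\<Prod>x\<in>#proots ?l. [:- x, 1:]) k"
    by (subst (1) complex_poly_decompose_multiset[of ?l, symmetric]) simp
  also have "coeff (\<Prod>x\<in>#proots ?l. [:- x, 1:]) k = - sum_mset (proots ?l)"
    using coeff_prod_linear_factors(2)[of "proots ?l"] size by force
  finally have "coeff (monom 1 1 * c k) e - of_nat (Suc k choose 2) * coeff (c (Suc k)) e =
      - coeff (c (Suc k)) e * sum_mset (proots ?l)"
    unfolding coeff_indicial_below_top lead by simp
  then show "sum_mset (proots ?l) = of_nat (Suc k choose 2) - coeff (monom 1 1 * c k) e / coeff (c (Suc k)) e"
    using nz by (simp add: field_simps del: binomial_Suc_Suc)
qed

lemma end_at_of_indicial:
  assumes "end_at R (indicial c (Suc k)) e"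
  shows "end_at R (coeff (c (Suc k))) e" "end_at R (coeff (monom 1 1 * c k)) e"
proof -
  have "coeff (c (Suc k)) a = 0 \<and> coeff (monom 1 1 * c k) a = 0" if "indicial c (Suc k) a = 0" for a
    using coeff_indicial_top[of c "Suc k" a] coeff_indicial_below_top[of c k a] that by simp
  then show "end_at R (coeff (c (Suc k))) e" "end_at R (coeff (monom 1 1 * c k)) e"
    using assms by (auto simp: end_at_def)
qed

text \<open>
  The hypothesis \<open>local\<close> says that \<open>b / a\<close> has at most a simple pole at \<open>p\<close>, with residue \<open>\<rho> p\<close>. As \<open>b / a\<close>
  vanishes at infinity, it is the sum of its polar parts, \<open>b = (\<Sum>p. \<rho> p * a / (z - p))\<close>. Comparing the
  coefficients of \<open>z^(degree a - 1)\<close> gives the claim.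
\<close>

lemma sum_of_residues:
  fixes a b :: "complex poly" and \<rho> :: "complex \<Rightarrow> complex"
  assumes a: "a \<noteq> 0" and Z: "finite Z" "{p. poly a p = 0} \<subseteq> Z"
    and deg: "degree (monom 1 1 * b) \<le> degree a"
    and local: "\<And>p. \<exists>e u v. a = [:- p, 1:] ^ e * u \<and> [:- p, 1:] * b = [:- p, 1:] ^ e * v \<and>
      poly u p \<noteq> 0 \<and> \<rho> p = poly v p / poly u p"
  shows "(\<Sum>p\<in>Z. \<rho> p) = coeff (monom 1 1 * b) (degree a) / lead_coeff a"
proof -
  define Z0 where "Z0 = {p. poly a p = 0}"
  have fin: "finite Z0" using a by (simp add: Z0_def poly_roots_finite)
  have regular: "\<rho> p = 0" if "p \<notin> Z0" for p
  proof -
    obtain e u v where euv: "a = [:- p, 1:] ^ e * u" "[:- p, 1:] * b = [:- p, 1:] ^ e * v"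
      "\<rho> p = poly v p / poly u p" using local by metis
    have "poly a p = 0" if "e > 0" using that by (simp add: euv(1))
    then have "e = 0" using that by (auto simp: Z0_def)
    then have "v = [:- p, 1:] * b" using euv(2) by (simp only: power_0 mult_1)
    then show ?thesis by (simp add: euv(3))
  qed
  define h where "h p = a div [:- p, 1:]" for p
  have h: "a = [:- p, 1:] * h p" if "p \<in> Z0" for p
  proof -
    have "[:- p, 1:] dvd a" using that by (simp add: Z0_def poly_eq_0_iff_dvd)
    then show ?thesis by (simp only: h_def dvd_mult_div_cancel)
  qed
  \<comment> \<open>It suffices that \<open>a\<close> divides \<open>b - W\<close>, since the degree of \<open>b - W\<close> is smaller than that of \<open>a\<close>.\<close>
  define W where "W = (\<Sum>p\<in>Z0. smult (\<rho> p) (h p))"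
  have a_dvd: "a dvd b - W"
  proof (cases "b - W = 0")
    case False
    have "order p a \<le> order p (b - W)" for p
    proof (cases "p \<in> Z0")
      case True
      obtain e u v where euv: "a = [:- p, 1:] ^ e * u" "[:- p, 1:] * b = [:- p, 1:] ^ e * v"
        "poly u p \<noteq> 0" "\<rho> p = poly v p / poly u p" using local by metis
      have u0: "u \<noteq> 0" using euv(3) by auto
      have e: "order p a = e"
        unfolding euv(1) using u0 euv(3) by (subst order_mult) (auto simp: order_power_n_n order_0I)
      have "e \<noteq> 0" using True euv(1,3) by (auto simp: Z0_def intro!: Nat.gr0I)
      then obtain k where k: "e = Suc k" by (cases e) auto
      have "b = [:- p, 1:] ^ k * v" "h p = [:- p, 1:] ^ k * u"
      proof -
        have "[:- p, 1:] * b = [:- p, 1:] * ([:- p, 1:] ^ k * v)"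
          unfolding euv(2) k by (simp only: power_Suc mult.assoc)
        then show "b = [:- p, 1:] ^ k * v" by (subst (asm) mult_cancel_left) auto
        have "[:- p, 1:] * h p = [:- p, 1:] * ([:- p, 1:] ^ k * u)"
          unfolding h[OF True, symmetric] by (subst euv(1)) (simp only: k power_Suc mult.assoc)
        then show "h p = [:- p, 1:] ^ k * u" by (subst (asm) mult_cancel_left) auto
      qed
      then have "b - smult (\<rho> p) (h p) = [:- p, 1:] ^ k * (v - smult (\<rho> p) u)"
        by (simp add: algebra_simps)
      moreover have "[:- p, 1:] dvd v - smult (\<rho> p) u"
        using euv(3,4) by (simp flip: poly_eq_0_iff_dvd)
      ultimately have "[:- p, 1:] ^ e dvd b - smult (\<rho> p) (h p)"
        unfolding k power_Suc2 by (metis mult_dvd_mono dvd_refl)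
      moreover have "[:- p, 1:] ^ e dvd smult (\<rho> x) (h x)" if "x \<in> Z0 - {p}" for x
      proof (rule dvd_smult)
        have "h x \<noteq> 0" using h[of x] that a by auto
        moreover have "order p a = order p [:- x, 1:] + order p (h x)"
          using h[of x] that a by (metis DiffD1 order_mult)
        moreover have "order p [:- x, 1:] = 0"
          using that by (intro order_0I) auto
        ultimately show "[:- p, 1:] ^ e dvd h x"
          using e by (simp add: order_divides)
      qed
      ultimately have "[:- p, 1:] ^ e dvd (b - smult (\<rho> p) (h p)) - (\<Sum>x\<in>Z0 - {p}. smult (\<rho> x) (h x))"
        by (rule dvd_diff[OF _ dvd_sum])
      also have "\<dots> = b - W"
        unfolding W_def using sum.remove[OF fin True, of "\<lambda>x. smult (\<rho> x) (h x)"] by simp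
      finally show ?thesis using False e by (simp add: order_divides)
    next
      case False
      then show ?thesis by (simp add: Z0_def order_0I)
    qed
    then show ?thesis using a False by (intro dvd_of_order_le)
  qed simp
  have deg_a: "degree a = Suc (degree (h p))" if "p \<in> Z0" for p
  proof -
    have "h p \<noteq> 0" using h[OF that] a by auto
    then have "degree ([:- p, 1:] * h p) = degree [:- p, 1:] + degree (h p)"
      by (intro degree_mult_eq) auto
    then show ?thesis using h[OF that] by simp
  qed
  have deg_h: "coeff (h p) (degree a) = 0" "coeff (monom 1 1 * h p) (degree a) = lead_coeff a"
    if "p \<in> Z0" for p
  proof -
    show 1: "coeff (h p) (degree a) = 0" using deg_a[OF that] by (simp add: coeff_eq_0)
    have "lead_coeff a = coeff ([:- p, 1:] * h p) (degree a)" using h[OF that] by simp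
    then show "coeff (monom 1 1 * h p) (degree a) = lead_coeff a"
      using 1 by (simp add: monom_Suc)
  qed
  have "b - W = 0"
  proof (rule ccontr)
    assume nz: "b - W \<noteq> 0"
    have "coeff (b - W) i = 0" if "i \<ge> degree a" for i
    proof -
      have "coeff b i = coeff (monom 1 1 * b) (Suc i)" by (simp add: monom_Suc)
      also have "\<dots> = 0" using deg that by (intro coeff_eq_0) auto
      finally have "coeff b i = 0" .
      moreover have "coeff (h p) i = 0" if "p \<in> Z0" for p
        using deg_a[OF that] \<open>i \<ge> degree a\<close> by (simp add: coeff_eq_0)
      ultimately show ?thesis by (simp add: W_def coeff_sum)
    qed
    then have "degree (b - W) < degree a"
      using nz by (metis leading_coeff_0_iff not_le)
    moreover have "degree a \<le> degree (b - W)"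
      using a_dvd nz by (rule dvd_imp_degree_le)
    ultimately show False by simp
  qed
  then have "coeff (monom 1 1 * b) (degree a) = (\<Sum>p\<in>Z0. \<rho> p * coeff (monom 1 1 * h p) (degree a))"
    by (simp add: W_def sum_distrib_left coeff_sum)
  also have "\<dots> = (\<Sum>p\<in>Z0. \<rho> p) * lead_coeff a"
    unfolding sum_distrib_right by (intro sum.cong refl) (simp only: deg_h)
  also have "(\<Sum>p\<in>Z0. \<rho> p) = (\<Sum>p\<in>Z. \<rho> p)"
    using Z regular by (intro sum.mono_neutral_left) (auto simp: Z0_def)
  finally show ?thesis using a by simp
qed

section \<open>Operators on power series and division of operators\<close>

definition fps_op :: "(nat \<Rightarrow> complex poly) \<Rightarrow> nat \<Rightarrow> operator" where
  "fps_op c n f = (\<Sum>j\<le>n. fps_of_poly (c j) * (fps_deriv ^^ j) f)"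

lemma fps_op_of_poly: "fps_op c n (fps_of_poly f) = fps_of_poly (poly_op c n f)"
proof -
  have "(fps_deriv ^^ j) (fps_of_poly f) = fps_of_poly ((pderiv ^^ j) f)" for j
    by (induction j) (simp_all add: fps_of_poly_pderiv)
  then show ?thesis
    by (simp add: fps_op_def poly_op_def fps_of_poly_sum fps_of_poly_mult)
qed

lemma fps_deriv_sum: "fps_deriv (\<Sum>i\<in>A. f i) = (\<Sum>i\<in>A. fps_deriv (f i :: complex fps))"
  by (induction A rule: infinite_finite_induct) simp_all

lemma fps_deriv_fps_op:
  "fps_deriv (fps_op c n f) =
    fps_op (\<lambda>j. (if j \<le> n then pderiv (c j) else 0) + (case j of 0 \<Rightarrow> 0 | Suc i \<Rightarrow> c i)) (Suc n) f"
proof -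
  have "fps_deriv (fps_op c n f) = (\<Sum>j\<le>n. fps_of_poly (pderiv (c j)) * (fps_deriv ^^ j) f)
      + (\<Sum>j\<le>n. fps_of_poly (c j) * (fps_deriv ^^ Suc j) f)"
    by (simp add: fps_op_def fps_deriv_sum fps_of_poly_pderiv sum.distrib)
  also have "(\<Sum>j\<le>n. fps_of_poly (pderiv (c j)) * (fps_deriv ^^ j) f) =
      (\<Sum>j\<le>Suc n. fps_of_poly (if j \<le> n then pderiv (c j) else 0) * (fps_deriv ^^ j) f)"
    by simp
  also have "(\<Sum>j\<le>n. fps_of_poly (c j) * (fps_deriv ^^ Suc j) f) =
      (\<Sum>j\<le>Suc n. fps_of_poly (case j of 0 \<Rightarrow> 0 | Suc i \<Rightarrow> c i) * (fps_deriv ^^ j) f)"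
    by (simp add: sum.atMost_Suc_shift del: sum.atMost_Suc funpow.simps)
  finally show ?thesis
    by (simp add: fps_op_def fps_of_poly_add distrib_right sum.distrib del: sum.atMost_Suc)
qed

lemma fps_deriv_funpow_fps_op:
  "\<exists>h. (\<forall>f. (fps_deriv ^^ s) (fps_op c r f) = fps_op h (s + r) f) \<and> h (s + r) = c r"
proof (induction s)
  case 0
  then show ?case by auto
next
  case (Suc s)
  then obtain h where "\<forall>f. (fps_deriv ^^ s) (fps_op c r f) = fps_op h (s + r) f" "h (s + r) = c r"
    by blast
  then show ?case
    by (intro exI[of _ "\<lambda>j. (if j \<le> s + r then pderiv (h j) else 0) + (case j of 0 \<Rightarrow> 0 | Suc i \<Rightarrow> h i)"])
      (simp add: fps_deriv_fps_op)
qed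

text \<open>
  Division with remainder in the ring of differential operators over the rational functions, with
  denominators cleared. The term of order \<open>s + r\<close> is removed with a multiple of \<open>(d/dz)^s \<circ> L\<close>, whose leading
  coefficient is that of \<open>L\<close>.
\<close>

lemma pseudo_division:
  assumes "c r \<noteq> 0"
  shows "\<exists>q g e. q \<noteq> 0 \<and> (\<forall>f. fps_of_poly q * (\<Sum>j<s+r. fps_of_poly (d j) * (fps_deriv ^^ j) f) =
      (\<Sum>j<s. fps_of_poly (g j) * (fps_deriv ^^ j) (fps_op c r f)) +
      (\<Sum>j<r. fps_of_poly (e j) * (fps_deriv ^^ j) f))"
proof (induction s arbitrary: d)
  case 0
  show ?case
    by (rule exI[of _ 1], rule exI[of _ "\<lambda>_. 0"], rule exI[of _ d]) simp
next
  case (Suc s)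
  obtain h where h: "\<And>f. (fps_deriv ^^ s) (fps_op c r f) = fps_op h (s + r) f" "h (s + r) = c r"
    using fps_deriv_funpow_fps_op by blast
  \<comment> \<open>The coefficients left after the term of order \<open>s + r\<close> has been removed.\<close>
  define d' where "d' j = c r * d j - d (s + r) * h j" for j
  obtain q g e where IH: "q \<noteq> 0"
    "\<And>f. fps_of_poly q * (\<Sum>j<s+r. fps_of_poly (d' j) * (fps_deriv ^^ j) f) =
      (\<Sum>j<s. fps_of_poly (g j) * (fps_deriv ^^ j) (fps_op c r f)) +
      (\<Sum>j<r. fps_of_poly (e j) * (fps_deriv ^^ j) f)"
    using Suc by blast
  have "fps_of_poly (q * c r) * (\<Sum>j<Suc s+r. fps_of_poly (d j) * (fps_deriv ^^ j) f) =
      (\<Sum>j<Suc s. fps_of_poly ((g(s := q * d (s + r))) j) * (fps_deriv ^^ j) (fps_op c r f)) +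
      (\<Sum>j<r. fps_of_poly (e j) * (fps_deriv ^^ j) f)" for f
  proof -
    let ?D = "\<lambda>j. (fps_deriv ^^ j) f"
    have "fps_op h (s + r) f = (\<Sum>j<s+r. fps_of_poly (h j) * ?D j) + fps_of_poly (c r) * ?D (s + r)"
      by (simp add: fps_op_def h(2) flip: lessThan_Suc_atMost)
    moreover have "(\<Sum>j<s+r. fps_of_poly (d' j) * ?D j) =
        fps_of_poly (c r) * (\<Sum>j<s+r. fps_of_poly (d j) * ?D j)
        - fps_of_poly (d (s + r)) * (\<Sum>j<s+r. fps_of_poly (h j) * ?D j)"
      by (simp add: d'_def fps_of_poly_diff fps_of_poly_mult sum_subtractf sum_distrib_left algebra_simps)
    ultimately have "fps_of_poly (c r) * (\<Sum>j<Suc s+r. fps_of_poly (d j) * ?D j) =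
        (\<Sum>j<s+r. fps_of_poly (d' j) * ?D j) + fps_of_poly (d (s + r)) * (fps_deriv ^^ s) (fps_op c r f)"
      by (simp add: h(1) algebra_simps)
    then have "fps_of_poly (q * c r) * (\<Sum>j<Suc s+r. fps_of_poly (d j) * ?D j) =
        fps_of_poly q * (\<Sum>j<s+r. fps_of_poly (d' j) * ?D j)
        + fps_of_poly (q * d (s + r)) * (fps_deriv ^^ s) (fps_op c r f)"
      by (simp only: fps_of_poly_mult mult.assoc distrib_left)
    then show ?thesis
      unfolding IH(2) by simp
  qed
  moreover have "q * c r \<noteq> 0" using IH(1) assms by simp
  ultimately show ?case by blast
qed

lemma poly_op_translate:
  "poly_op (\<lambda>j. pcompose (c j) [:p, 1:]) n (pcompose f [:p, 1:]) = pcompose (poly_op c n f) [:p, 1:]"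
proof -
  have "(pderiv ^^ j) (pcompose f [:p, 1:]) = pcompose ((pderiv ^^ j) f) [:p, 1:]" for j
    by (induction j) (simp_all add: pderiv_pcompose pderiv_pCons)
  then show ?thesis
    by (simp add: poly_op_def pcompose_sum pcompose_mult)
qed

lemma comp_translate:
  assumes "\<And>f. q * poly_op d m f = poly_op g s (poly_op c r f)"
  shows "pcompose q [:p, 1:] * poly_op (\<lambda>j. pcompose (d j) [:p, 1:]) m f =
    poly_op (\<lambda>j. pcompose (g j) [:p, 1:]) s (poly_op (\<lambda>j. pcompose (c j) [:p, 1:]) r f)"
proof -
  have "f = pcompose (pcompose f [:- p, 1:]) [:p, 1:]"
    by (simp add: pcompose_pCons flip: pcompose_assoc)
  then show ?thesis
    using assms[of "pcompose f [:- p, 1:]"] by (metis poly_op_translate pcompose_mult)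
qed

text \<open>
  Take an annihilator of least order. The remainder of the division by it annihilates \<open>\<Phi>\<close> and has smaller
  order, so it is 0. The resulting identity of operators is stated on polynomials, where it can be
  translated to other points.
\<close>

lemma right_factor_exists:
  assumes ann: "fps_op d m \<Phi> = 0" and "\<Phi> \<noteq> 0"
    and "r\<^sub>0 \<le> m" "b r\<^sub>0 \<noteq> 0" "fps_op b r\<^sub>0 \<Phi> = 0"
  obtains q g c r s where "r \<le> r\<^sub>0" "0 < r" "m = s + r" "q \<noteq> 0" "c r \<noteq> 0"
    "\<And>f. q * poly_op d m f = poly_op g s (poly_op c r f)"
proof -
  define P where "P r \<longleftrightarrow> (\<exists>c. c r \<noteq> 0 \<and> fps_op c r \<Phi> = 0)" for r
  define r where "r = (LEAST r. P r)"
  have "P r\<^sub>0" using assms(4,5) by (auto simp: P_def)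
  then have r: "P r" "r \<le> r\<^sub>0" "\<And>k. k < r \<Longrightarrow> \<not> P k"
    unfolding r_def by (auto intro: LeastI Least_le dest: not_less_Least)
  obtain c where c: "c r \<noteq> 0" "fps_op c r \<Phi> = 0" using r(1) by (auto simp: P_def)
  have "r \<noteq> 0"
  proof
    assume "r = 0"
    then have "fps_of_poly (c r) * \<Phi> = 0" using c(2) by (simp add: fps_op_def)
    then show False using c(1) \<open>\<Phi> \<noteq> 0\<close> by simp
  qed
  define s where "s = m - r"
  have m: "m = s + r" using r(2) assms(3) by (simp add: s_def)
  obtain q g e where q: "q \<noteq> 0" and division:
    "\<And>f. fps_of_poly q * (\<Sum>j<Suc s+r. fps_of_poly (d j) * (fps_deriv ^^ j) f) =
      (\<Sum>j<Suc s. fps_of_poly (g j) * (fps_deriv ^^ j) (fps_op c r f)) +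
      (\<Sum>j<r. fps_of_poly (e j) * (fps_deriv ^^ j) f)"
    using pseudo_division[where c = c and r = r and s = "Suc s" and d = d, OF c(1)] by blast
  have division': "fps_of_poly q * fps_op d m f =
      fps_op g s (fps_op c r f) + (\<Sum>j<r. fps_of_poly (e j) * (fps_deriv ^^ j) f)" for f
    using division[of f] unfolding fps_op_def[of d] fps_op_def[of g] m
    by (simp only: lessThan_Suc_atMost add_Suc)
  have "fps_op g s 0 = 0"
  proof -
    have "(fps_deriv ^^ j) (0 :: complex fps) = 0" for j by (induction j) simp_all
    then show ?thesis by (simp add: fps_op_def)
  qed
  then have remainder: "(\<Sum>j<r. fps_of_poly (e j) * (fps_deriv ^^ j) \<Phi>) = 0"
    using division'[of \<Phi>] by (simp add: ann c(2))
  have "e j = 0" if "j < r" for j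
  proof (rule ccontr)
    assume "e j \<noteq> 0"
    define J where "J = Max {j. j < r \<and> e j \<noteq> 0}"
    have "J \<in> {j. j < r \<and> e j \<noteq> 0}"
      unfolding J_def using \<open>e j \<noteq> 0\<close> that by (intro Max_in) auto
    moreover have "e i = 0" if "i < r" "i > J" for i
    proof (rule ccontr)
      assume "e i \<noteq> 0"
      then have "i \<le> J" unfolding J_def using that(1) by (intro Max_ge) auto
      then show False using that(2) by simp
    qed
    ultimately have "(\<Sum>j<r. fps_of_poly (e j) * (fps_deriv ^^ j) \<Phi>) = fps_op e J \<Phi>"
      unfolding fps_op_def by (intro sum.mono_neutral_right) auto
    then have "P J" using remainder \<open>J \<in> _\<close> by (auto simp: P_def)
    then show False using r(3) \<open>J \<in> _\<close> by simp
  qed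
  then have "fps_of_poly q * fps_op d m f = fps_op g s (fps_op c r f)" for f
    using division'[of f] by simp
  then have "fps_of_poly (q * poly_op d m f) = fps_of_poly (poly_op g s (poly_op c r f))" for f
    by (simp only: fps_of_poly_mult flip: fps_op_of_poly)
  then have "q * poly_op d m f = poly_op g s (poly_op c r f)" for f
    by (simp only: fps_of_poly_eq_iff)
  then show ?thesis
    using that[of r s q c g] r(2) \<open>r \<noteq> 0\<close> m q c(1) by simp
qed

section \<open>Local exponents of the operator\<close>

text \<open>
  The coefficients of \<open>D_Y\<close> with respect to \<open>\<Theta>^j\<close>, to \<open>z^j (d/dz)^j\<close> and to \<open>(d/dz)^j\<close> are
  \<open>D_Y_theta\<close>, \<open>D_Y_euler\<close> and \<open>D_Y_deriv\<close>.
\<close>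

definition D_Y_theta :: "nat \<Rightarrow> complex poly" where
  "D_Y_theta j = [
     [:0, - 539, - 896, - 1806, 616, 121:],
     [:0, - 4067, - 1337, - 10731, 5005, 484:],
     [:0, - 11781, 13260, - 26511, 14784, 726:],
     [:0, - 15428, 40708, - 38514, 19558, 484:],
     [:49, - 7945, 28723, - 32126, 10010, 121:]] ! j"

definition D_Y_euler :: "nat \<Rightarrow> complex poly" where
  "D_Y_euler j = [
     [:0, - 539, - 896, - 1806, 616, 121:],
     [:49, - 39221, 81354, - 107882, 49357, 1815:],
     [:343, - 113680, 336445, - 366935, 143528, 3025:],
     [:294, - 63098, 213046, - 231270, 79618, 1210:],
     [:49, - 7945, 28723, - 32126, 10010, 121:]] ! j"

definition D_Y_deriv :: "nat \<Rightarrow> complex poly" where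
  "D_Y_deriv j = monom 1 j * D_Y_euler j"

lemma sum_atMost_4: "(\<Sum>j\<le>(4::nat). f j) = f 0 + f 1 + f 2 + f 3 + (f 4 :: 'a :: comm_monoid_add)"
  by (simp add: eval_nat_numeral add.assoc)

lemma theta_poly_pCons: "theta_poly (pCons a p) f = fps_const a * f + theta_poly p (theta f)"
  by (rule fps_ext) (simp add: theta_poly_nth theta_nth algebra_simps)

lemma theta_poly_0: "theta_poly 0 f = 0"
  by (simp add: theta_poly_def)

lemma D_Y_eq_theta: "D_Y f = (\<Sum>j\<le>4. fps_of_poly (D_Y_theta j) * (theta ^^ j) f)"
proof -
  have "[:1, 1:] ^ 4 = [:1, 4, 6, 4, 1 :: complex:]"
    by (simp add: eval_nat_numeral)
  then show ?thesis
    unfolding D_Y_def sum_atMost_4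
    by (simp add: D_Y_theta_def theta_poly_pCons theta_poly_0 fps_of_poly_pCons numeral_fps_const[symmetric]
        fps_const_neg[symmetric] eval_nat_numeral algebra_simps del: fps_const_neg)
qed

lemma theta_funpow_euler:
  "theta f = fps_X * fps_deriv f"
  "(theta ^^ 2) f = fps_X^2 * (fps_deriv ^^ 2) f + fps_X * fps_deriv f"
  "(theta ^^ 3) f = fps_X^3 * (fps_deriv ^^ 3) f + 3 * fps_X^2 * (fps_deriv ^^ 2) f + fps_X * fps_deriv f"
  "(theta ^^ 4) f = fps_X^4 * (fps_deriv ^^ 4) f + 6 * fps_X^3 * (fps_deriv ^^ 3) f
     + 7 * fps_X^2 * (fps_deriv ^^ 2) f + fps_X * fps_deriv f"
  by (simp_all add: theta_def eval_nat_numeral algebra_simps)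

lemma D_Y_eq_fps_op: "D_Y f = fps_op D_Y_deriv 4 f"
proof -
  define g1 g2 g3 g4 where "g1 = fps_X * fps_deriv f" and "g2 = fps_X^2 * (fps_deriv ^^ 2) f"
    and "g3 = fps_X^3 * (fps_deriv ^^ 3) f" and "g4 = fps_X^4 * (fps_deriv ^^ 4) f"
  have theta: "theta f = g1" "(theta ^^ 2) f = g2 + g1" "(theta ^^ 3) f = g3 + 3 * g2 + g1"
    "(theta ^^ 4) f = g4 + 6 * g3 + 7 * g2 + g1"
    unfolding theta_funpow_euler g1_def g2_def g3_def g4_def by (simp_all add: mult.assoc)
  have "fps_op D_Y_deriv 4 f = fps_of_poly (D_Y_euler 0) * f + fps_of_poly (D_Y_euler 1) * g1
    + fps_of_poly (D_Y_euler 2) * g2 + fps_of_poly (D_Y_euler 3) * g3 + fps_of_poly (D_Y_euler 4) * g4"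
    unfolding fps_op_def sum_atMost_4 D_Y_deriv_def fps_of_poly_mult fps_of_poly_monom'
      g1_def g2_def g3_def g4_def
    by (simp add: mult_ac)
  also have "\<dots> = D_Y f"
    unfolding D_Y_eq_theta sum_atMost_4
    by (simp add: theta D_Y_theta_def D_Y_euler_def fps_of_poly_pCons numeral_fps_const[symmetric]
        fps_const_neg[symmetric] algebra_simps del: fps_const_neg)
  finally show ?thesis ..
qed

lemma coeff_pcompose_shift:
  fixes f :: "complex poly"
  shows "coeff (pcompose f [:p, 1:]) 0 = poly f p"
    "coeff (pcompose f [:p, 1:]) 1 = poly (pderiv f) p"
    "coeff (pcompose f [:p, 1:]) 2 = poly (pderiv (pderiv f)) p / 2"
proof -
  have 0: "coeff (pcompose f [:p, 1:]) 0 = poly f p" for f :: "complex poly"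
    by (simp flip: poly_0_coeff_0 add: poly_pcompose)
  have d: "pderiv (pcompose f [:p, 1:]) = pcompose (pderiv f) [:p, 1:]" for f :: "complex poly"
    by (simp add: pderiv_pcompose pderiv_pCons)
  have 1: "coeff (pcompose f [:p, 1:]) 1 = poly (pderiv f) p" for f :: "complex poly"
    using coeff_pderiv[of "pcompose f [:p, 1:]" 0] by (simp add: d 0)
  show "coeff (pcompose f [:p, 1:]) 0 = poly f p" "coeff (pcompose f [:p, 1:]) 1 = poly (pderiv f) p"
    by (rule 0, rule 1)
  show "coeff (pcompose f [:p, 1:]) 2 = poly (pderiv (pderiv f)) p / 2"
    using coeff_pderiv[of "pcompose f [:p, 1:]" 1] by (simp add: d 1[unfolded One_nat_def] numeral_2_eq_2)
qed

text \<open>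
  The operator in the coordinate \<open>z - p\<close>, so that the lowest terms refer to the point \<open>p\<close>.
\<close>

abbreviation D_Y_at :: "complex \<Rightarrow> nat \<Rightarrow> complex poly" where
  "D_Y_at p \<equiv> (\<lambda>j. pcompose (D_Y_deriv j) [:p, 1:])"

lemma indicial_D_Y_at:
  "indicial (D_Y_at p) 4 0 = smult (poly (D_Y_deriv 4) p) (falling 4)"
  "indicial (D_Y_at p) 4 1 = smult (poly (pderiv (D_Y_deriv 4)) p) (falling 4)
     + smult (poly (D_Y_deriv 3) p) (falling 3)"
  "indicial (D_Y_at p) 4 2 = smult (poly (pderiv (pderiv (D_Y_deriv 4))) p / 2) (falling 4)
     + smult (poly (pderiv (D_Y_deriv 3)) p) (falling 3) + smult (poly (D_Y_deriv 2) p) (falling 2)"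
  unfolding indicial_def sum_atMost_4
  by (simp_all add: coeff_monom_mult coeff_pcompose_shift coeff_pcompose_shift[unfolded One_nat_def] add_ac)

lemma falling_numeral:
  "falling 0 = 1" "falling 1 = [:0, 1:]" "falling 2 = [:0, 1:] * [:- 1, 1:]"
  "falling 3 = [:0, 1:] * [:- 1, 1:] * [:- 2, 1:]"
  "falling 4 = [:0, 1:] * [:- 1, 1:] * [:- 2, 1:] * [:- 3, 1:]"
  by (simp_all add: falling_def eval_nat_numeral)

text \<open>
  The roots of this cubic are the conifold points. The leading coefficient of \<open>D_Y\<close> vanishes
  there, at 0 and at the apparent singularity \<open>7/11\<close>.
\<close>

definition conifold :: "complex poly" where
  "conifold = [:1, - 159, 84, 1:]"

lemma D_Y_deriv_4: "D_Y_deriv 4 = monom 1 4 * [:7, - 11:] ^ 2 * conifold"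
proof -
  have "D_Y_euler 4 = [:7, - 11:] ^ 2 * conifold"
    by (simp add: D_Y_euler_def conifold_def power2_eq_square)
  then show ?thesis by (simp only: D_Y_deriv_def mult.assoc)
qed

lemma exponents_ordinary:
  assumes "poly (D_Y_deriv 4) p \<noteq> 0"
  obtains e where "end_at (\<le>) (indicial (D_Y_at p) 4) e" "degree (indicial (D_Y_at p) 4 e) = 4"
    "proots (indicial (D_Y_at p) 4 e) = {#0, 1, 2, 3#}"
proof (rule that[of 0])
  show "end_at (\<le>) (indicial (D_Y_at p) 4) 0" by (simp add: end_at_def)
  show "degree (indicial (D_Y_at p) 4 0) = 4" "proots (indicial (D_Y_at p) 4 0) = {#0, 1, 2, 3#}"
    using assms by (simp_all add: indicial_D_Y_at degree_falling)
      (simp add: falling_numeral proots_mult del: mult_pCons_left mult_pCons_right)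
qed

text \<open>
  At a simple root \<open>p\<close> of the leading coefficient \<open>d\<^sub>4\<close> the exponents are \<open>0, 1, 2\<close> and \<open>3 - d\<^sub>3 p / d\<^sub>4' p\<close>. The last one
  is 1, because the cubic divides \<open>d\<^sub>3 - 2 d\<^sub>4'\<close>.
\<close>

lemma exponents_conifold:
  assumes "poly conifold p = 0"
  obtains e where "end_at (\<le>) (indicial (D_Y_at p) 4) e" "degree (indicial (D_Y_at p) 4 e) = 4"
    "proots (indicial (D_Y_at p) 4 e) = {#0, 1, 1, 2#}"
proof (rule that[of 1])
  have root: "1 - 159 * p + 84 * p^2 + p^3 = 0"
    using assms by (simp add: conifold_def algebra_simps power2_eq_square power3_eq_cube)
  have "p \<noteq> 0" using root by auto
  have "7 - 11 * p \<noteq> 0"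
  proof
    assume "7 - 11 * p = 0"
    with root have "(87723 :: complex) = 0" by algebra
    then show False by simp
  qed
  \<comment> \<open>The cubic has no multiple root: it generates the unit ideal together with its derivative.\<close>
  have simple: "- 159 + 168 * p + 3 * p^2 \<noteq> 0"
  proof
    assume "- 159 + 168 * p + 3 * p^2 = 0"
    with root have "(2368521 :: complex) = 0" by algebra
    then show False by simp
  qed
  let ?d = "poly (pderiv (D_Y_deriv 4)) p"
  have "?d = p^4 * (7 - 11 * p)^2 * (- 159 + 168 * p + 3 * p^2)"
  proof -
    have "pderiv (D_Y_deriv 4) = pderiv (monom 1 4 * [:7, - 11:] ^ 2) * conifold
        + monom 1 4 * [:7, - 11:] ^ 2 * pderiv conifold"
      by (simp only: D_Y_deriv_4 pderiv_mult add.commute mult.commute)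
    then have "?d = poly (monom 1 4 * [:7, - 11:] ^ 2) p * poly (pderiv conifold) p"
      using assms by (simp only: poly_add poly_mult mult_zero_right add_0)
    then show ?thesis
      by (simp add: poly_monom conifold_def pderiv_pCons algebra_simps power2_eq_square)
  qed
  then have d: "?d \<noteq> 0" using \<open>p \<noteq> 0\<close> \<open>7 - 11 * p \<noteq> 0\<close> simple by simp
  have "D_Y_deriv 3 - smult 2 (pderiv (D_Y_deriv 4)) = conifold * [:0, 0, 0, - 98, 770, - 968:]"
    by (simp add: D_Y_deriv_def D_Y_euler_def conifold_def pderiv_mult pderiv_monom pderiv_pCons
        monom_Suc eval_nat_numeral)
  then have "poly (D_Y_deriv 3) p - 2 * ?d = poly (conifold * [:0, 0, 0, - 98, 770, - 968:]) p"
    by (metis poly_diff poly_smult)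
  then have "poly (D_Y_deriv 3) p = 2 * ?d" using assms by simp
  then have ind: "indicial (D_Y_at p) 4 1 = smult ?d (falling 3 * [:- 1, 1:])"
    unfolding indicial_D_Y_at falling_numeral by (simp add: algebra_simps)
  have "indicial (D_Y_at p) 4 0 = 0"
    using assms by (simp add: indicial_D_Y_at D_Y_deriv_4)
  then have "a \<ge> 1" if "indicial (D_Y_at p) 4 a \<noteq> 0" for a
    using that by (cases a) auto
  then show "end_at (\<le>) (indicial (D_Y_at p) 4) 1" by (simp add: end_at_def)
  show "proots (indicial (D_Y_at p) 4 1) = {#0, 1, 1, 2#}"
    unfolding ind using d by (simp add: falling_numeral proots_mult del: mult_pCons_left mult_pCons_right)
  then show "degree (indicial (D_Y_at p) 4 1) = 4"
    by (simp flip: size_proots_complex)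
qed

text \<open>
  Here \<open>d\<^sub>4\<close> has a double root and \<open>d\<^sub>3\<close> a simple one, and the ratio \<open>1 : -2 : 2\<close> of \<open>d\<^sub>4''/2\<close>, \<open>d\<^sub>3'\<close> and \<open>d\<^sub>2\<close> gives
  \<open>s (s - 1) ((s - 2) (s - 3) - 2 (s - 2) + 2) = s (s - 1) (s - 3) (s - 4)\<close>.
\<close>

lemma exponents_apparent:
  obtains e where "end_at (\<le>) (indicial (D_Y_at (7 / 11)) 4) e"
    "degree (indicial (D_Y_at (7 / 11)) 4 e) = 4"
    "proots (indicial (D_Y_at (7 / 11)) 4 e) = {#0, 1, 3, 4#}"
proof (rule that[of 2])
  let ?p = "7 / 11 :: complex" and ?\<kappa> = "- 210622923 / 161051 :: complex"
  have vals: "poly (D_Y_deriv 4) ?p = 0" "poly (pderiv (D_Y_deriv 4)) ?p = 0" "poly (D_Y_deriv 3) ?p = 0"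
    "poly (pderiv (pderiv (D_Y_deriv 4))) ?p / 2 = ?\<kappa>" "poly (pderiv (D_Y_deriv 3)) ?p = - 2 * ?\<kappa>"
    "poly (D_Y_deriv 2) ?p = 2 * ?\<kappa>"
    by (simp_all add: D_Y_deriv_def D_Y_euler_def pderiv_mult pderiv_monom pderiv_pCons
        monom_Suc eval_nat_numeral)
  have ind: "indicial (D_Y_at ?p) 4 2 = smult ?\<kappa> ([:0, 1:] * [:- 1, 1:] * [:- 3, 1:] * [:- 4, 1:])"
    unfolding indicial_D_Y_at vals falling_numeral by (simp add: algebra_simps)
  have "indicial (D_Y_at ?p) 4 0 = 0" "indicial (D_Y_at ?p) 4 (Suc 0) = 0"
    using vals by (simp_all add: indicial_D_Y_at indicial_D_Y_at(2)[unfolded One_nat_def])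
  then have "a \<ge> 2" if "indicial (D_Y_at ?p) 4 a \<noteq> 0" for a
    using that by (cases a; cases "a - 1") auto
  then show "end_at (\<le>) (indicial (D_Y_at ?p) 4) 2" by (simp add: end_at_def)
  show "proots (indicial (D_Y_at ?p) 4 2) = {#0, 1, 3, 4#}"
    unfolding ind by (simp add: proots_mult del: mult_pCons_left mult_pCons_right)
  then show "degree (indicial (D_Y_at ?p) 4 2) = 4"
    by (simp flip: size_proots_complex)
qed

lemma indicial_D_Y_deriv:
  "indicial D_Y_deriv 4 a =
    (if a < 4 then 0 else (\<Sum>j\<le>4. smult (coeff (D_Y_euler j) (a - 4)) (falling j)))"
proof -
  have "monom 1 (4 - j) * D_Y_deriv j = monom 1 4 * D_Y_euler j" if "j \<le> 4" for j
    using that by (simp add: D_Y_deriv_def mult_monom flip: mult.assoc)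
  then have "indicial D_Y_deriv 4 a = (\<Sum>j\<le>4. smult (coeff (monom 1 4 * D_Y_euler j) a) (falling j))"
    unfolding indicial_def by (intro sum.cong) auto
  then show ?thesis by (simp add: coeff_monom_mult)
qed

lemma exponents_zero:
  obtains e where "end_at (\<le>) (indicial D_Y_deriv 4) e" "degree (indicial D_Y_deriv 4 e) = 4"
    "proots (indicial D_Y_deriv 4 e) = {#0, 0, 0, 0#}"
proof (rule that[of 4])
  have ind: "indicial D_Y_deriv 4 4 = smult 49 ([:0, 1:] * [:0, 1:] * [:0, 1:] * [:0, 1:])"
    unfolding indicial_D_Y_deriv sum_atMost_4 falling_numeral by (simp add: D_Y_euler_def)
  show "end_at (\<le>) (indicial D_Y_deriv 4) 4"
    by (auto simp: end_at_def indicial_D_Y_deriv not_less[symmetric])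
  show "proots (indicial D_Y_deriv 4 4) = {#0, 0, 0, 0#}"
    unfolding ind by (simp add: proots_mult del: mult_pCons_left mult_pCons_right)
  then show "degree (indicial D_Y_deriv 4 4) = 4"
    by (simp flip: size_proots_complex)
qed

text \<open>
  The roots are \<open>-1\<close> for exponents 1 because the indicial polynomial refers to powers of \<open>z\<close>, not of \<open>1/z\<close>.
\<close>

lemma exponents_infinity:
  obtains e where "end_at (\<ge>) (indicial D_Y_deriv 4) e" "degree (indicial D_Y_deriv 4 e) = 4"
    "proots (indicial D_Y_deriv 4 e) = {#- 1, - 1, - 1, - 1#}"
proof (rule that[of 9])
  have ind: "indicial D_Y_deriv 4 9 = smult 121 ([:1, 1:] * [:1, 1:] * [:1, 1:] * [:1, 1:])"
    unfolding indicial_D_Y_deriv sum_atMost_4 falling_numeral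
    by (simp add: D_Y_euler_def eval_nat_numeral)
  have degrees: "degree (D_Y_euler j) \<le> 5" if "j \<le> 4" for j
  proof -
    have "j = 0 \<or> j = 1 \<or> j = 2 \<or> j = 3 \<or> j = 4" using that by linarith
    then show ?thesis by (auto simp: D_Y_euler_def)
  qed
  have "coeff (D_Y_euler j) (a - 4) = 0" if "a > 9" "j \<le> 4" for a j
  proof (rule coeff_eq_0)
    have "degree (D_Y_euler j) \<le> 5" using degrees that(2) .
    then show "degree (D_Y_euler j) < a - 4" using that(1) by linarith
  qed
  then have "indicial D_Y_deriv 4 a = 0" if "a > 9" for a
    using that unfolding indicial_D_Y_deriv by simp
  then show "end_at (\<ge>) (indicial D_Y_deriv 4) 9"
    by (auto simp: end_at_def not_le[symmetric])
  show "proots (indicial D_Y_deriv 4 9) = {#- 1, - 1, - 1, - 1#}"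
    unfolding ind by (simp add: proots_mult del: mult_pCons_left mult_pCons_right)
  then show "degree (indicial D_Y_deriv 4 9) = 4"
    by (simp flip: size_proots_complex)
qed

section \<open>Annihilators of lower order\<close>

lemma low_end_factorization:
  fixes f :: "complex poly"
  assumes "end_at (\<le>) (coeff (pcompose f [:p, 1:])) e"
  shows "\<exists>u. f = [:- p, 1:] ^ e * u \<and> poly u p = coeff (pcompose f [:p, 1:]) e"
proof -
  have "monom 1 e dvd pcompose f [:p, 1:]"
    using assms by (auto simp: monom_1_dvd_iff' end_at_def not_le[symmetric])
  then obtain u where u: "pcompose f [:p, 1:] = monom 1 e * u" by (rule dvdE)
  have "pcompose (monom 1 e) q = q ^ e" for q :: "complex poly"
    by (induction e) (simp_all add: monom_Suc pcompose_pCons pcompose_1)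
  then have "pcompose (pcompose f [:p, 1:]) [:- p, 1:] = [:- p, 1:] ^ e * pcompose u [:- p, 1:]"
    by (simp add: u pcompose_mult)
  moreover have "pcompose (pcompose f [:p, 1:]) [:- p, 1:] = f"
    by (simp add: pcompose_pCons flip: pcompose_assoc)
  moreover have "poly (pcompose u [:- p, 1:]) p = coeff (pcompose f [:p, 1:]) e"
    by (simp add: u poly_pcompose coeff_monom_mult poly_0_coeff_0)
  ultimately show ?thesis by metis
qed

text \<open>
  As a rewrite rule it enumerates the sub-multisets of an explicit multiset.
\<close>

lemma subseteq_add_mset_iff: "B \<subseteq># add_mset x A \<longleftrightarrow> B \<subseteq># A \<or> (\<exists>C. C \<subseteq># A \<and> B = add_mset x C)"
proof
  assume B: "B \<subseteq># add_mset x A"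
  show "B \<subseteq># A \<or> (\<exists>C. C \<subseteq># A \<and> B = add_mset x C)"
  proof (cases "x \<in># B")
    case True
    then obtain C where "B = add_mset x C" by (rule mset_add)
    then show ?thesis using B by auto
  next
    case False
    then show ?thesis using B by (metis diff_single_trivial subset_eq_diff_conv add_mset_add_single)
  qed
qed (auto intro: subset_mset.order_trans)

text \<open>
  The exponents \<open>B\<close> of the right factor at \<open>p\<close> are among the exponents \<open>A\<close> of \<open>D_Y\<close>. They determine the
  residue at \<open>p\<close> of the quotient of its two highest coefficients.
\<close>

lemma residue_at:
  assumes comp: "\<And>f. q * poly_op D_Y_deriv (s + Suc k) f = poly_op g s (poly_op c (Suc k) f)"
    and q: "q \<noteq> 0" and c: "c (Suc k) \<noteq> 0" and 4: "s + Suc k = 4"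
    and d: "end_at (\<le>) (indicial (D_Y_at p) 4) ed" "degree (indicial (D_Y_at p) 4 ed) = 4"
      "proots (indicial (D_Y_at p) 4 ed) = A"
  shows "\<exists>B e u v. B \<subseteq># A \<and> size B = Suc k \<and> c (Suc k) = [:- p, 1:] ^ e * u \<and>
    [:- p, 1:] * c k = [:- p, 1:] ^ e * v \<and> poly u p \<noteq> 0 \<and>
    of_nat (Suc k choose 2) - sum_mset B = poly v p / poly u p"
proof -
  define c' where "c' j = pcompose (c j) [:p, 1:]" for j
  have comp': "pcompose q [:p, 1:] * poly_op (D_Y_at p) (s + Suc k) f =
      poly_op (\<lambda>j. pcompose (g j) [:p, 1:]) s (poly_op c' (Suc k) f)" for f
    unfolding c'_def by (rule comp_translate[OF comp])
  have R: "(\<le>) = (\<le>) \<or> (\<le>) = ((\<ge>) :: nat \<Rightarrow> nat \<Rightarrow> bool)" by simp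
  have nz: "pcompose q [:p, 1:] \<noteq> 0" "c' (Suc k) \<noteq> 0"
    using q c by (simp_all add: c'_def pcompose_eq_0_iff)
  have d_nz: "indicial (D_Y_at p) 4 ed \<noteq> 0" using d(2) by auto
  obtain e where e: "end_at (\<le>) (indicial c' (Suc k)) e" "degree (indicial c' (Suc k) e) = Suc k"
    "indicial c' (Suc k) e dvd indicial (D_Y_at p) 4 ed"
    using indicial_right_factor[OF R comp' nz, of ed] d(1,2) d_nz unfolding 4 by metis
  let ?B = "proots (indicial c' (Suc k) e)"
  note exps = sum_of_exponents[OF e(2)]
  note ends = end_at_of_indicial[OF e(1)]
  obtain u where u: "c (Suc k) = [:- p, 1:] ^ e * u" "poly u p = coeff (c' (Suc k)) e"
    using low_end_factorization[of "c (Suc k)" p e] ends(1) unfolding c'_def by blast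
  have "pcompose ([:- p, 1:] * c k) [:p, 1:] = monom 1 1 * c' k"
  proof -
    have "pcompose [:- p, 1:] [:p, 1:] = monom 1 1" by (simp add: pcompose_pCons monom_Suc)
    then show ?thesis by (simp only: c'_def pcompose_mult)
  qed
  then obtain v where v: "[:- p, 1:] * c k = [:- p, 1:] ^ e * v" "poly v p = coeff (monom 1 1 * c' k) e"
    using low_end_factorization[of "[:- p, 1:] * c k" p e] ends(2) by metis
  have "?B \<subseteq># A"
    using proots_subset_of_dvd[OF e(3) d_nz] d(3) by simp
  moreover have "of_nat (Suc k choose 2) - sum_mset ?B = poly v p / poly u p"
    unfolding exps(2) u(2) v(2) by simp
  ultimately show ?thesis using exps(1,3) u v by metis
qed

text \<open>
  Fuchs's relation for a right factor of order \<open>r = k + 1\<close> of \<open>D_Y\<close>, as computed at the top of this theory.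
\<close>

lemma no_lower_order_annihilator:
  assumes \<Phi>: "fps_op D_Y_deriv 4 \<Phi> = 0" "\<Phi> \<noteq> 0"
    and b: "n \<le> 3" "b n \<noteq> 0" "fps_op b n \<Phi> = 0"
  shows False
proof -
  have "n \<le> 4" using b(1) by simp
  then obtain q g c r s where r: "r \<le> n" "0 < r" "4 = s + r" and q: "q \<noteq> 0" and c: "c r \<noteq> 0"
    and comp: "\<And>f. q * poly_op D_Y_deriv 4 f = poly_op g s (poly_op c r f)"
    using right_factor_exists[OF \<Phi> _ b(2,3)] by metis
  obtain k where k: "r = Suc k" using r(2) by (cases r) auto
  have k3: "k = 0 \<or> k = 1 \<or> k = 2" using r(1) b(1) k by auto
  have comp: "q * poly_op D_Y_deriv (s + Suc k) f = poly_op g s (poly_op c (Suc k) f)" for f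
    using comp r(3) k by simp
  have c: "c (Suc k) \<noteq> 0" and four: "s + Suc k = 4" using c r(3) k by simp_all
  note residue = residue_at[OF comp q c four]
  define C :: complex where "C = of_nat (Suc k choose 2)"
  have binom: "C = (if k = 0 then 0 else if k = 1 then 1 else 3)"
    using k3 by (auto simp: C_def numeral_2_eq_2)
  \<comment> \<open>This will bound the real part of the residue at \<open>p \<noteq> 0\<close> from above.\<close>
  define bound :: "complex \<Rightarrow> real" where
    "bound p = (if k = 2 then of_bool (poly conifold p = 0) - of_bool (p = 7 / 11) else 0)" for p
  have ordinary: "poly (D_Y_deriv 4) p \<noteq> 0" if "p \<noteq> 0" "p \<noteq> 7 / 11" "poly conifold p \<noteq> 0" for p
  proof -
    have "7 - 11 * p \<noteq> 0" using that(2) by (auto simp: field_simps)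
    then show ?thesis using that by (simp add: D_Y_deriv_4 poly_monom)
  qed
  have conifold_values: "poly conifold 0 \<noteq> 0" "poly conifold (7 / 11) \<noteq> 0"
    by (simp_all add: conifold_def)
  have "\<exists>\<rho>. (\<exists>e u v. c (Suc k) = [:- p, 1:] ^ e * u \<and> [:- p, 1:] * c k = [:- p, 1:] ^ e * v \<and>
      poly u p \<noteq> 0 \<and> \<rho> = poly v p / poly u p) \<and>
      (if p = 0 then \<rho> = C else Re \<rho> \<le> bound p)" for p
  proof -
    consider "p = 0" | "poly conifold p = 0" | "p = 7 / 11" | "poly (D_Y_deriv 4) p \<noteq> 0" "p \<noteq> 0"
      using ordinary by blast
    then show ?thesis
    proof cases
      case 1
      have "D_Y_at 0 = D_Y_deriv" by (simp add: pcompose_idR)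
      then obtain B where B: "B \<subseteq># {#0, 0, 0, 0#}" "size B = Suc k"
        and e: "\<exists>e u v. c (Suc k) = [:- p, 1:] ^ e * u \<and> [:- p, 1:] * c k = [:- p, 1:] ^ e * v \<and>
          poly u p \<noteq> 0 \<and> C - sum_mset B = poly v p / poly u p"
        using exponents_zero residue[of 0] unfolding C_def 1 by metis
      have "sum_mset B = 0" using B(1) by (auto simp: subseteq_add_mset_iff)
      then show ?thesis using e 1 by auto
    next
      case 2
      obtain B where B: "B \<subseteq># {#0, 1, 1, 2#}" "size B = Suc k"
        and e: "\<exists>e u v. c (Suc k) = [:- p, 1:] ^ e * u \<and> [:- p, 1:] * c k = [:- p, 1:] ^ e * v \<and>
          poly u p \<noteq> 0 \<and> C - sum_mset B = poly v p / poly u p"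
        using exponents_conifold[OF 2] residue[of p] unfolding C_def by metis
      have "p \<noteq> 7 / 11" using 2 conifold_values(2) by metis
      then have "bound p = (if k = 2 then 1 else 0)" using 2 by (simp only: bound_def) simp
      then have "Re (C - sum_mset B) \<le> bound p"
        using B k3 by (auto simp: subseteq_add_mset_iff binom)
      then show ?thesis using e 2 conifold_values by (intro exI[of _ "C - sum_mset B"]) auto
    next
      case 3
      obtain B where B: "B \<subseteq># {#0, 1, 3, 4#}" "size B = Suc k"
        and e: "\<exists>e u v. c (Suc k) = [:- p, 1:] ^ e * u \<and> [:- p, 1:] * c k = [:- p, 1:] ^ e * v \<and>
          poly u p \<noteq> 0 \<and> C - sum_mset B = poly v p / poly u p"
        using exponents_apparent residue[of p] unfolding C_def 3 by metis
      have "Re (C - sum_mset B) \<le> bound p"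
        using B k3 3 conifold_values by (auto simp: subseteq_add_mset_iff binom bound_def)
      moreover have "p \<noteq> 0" using 3 by auto
      ultimately show ?thesis
        by (intro exI[of _ "C - sum_mset B"] conjI[OF e]) (simp only: if_False)
    next
      case 4
      obtain B where B: "B \<subseteq># {#0, 1, 2, 3#}" "size B = Suc k"
        and e: "\<exists>e u v. c (Suc k) = [:- p, 1:] ^ e * u \<and> [:- p, 1:] * c k = [:- p, 1:] ^ e * v \<and>
          poly u p \<noteq> 0 \<and> C - sum_mset B = poly v p / poly u p"
        using exponents_ordinary[OF 4(1)] residue[of p] unfolding C_def by metis
      have "poly conifold p \<noteq> 0" using 4 by (auto simp: D_Y_deriv_4)
      moreover have "p \<noteq> 7 / 11" using 4 by (auto simp: D_Y_deriv_4)
      ultimately have "Re (C - sum_mset B) \<le> bound p"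
        using B k3 by (auto simp: subseteq_add_mset_iff binom bound_def)
      then show ?thesis using e 4 by (intro exI[of _ "C - sum_mset B"]) auto
    qed
  qed
  then obtain \<rho> where \<rho>: "\<And>p. \<exists>e u v. c (Suc k) = [:- p, 1:] ^ e * u \<and> [:- p, 1:] * c k = [:- p, 1:] ^ e * v \<and>
      poly u p \<noteq> 0 \<and> \<rho> p = poly v p / poly u p"
    and \<rho>_bound: "\<And>p. if p = 0 then \<rho> p = C else Re (\<rho> p) \<le> bound p"
    by metis
  define K where "K = {p. poly conifold p = 0}"
  define Z where "Z = {p. poly (c (Suc k)) p = 0} \<union> {0, 7 / 11} \<union> K"
  have conifold: "conifold \<noteq> 0" "degree conifold = 3" by (simp_all add: conifold_def)
  have K: "finite K" "card K \<le> 3"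
    using poly_roots_finite[OF conifold(1)] card_poly_roots_bound[OF conifold(1)] conifold(2)
    by (simp_all add: K_def)
  have Z: "finite Z" using c K by (simp add: Z_def poly_roots_finite)
  have R: "(\<ge>) = (\<le>) \<or> (\<ge>) = ((\<ge>) :: nat \<Rightarrow> nat \<Rightarrow> bool)" by simp
  obtain ed where ed: "end_at (\<ge>) (indicial D_Y_deriv 4) ed" "degree (indicial D_Y_deriv 4 ed) = 4"
    "proots (indicial D_Y_deriv 4 ed) = {#- 1, - 1, - 1, - 1#}"
    by (rule exponents_infinity)
  have ed_nz: "indicial D_Y_deriv 4 ed \<noteq> 0" using ed(2) by auto
  obtain e where e: "end_at (\<ge>) (indicial c (Suc k)) e" "degree (indicial c (Suc k) e) = Suc k"
    "indicial c (Suc k) e dvd indicial D_Y_deriv 4 ed"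
    using indicial_right_factor[OF R comp q c, of ed] ed(1,2) ed_nz unfolding four by metis
  note exps = sum_of_exponents[OF e(2)]
  note ends = end_at_of_indicial[OF e(1)]
  have deg: "degree (c (Suc k)) = e"
    using ends(1) exps(3) c by (intro antisym le_degree) (auto simp: end_at_def)
  have "degree (monom 1 1 * c k) \<le> e"
    using ends(2) by (intro degree_le) (auto simp: end_at_def not_less[symmetric])
  then have "(\<Sum>p\<in>Z. \<rho> p) = coeff (monom 1 1 * c k) e / coeff (c (Suc k)) e"
    using sum_of_residues[OF c Z _ _ \<rho>] unfolding deg by (simp add: Z_def subset_iff)
  also have "\<dots> = C - sum_mset (proots (indicial c (Suc k) e))"
    by (simp add: exps(2) C_def del: binomial_Suc_Suc)
  also have "sum_mset (proots (indicial c (Suc k) e)) = - of_nat (Suc k)"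
    using proots_subset_of_dvd[OF e(3) ed_nz] exps(1) unfolding ed(3)
    by (auto simp: subseteq_add_mset_iff)
  finally have total: "(\<Sum>p\<in>Z. Re (\<rho> p)) = Re C + real (Suc k)"
    by (simp flip: Re_sum)
  have "(\<Sum>p\<in>Z. Re (\<rho> p)) = Re C + (\<Sum>p\<in>Z - {0}. Re (\<rho> p))"
    using Z \<rho>_bound[of 0] by (subst sum.remove[of _ 0]) (auto simp: Z_def)
  also have "(\<Sum>p\<in>Z - {0}. Re (\<rho> p)) \<le> (\<Sum>p\<in>Z - {0}. bound p)"
    using \<rho>_bound by (intro sum_mono) (metis DiffD2 singletonI)
  also have "(\<Sum>p\<in>Z - {0}. bound p) \<le> real k"
  proof (cases "k = 2")
    case True
    have "(\<Sum>p\<in>Z - {0}. of_bool (poly conifold p = 0)) = real (card K)"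
    proof -
      have "{p \<in> Z - {0}. poly conifold p = 0} = K" using conifold_values by (auto simp: Z_def K_def)
      then show ?thesis using Z by (simp add: sum_of_bool_eq Int_def)
    qed
    moreover have "(\<Sum>p\<in>Z - {0}. of_bool (p = 7 / 11)) = (1 :: real)"
    proof -
      have "{p \<in> Z - {0}. p = 7 / 11} = {7 / 11}" by (auto simp: Z_def)
      then show ?thesis using Z by (simp add: sum_of_bool_eq Int_def)
    qed
    ultimately show ?thesis using True K(2) by (simp add: bound_def sum_subtractf)
  qed (simp add: bound_def)
  finally show False using total by simp
qed

lemma theta_funpow_eq_fps_op: "\<exists>t. (\<forall>f. (theta ^^ j) f = fps_op t j f) \<and> t j = monom 1 j"
proof (induction j)
  case 0
  show ?case by (rule exI[of _ "\<lambda>_. 1"]) (simp add: fps_op_def)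
next
  case (Suc j)
  then obtain t where t: "\<And>f. (theta ^^ j) f = fps_op t j f" "t j = monom 1 j" by blast
  define h where "h i = (if i \<le> j then pderiv (t i) else 0) + (case i of 0 \<Rightarrow> 0 | Suc i \<Rightarrow> t i)" for i
  define t' where "t' i = monom 1 1 * h i" for i
  have "(theta ^^ Suc j) f = fps_op t' (Suc j) f" for f
  proof -
    have "(theta ^^ Suc j) f = fps_X * fps_op h (Suc j) f"
      unfolding funpow.simps o_apply t(1) theta_def fps_deriv_fps_op h_def ..
    also have "\<dots> = fps_op t' (Suc j) f"
      by (simp add: t'_def fps_op_def sum_distrib_left fps_of_poly_mult fps_of_poly_monom' mult.assoc
          del: sum.atMost_Suc)
    finally show ?thesis .
  qed
  moreover have "t' (Suc j) = monom 1 (Suc j)" by (simp add: t'_def h_def t(2) mult_monom)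
  ultimately show ?case by blast
qed

lemma theta_sum_eq_fps_op:
  "\<exists>c. (\<forall>f. (\<Sum>j\<le>n. fps_of_poly (b j) * (theta ^^ j) f) = fps_op c n f) \<and> c n = monom 1 n * b n"
proof (induction n)
  case 0
  show ?case by (rule exI[of _ b]) (simp add: fps_op_def)
next
  case (Suc n)
  then obtain c where c: "\<And>f. (\<Sum>j\<le>n. fps_of_poly (b j) * (theta ^^ j) f) = fps_op c n f" by blast
  obtain t where t: "\<And>f. (theta ^^ Suc n) f = fps_op t (Suc n) f" "t (Suc n) = monom 1 (Suc n)"
    using theta_funpow_eq_fps_op by blast
  define c' where "c' j = (if j \<le> n then c j else 0) + b (Suc n) * t j" for j
  have "(\<Sum>j\<le>Suc n. fps_of_poly (b j) * (theta ^^ j) f) = fps_op c' (Suc n) f" for f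
  proof -
    have "fps_op c n f = (\<Sum>j\<le>Suc n. fps_of_poly (if j \<le> n then c j else 0) * (fps_deriv ^^ j) f)"
      by (simp add: fps_op_def)
    moreover have "fps_of_poly (b (Suc n)) * fps_op t (Suc n) f =
        (\<Sum>j\<le>Suc n. fps_of_poly (b (Suc n) * t j) * (fps_deriv ^^ j) f)"
      by (simp add: fps_op_def sum_distrib_left fps_of_poly_mult mult.assoc del: sum.atMost_Suc)
    ultimately show ?thesis
      unfolding sum.atMost_Suc[of "\<lambda>j. fps_of_poly (b j) * (theta ^^ j) f"] c t(1)
      by (simp add: fps_op_def c'_def fps_of_poly_add distrib_right sum.distrib del: sum.atMost_Suc)
  qed
  moreover have "c' (Suc n) = monom 1 (Suc n) * b (Suc n)" by (simp add: c'_def t(2))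
  ultimately show ?case by blast
qed

lemma no_theta_annihilator:
  assumes \<Phi>: "D_Y \<Phi> = 0" "\<Phi> \<noteq> 0" and sum: "(\<Sum>j\<le>3. fps_of_poly (b j) * (theta ^^ j) \<Phi>) = 0"
    and "i \<le> 3"
  shows "b i = 0"
proof (rule ccontr)
  assume "b i \<noteq> 0"
  define J where "J = Max {j. j \<le> 3 \<and> b j \<noteq> 0}"
  have J: "J \<in> {j. j \<le> 3 \<and> b j \<noteq> 0}"
    unfolding J_def using \<open>b i \<noteq> 0\<close> \<open>i \<le> 3\<close> by (intro Max_in) auto
  have "b j = 0" if "j \<le> 3" "j > J" for j
  proof (rule ccontr)
    assume "b j \<noteq> 0"
    then have "j \<le> J" unfolding J_def using that(1) by (intro Max_ge) auto
    then show False using that(2) by simp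
  qed
  then have "(\<Sum>j\<le>J. fps_of_poly (b j) * (theta ^^ j) \<Phi>) = (\<Sum>j\<le>3. fps_of_poly (b j) * (theta ^^ j) \<Phi>)"
    using J by (intro sum.mono_neutral_left) auto
  moreover obtain c where "\<forall>f. (\<Sum>j\<le>J. fps_of_poly (b j) * (theta ^^ j) f) = fps_op c J f"
    "c J = monom 1 J * b J"
    using theta_sum_eq_fps_op by blast
  ultimately have "fps_op c J \<Phi> = 0" "c J \<noteq> 0" "J \<le> 3"
    using sum J by (auto simp: monom_eq_0_iff)
  moreover have "fps_op D_Y_deriv 4 \<Phi> = 0" using \<Phi>(1) by (simp only: D_Y_eq_fps_op)
  ultimately show False using no_lower_order_annihilator \<Phi>(2) by blast
qed

lemma normal_op_eq_theta_sum:
  assumes "theta_degree P = n"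
  defines "b \<equiv> \<lambda>j. \<Sum>k\<le>degree P. monom (coeff (coeff P k) j) k"
  shows "normal_op P f = (\<Sum>j\<le>n. fps_of_poly (b j) * (theta ^^ j) f)"
    and "n > 0 \<Longrightarrow> b n \<noteq> 0"
proof -
  have deg: "degree (coeff P k) \<le> n" if "k \<le> degree P" for k
    unfolding assms(1)[symmetric] theta_degree_def using that by (intro Max_ge) auto
  have "theta_poly (coeff P k) f = (\<Sum>j\<le>n. fps_const (coeff (coeff P k) j) * (theta ^^ j) f)"
    if "k \<le> degree P" for k
    unfolding theta_poly_def using deg[OF that]
    by (intro sum.mono_neutral_left) (auto simp: coeff_eq_0)
  then have "normal_op P f =
      (\<Sum>k\<le>degree P. \<Sum>j\<le>n. fps_of_poly (monom (coeff (coeff P k) j) k) * (theta ^^ j) f)"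
    by (simp add: normal_op_def sum_distrib_left fps_of_poly_monom mult_ac)
  also have "\<dots> = (\<Sum>j\<le>n. fps_of_poly (b j) * (theta ^^ j) f)"
    by (subst sum.swap) (simp add: b_def fps_of_poly_sum sum_distrib_right)
  finally show "normal_op P f = (\<Sum>j\<le>n. fps_of_poly (b j) * (theta ^^ j) f)" .
  assume "n > 0"
  have "theta_degree P \<in> (\<lambda>k. degree (coeff P k)) ` {..degree P}"
    unfolding theta_degree_def by (rule Max_in) auto
  then obtain k where k: "k \<le> degree P" "degree (coeff P k) = n" using assms(1) by auto
  have "coeff (b n) k = coeff (coeff P k) n"
    using k(1) by (simp add: b_def coeff_sum)
  also have "\<dots> \<noteq> 0" using k(2) \<open>n > 0\<close> by (metis degree_0 leading_coeff_0_iff less_numeral_extra(3))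
  finally show "b n \<noteq> 0" by auto
qed

lemma mirror_PF_conditions_D_Y:
  assumes "D_Y \<Phi> = 0"
  shows "mirror_PF_conditions \<Phi> D_Y"
proof -
  have "degree P_Y = 5" by (simp add: P_Y_def)
  moreover have "{..5} = {0, 1, 2, 3, 4, 5 :: nat}" by auto
  ultimately have "theta_degree P_Y = 4"
    by (simp add: theta_degree_def P_Y_def eval_nat_numeral)
  moreover have "coeff P_Y 0 = monom 49 4"
    by (simp add: P_Y_def monom_Suc monom_0 eval_nat_numeral)
  then have "\<exists>c. c \<noteq> 0 \<and> coeff P_Y 0 = monom c 4" by (intro exI[of _ 49]) simp
  ultimately show ?thesis
    unfolding mirror_PF_conditions_def using assms D_Y_eq_normal_op diff_ops_eq_range_normal_op by blast
qed

text \<open>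
  Cross-multiplying with the leading coefficients cancels \<open>\<Theta>\<^sup>4\<close>, and the difference vanishes because it annihilates
  \<open>\<Phi>\<close>.
\<close>

lemma D_Y_unique:
  assumes \<Phi>: "D_Y \<Phi> = 0" "\<Phi> \<noteq> 0" and E: "mirror_PF_conditions \<Phi> E"
  shows "eq_up_to_poly_factor D_Y E"
proof -
  obtain P where P: "E = normal_op P" "theta_degree P = 4" and E0: "E \<Phi> = 0"
    using E by (auto simp: mirror_PF_conditions_def)
  define b where "b j = (\<Sum>k\<le>degree P. monom (coeff (coeff P k) j) k)" for j
  have Ef: "E f = (\<Sum>j\<le>4. fps_of_poly (b j) * (theta ^^ j) f)" for f
    unfolding P(1) b_def by (rule normal_op_eq_theta_sum(1)[OF P(2)])
  have b4: "b 4 \<noteq> 0" unfolding b_def by (rule normal_op_eq_theta_sum(2)[OF P(2)]) simp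
  have a4: "D_Y_theta 4 \<noteq> 0" by (simp add: D_Y_theta_def)
  define d where "d j = b 4 * D_Y_theta j - D_Y_theta 4 * b j" for j
  have diff: "fps_of_poly (b 4) * D_Y f - fps_of_poly (D_Y_theta 4) * E f =
      (\<Sum>j\<le>3. fps_of_poly (d j) * (theta ^^ j) f)" for f
  proof -
    have "fps_of_poly (b 4) * D_Y f - fps_of_poly (D_Y_theta 4) * E f =
        (\<Sum>j\<le>4. fps_of_poly (d j) * (theta ^^ j) f)"
      unfolding D_Y_eq_theta Ef
      by (simp add: d_def fps_of_poly_diff fps_of_poly_mult left_diff_distrib sum_subtractf
          sum_distrib_left mult.assoc)
    also have "\<dots> = (\<Sum>j\<le>3. fps_of_poly (d j) * (theta ^^ j) f)"
    proof (intro sum.mono_neutral_right ballI)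
      fix i :: nat assume "i \<in> {..4} - {..3}"
      then have "i = 4" by auto
      then show "fps_of_poly (d i) * (theta ^^ i) f = 0" by (simp add: d_def)
    qed auto
    finally show ?thesis .
  qed
  have "d j = 0" if "j \<le> 3" for j
    using no_theta_annihilator[OF \<Phi>, of d j] that diff[of \<Phi>] \<Phi>(1) E0 by simp
  then have "fps_of_poly (b 4) * D_Y f = fps_of_poly (D_Y_theta 4) * E f" for f
    using diff[of f] by simp
  then show ?thesis unfolding eq_up_to_poly_factor_def using a4 b4 by blast
qed

theorem proposition3p4:
  shows "D_Y Phi_0 = 0 \<and> is_mirror_Picard_Fuchs_operator Phi_0 D_Y"
proof -
  have "D_Y Phi_0 = 0" by (rule D_Y_annihilates) (rule Phi_0_nth)
  moreover have "fps_nth Phi_0 0 = 1" by (simp add: Phi_0_nth values_at_0)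
  then have "Phi_0 \<noteq> 0" by auto
  ultimately show ?thesis
    using mirror_PF_conditions_D_Y D_Y_unique by (auto simp: is_mirror_Picard_Fuchs_operator_def)
qed

end
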